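(* Let $\nu$ be a Borel probability measure on $\mathbb{R}^d$ whose support lies in the interior of $[0,1]^d$, and assume that there are $a>0$ and $C\ge1$ with $\nu(Q)\le C2^{-ak}$ for all $Q\in\mathcal D_k$, $k\ge0$. Assume that the laws of $X_k$ under $\nu$ converge weakly to a probability measure $\varrho$ as $k\to\infty$. Let $m_\varrho=\min\operatorname{supp}\varrho$ and $M_\varrho=\max\operatorname{supp}\varrho$, and write $h=h(\nu)$ and $D=D_0(\nu)$. Then $0<\sigma_-\le m_\varrho\le M_\varrho\le\sigma_+$ and $$\frac{m_\varrho M_\varrho}{m_\varrho+M_\varrho-h}\le D\le h,\qquad 0\le h-D\le(\sqrt{M_\varrho}-\sqrt{m_\varrho})^2.$$ One has the exact representations $$h-D=\int\frac{(y-D)^2}{y}\,d\varrho(y)=\frac Dh\int\frac{(y-h)^2}{y}\,d\varrho(y).$$ In particular, $$\frac{D}{hM_\varrho}\operatorname{Var}(\varrho)\le h-D\le\frac{D}{hm_\varrho}\operatorname{Var}(\varrho),\qquad \lim_{k\to\infty}\frac{\beta_k''(1)}{k\ln2}=\operatorname{Var}(\varrho).$$ Hence $h=D$ if and only if $\varrho=\delta_h$, equivalently $\beta_k''(1)=o(k)$. If $m_\varrho<M_\varrho$, equality in the lower bound $\frac{m_\varrho M_\varrho}{m_\varrho+M_\varrho-h}\le D$ holds exactly when $\varrho(\{m_\varrho,M_\varrho\})=1$, and the maximal gap $h-D=(\sqrt{M_\varrho}-\sqrt{m_\varrho})^2$ occurs exactly for $$\varrho(\{m_\varrho\})=\frac{\sqrt{m_\varrho}}{\sqrt{m_\varrho}+\sqrt{M_\varrho}},\qquad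 \varrho(\{M_\varrho\})=\frac{\sqrt{M_\varrho}}{\sqrt{m_\varrho}+\sqrt{M_\varrho}}.$$ For a two-point law $\varrho=p\delta_{s_1}+(1-p)\delta_{s_2}$ the first representation reads $$h-D=\frac{p(1-p)(s_1-s_2)^2}{ps_2+(1-p)s_1}.$$ For every interval $[\alpha,\alpha']$ with $[m_\varrho,M_\varrho]\subseteq[\alpha,\alpha']\subset(0,\infty)$ the bounds remain valid with $\alpha,\alpha'$ in place of $m_\varrho,M_\varrho$, that is, $\frac{\alpha\alpha'}{\alpha+\alpha'-h}\le D\le h$, $0\le h-D\le(\sqrt{\alpha'}-\sqrt\alpha)^2$ and $\frac{D}{h\alpha'}\operatorname{Var}(\varrho)\le h-D\le\frac{D}{h\alpha}\operatorname{Var}(\varrho)$; in particular, $$h(\nu)-D_0(\nu)\le(\sqrt{M_\varrho}-\sqrt{m_\varrho})^2\le(\sqrt{\sigma_+}-\sqrt{\sigma_-})^2.$$ If $X_k\to s$ $\nu$-almost everywhere for some function $s$, then $\varrho=s_*\nu$ and $[m_\varrho,M_\varrho]=[\dim_*(\nu),\mathrm{Dim}^*(\nu)]$, so that $$h(\nu)-D_0(\nu)\le\bigl(\sqrt{\mathrm{Dim}^*(\nu)}-\sqrt{\dim_*(\nu)}\bigr)^2\le(\sqrt{\sigma_+}-\sqrt{\sigma_-})^2.$$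
   Context: $\log$ is the logarithm to base 2 and $\ln$ the natural logarithm; $\mathbb{R}^d$ carries the maximum norm. $\mathcal D_k$ is the partition of the root cube $[0,1]^d$ into $2^{dk}$ dyadic cubes of side length $2^{-k}$ (half-open cubes, with the outer boundary faces of $[0,1]^d$ assigned to the adjacent end cubes, so that the partitions are disjoint and nested, $\mathcal D_0=\{[0,1]^d\}$). $Q_k(x)$ is the cube of $\mathcal D_k$ containing $x$; the null set of $x$ with some $\nu(Q_k(x))=0$ is discarded. Local information rates: $X_k(x)=-\frac1k\log\nu(Q_k(x))$. Spectrum: $\beta_k(q)=\frac1k\log\sum_{Q\in\mathcal D_k,\nu(Q)>0}\nu(Q)^q$ for $q\in\mathbb{R}$; $\overline\beta(q)=\limsup_k\beta_k(q)$, finite and convex on $(0,\infty)$; $\sigma_-=-\overline\beta'_+(1)$, $\sigma_+=-\overline\beta'_-(1)$ (one-sided derivatives). $h(\nu)=\lim_k-\frac1k\sum_{Q\in\mathcal D_k}\nu(Q)\log\nu(Q)$ is the entropy dimension, and $D_0(\nu)=\lim_{N\to\infty}\frac{\log N}{-\log\mathfrak e_{N,0}(\nu)}$ the geometric-mean quantization dimension, where $\mathfrak e_{N,0}(\nu)=\inf_{1\le\#A\le N}\exp\bigl(\int\ln d(x,A)\,d\nu(x)\bigr)$, infimum over non-empty finite $A\subset\mathbb{R}^d$, $d(x,A)=\inf_{y\in A}\|x-y\|_\infty$. Under the weak convergence hypothesis of the claim both limits exist, so $h$ and $D$ denote their values. $\dim_*(\nu)=\inf_{\nu(E)>0}\dim_HE$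 (Hausdorff dimension) and $\mathrm{Dim}^*(\nu)=\inf_{\nu(E)=1}\dim_PE$ (packing dimension), infima over Borel sets $E$. *)

theory Defs
  imports "HOL-Probability.Probability" "HOL-Library.Landau_Symbols"
begin

definition msupport :: "'a::topological_space measure \<Rightarrow> 'a set" where
  "msupport \<mu> = {x. \<forall>U. open U \<and> x \<in> U \<longrightarrow> emeasure \<mu> U > 0}"


subsection \<open>Dyadic cubes and local information rates\<close>

text \<open>Half-open intervals, except that the last one also contains its right end point 1.\<close>

definition dyadic_interval :: "nat \<Rightarrow> nat \<Rightarrow> real set" where
  "dyadic_interval k j =
     (if Suc j = 2 ^ k then {real j / 2 ^ k .. 1} else {real j / 2 ^ k ..< real (Suc j) / 2 ^ k})"

definition dyadic_cubes :: "nat \<Rightarrow> (real ^ 'n) set set" where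
  "dyadic_cubes k =
     (\<lambda>j. {x. \<forall>i. x $ i \<in> dyadic_interval k (j i)}) ` {j :: 'n \<Rightarrow> nat. \<forall>i. j i < 2 ^ k}"

definition dyadic_cube_at :: "nat \<Rightarrow> real ^ 'n \<Rightarrow> (real ^ 'n) set" where
  "dyadic_cube_at k x = (THE Q. Q \<in> dyadic_cubes k \<and> x \<in> Q)"

text \<open>
  On the null set where the cube has measure 0, or where the point lies outside the unit cube,
  the value is a dummy.
\<close>

definition info_rate :: "(real ^ 'n) measure \<Rightarrow> nat \<Rightarrow> real ^ 'n \<Rightarrow> real" where
  "info_rate \<nu> k x = - (1 / real k) * log 2 (measure \<nu> (dyadic_cube_at k x))"


subsection \<open>The spectrum and its one-sided derivatives at 1\<close>

definition spectrum :: "(real ^ 'n) measure \<Rightarrow> nat \<Rightarrow> real \<Rightarrow> real" where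
  "spectrum \<nu> k q =
     (1 / real k) * log 2 (\<Sum>Q\<in>{Q \<in> dyadic_cubes k. measure \<nu> Q > 0}. measure \<nu> Q powr q)"

text \<open>
  For a probability measure on the unit cube the upper limit is finite for every \<open>q > 0\<close>, so nothing
  is lost by passing to the reals.
\<close>

definition upper_spectrum :: "(real ^ 'n) measure \<Rightarrow> real \<Rightarrow> real" where
  "upper_spectrum \<nu> q = real_of_ereal (limsup (\<lambda>k. ereal (spectrum \<nu> k q)))"

definition right_deriv :: "(real \<Rightarrow> real) \<Rightarrow> real \<Rightarrow> real" where
  "right_deriv f x = Lim (at_right x) (\<lambda>y. (f y - f x) / (y - x))"

definition left_deriv :: "(real \<Rightarrow> real) \<Rightarrow> real \<Rightarrow> real" where
  "left_deriv f x = Lim (at_left x) (\<lambda>y. (f y - f x) / (y - x))"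

definition sigma_minus :: "(real ^ 'n) measure \<Rightarrow> real" where
  "sigma_minus \<nu> = - right_deriv (upper_spectrum \<nu>) 1"

definition sigma_plus :: "(real ^ 'n) measure \<Rightarrow> real" where
  "sigma_plus \<nu> = - left_deriv (upper_spectrum \<nu>) 1"


subsection \<open>Entropy dimension and geometric-mean quantization dimension\<close>

definition entropy_rate :: "(real ^ 'n) measure \<Rightarrow> nat \<Rightarrow> real" where
  "entropy_rate \<nu> k = - (1 / real k) * (\<Sum>Q\<in>dyadic_cubes k. measure \<nu> Q * log 2 (measure \<nu> Q))"

definition entropy_dim :: "(real ^ 'n) measure \<Rightarrow> real" where
  "entropy_dim \<nu> = lim (entropy_rate \<nu>)"

definition linf_setdist :: "real ^ 'n \<Rightarrow> (real ^ 'n) set \<Rightarrow> real" where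
  "linf_setdist x A = (INF y\<in>A. infnorm (x - y))"

text \<open>
  This is the intended quantity for compactly supported measures whose dyadic cubes satisfy
  \<open>\<nu> Q \<le> C 2\<^sup>-\<^sup>a\<^sup>k\<close> with \<open>a > 0\<close>: these have no atoms, so that the convention
  \<open>ln 0 = 0\<close> only affects a null set, and the logarithmic distance to a finite set is integrable.
\<close>

definition geom_quant_error :: "(real ^ 'n) measure \<Rightarrow> nat \<Rightarrow> real" where
  "geom_quant_error \<nu> N =
     (INF A\<in>{A. finite A \<and> 1 \<le> card A \<and> card A \<le> N}.
        exp (LINT x|\<nu>. ln (linf_setdist x A)))"

definition geom_quant_ratio :: "(real ^ 'n) measure \<Rightarrow> nat \<Rightarrow> real" where
  "geom_quant_ratio \<nu> N = log 2 (real N) / (- log 2 (geom_quant_error \<nu> N))"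

definition geom_quant_dim :: "(real ^ 'n) measure \<Rightarrow> real" where
  "geom_quant_dim \<nu> = lim (geom_quant_ratio \<nu>)"


subsection \<open>Hausdorff and packing dimension with respect to the maximum norm\<close>

definition linf_diam :: "(real ^ 'n) set \<Rightarrow> real" where
  "linf_diam U = (if U = {} then 0 else SUP (x, y)\<in>U \<times> U. infnorm (x - y))"

definition hausdorff_measure :: "real \<Rightarrow> (real ^ 'n) set \<Rightarrow> ennreal" where
  "hausdorff_measure s E =
     (SUP \<delta>\<in>{0 :: real<..}.
        INF U\<in>{U :: nat \<Rightarrow> (real ^ 'n) set. E \<subseteq> (\<Union>i. U i) \<and>
                 (\<forall>i. \<forall>x\<in>U i. \<forall>y\<in>U i. infnorm (x - y) \<le> \<delta>)}.
          \<Sum>i. ennreal (linf_diam (U i) powr s))"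

text \<open>
  Every \<open>s > CARD('n)\<close> is admissible in the infima defining the two dimensions, so they may be
  taken in the reals. Exponent 0 is left out to avoid \<open>0 powr 0 = 0\<close>; this does not
  change the infima.
\<close>

definition hausdorff_dim :: "(real ^ 'n) set \<Rightarrow> real" where
  "hausdorff_dim E = Inf {s. s > 0 \<and> hausdorff_measure s E = 0}"

definition linf_cball :: "real ^ 'n \<Rightarrow> real \<Rightarrow> (real ^ 'n) set" where
  "linf_cball x r = {y. infnorm (x - y) \<le> r}"

text \<open>
  Packings are families of disjoint closed balls with centres in the set. Finite ones suffice, because
  the supremum over countable packings is the supremum over their finite subfamilies.
\<close>

definition linf_packings :: "real \<Rightarrow> (real ^ 'n) set \<Rightarrow> ((real ^ 'n) \<times> real) set set" where
  "linf_packings \<delta> E =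
     {F. finite F \<and> (\<forall>(x, r)\<in>F. x \<in> E \<and> 0 < r \<and> 2 * r \<le> \<delta>) \<and>
         pairwise (\<lambda>(x, r) (y, t). disjnt (linf_cball x r) (linf_cball y t)) F}"

definition packing_premeasure :: "real \<Rightarrow> (real ^ 'n) set \<Rightarrow> ennreal" where
  "packing_premeasure s E =
     (INF \<delta>\<in>{0<..}. SUP F\<in>linf_packings \<delta> E. \<Sum>(x, r)\<in>F. ennreal ((2 * r) powr s))"

definition packing_measure :: "real \<Rightarrow> (real ^ 'n) set \<Rightarrow> ennreal" where
  "packing_measure s E =
     (INF U\<in>{U :: nat \<Rightarrow> (real ^ 'n) set. E \<subseteq> (\<Union>i. U i)}. \<Sum>i. packing_premeasure s (U i))"

definition packing_dim :: "(real ^ 'n) set \<Rightarrow> real" where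
  "packing_dim E = Inf {s. s > 0 \<and> packing_measure s E = 0}"

definition lower_hausdorff_dim :: "(real ^ 'n) measure \<Rightarrow> real" where
  "lower_hausdorff_dim \<nu> = (INF E\<in>{E \<in> sets borel. measure \<nu> E > 0}. hausdorff_dim E)"

definition upper_packing_dim :: "(real ^ 'n) measure \<Rightarrow> real" where
  "upper_packing_dim \<nu> = (INF E\<in>{E \<in> sets borel. measure \<nu> E = 1}. packing_dim E)"

end

theory Submission
  imports Defs
begin

text \<open>
  Let \<open>Y\<close> have law \<open>\<rho>\<close>. Since \<open>C 2\<^sup>-\<^sup>a\<^sup>k\<close> bounds the cube masses and there are at most \<open>2\<^sup>d\<^sup>k\<close>
  cubes, the laws of \<open>X\<^sub>k\<close> have uniformly small tails, so first and second moments converge: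
  \<open>h = E Y\<close>, and \<open>\<beta>\<^sub>k''(1) = k ln 2 Var X\<^sub>k\<close> gives the variance limit.

  The key fact is \<open>1 / D = E (1 / Y)\<close>. With \<open>N = 2\<^sup>n\<close> points, \<open>- log d(x,A)\<close> is essentially the number of
  levels \<open>k\<close> at which \<open>x\<close> lies within \<open>2\<^sup>-\<^sup>k\<close> of \<open>A\<close>. At level \<open>k\<close> the set \<open>A\<close> is close to at most
  \<open>O(2\<^sup>n)\<close> cubes, which carry hardly more than the mass of the cubes of measure at least \<open>2\<^sup>-\<^sup>n\<close>, i.e.
  \<open>P(k X\<^sub>k \<le> n)\<close>; conversely one point in each such cube, for all \<open>k \<le> n / a\<close>, costs only \<open>O(n 2\<^sup>n)\<close>
  points. By weak convergence, \<open>\<Sum>\<^sub>k P(k X\<^sub>k \<le> n)\<close> is \<open>E #{k. k Y \<le> n} = n E (1 / Y)\<close> up to \<open>o(n)\<close>.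

  Writing \<open>\<Sum> \<nu>(Q)\<^sup>1\<^sup>+\<^sup>u = E 2\<^sup>-\<^sup>u\<^sup>k\<^sup>X\<close> with \<open>X = X\<^sub>k\<close> and restricting to \<open>X\<^sub>k \<le> \<lambda>\<close> or \<open>X\<^sub>k > \<lambda>\<close> bounds the
  one-sided derivatives of the spectrum at 1. If \<open>X\<^sub>k \<longlonglongrightarrow> s\<close> almost everywhere, then
  \<open>2\<^sup>-\<^sup>k\<^sup>t \<le> \<nu>(Q\<^sub>k(x)) \<le> 2\<^sup>-\<^sup>k\<^sup>r\<close> eventually whenever \<open>r < s(x) < t\<close>; covering by heavy cubes, the mass distribution
  principle and their packing counterparts identify the two dimensions.

  Everything about the gap is then algebra with \<open>h = E Y\<close> and \<open>1 / D = E (1 / Y)\<close> for \<open>Y\<close> in \<open>[m, M]\<close>.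
\<close>

subsection \<open>Dyadic cubes\<close>

text \<open>Weak convergence compares distribution functions at a fixed argument, whereas the
  quantization sum evaluates them at \<open>n / k\<close>, which moves with the level. It is
  therefore used in the Levy metric: from some level \<open>k0\<close> on, the law of
  \<open>X k\<close> and \<rho> agree at all arguments at once, up to a shift and an error
  \<epsilon>. About \<open>n / a\<close> levels count, so these errors add up to a small multiple of
  \<open>n\<close>, and the levels below \<open>k0\<close> add a constant. The cutoff
  \<open>n / a\<close> is where the bound \<open>C * 2 powr (- a * k)\<close> overtakes the number
  2^n of points; beyond it the mass near \<open>A\<close> decays geometrically.

  For the spectrum, the limit law yields only lower bounds, each from a set of fixed positive mass;
  that the one-sided derivatives exist comes from monotone difference quotients instead.

  The pointwise limit \<open>s\<close> is an arbitrary function that agrees almost everywhere with a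
  Borel one. Its law is therefore taken on the completion of \<nu>, while the sets used for the
  dimensions are built from the measurable version \<open>loc\<close>.\<close>

lemma infnorm_le_iff: "infnorm (x :: real^'n) \<le> r \<longleftrightarrow> (\<forall>i. \<bar>x $ i\<bar> \<le> r)"
proof
  assume "infnorm x \<le> r" thus "\<forall>i. \<bar>x $ i\<bar> \<le> r"
    using component_le_infnorm_cart order_trans by blast
next
  assume "\<forall>i. \<bar>x $ i\<bar> \<le> r"
  thus "infnorm x \<le> r" unfolding infnorm_cart by (intro cSup_least) auto
qed

lemma two_powr_minus_nat: "2 powr (- real k) = (1 :: real) / 2 ^ k"
  by (simp add: powr_minus powr_realpow divide_inverse)

definition unit_cube :: "(real ^ 'n) set" where
  "unit_cube = {x. \<forall>i. 0 \<le> x $ i \<and> x $ i \<le> 1}"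

text \<open>The minimum puts the end point \<open>t = 1\<close> into the last interval.\<close>

definition dyadic_index :: "nat \<Rightarrow> real \<Rightarrow> nat" where
  "dyadic_index k t = min (nat \<lfloor>t * 2 ^ k\<rfloor>) (2 ^ k - 1)"

definition indexed_cube :: "nat \<Rightarrow> ('n \<Rightarrow> nat) \<Rightarrow> (real ^ 'n) set" where
  "indexed_cube k j = {x. \<forall>i. x $ i \<in> dyadic_interval k (j i)}"

lemma dyadic_index_less: "dyadic_index k t < 2 ^ k"
proof -
  have "(2::nat) ^ k > 0" by simp
  thus ?thesis unfolding dyadic_index_def by linarith
qed

text \<open>On the unit interval the intervals of one level are the fibres of
  \<open>dyadic_index k\<close>. Existence, uniqueness and disjointness of cubes then become facts
  about functions.\<close>

lemma mem_dyadic_interval_iff: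
  assumes "0 \<le> t" "t \<le> 1" "j < 2 ^ k"
  shows "t \<in> dyadic_interval k j \<longleftrightarrow> j = dyadic_index k t"
proof -
  have le: "t * 2 ^ k \<le> 2 ^ k" using assms by simp
  show ?thesis
  proof (cases "Suc j = 2 ^ k")
    case True
    have j: "j = 2 ^ k - 1" using True by simp
    have "t \<in> dyadic_interval k j \<longleftrightarrow> real j \<le> t * 2 ^ k"
      using True assms by (simp add: dyadic_interval_def field_simps)
    also have "\<dots> \<longleftrightarrow> j \<le> nat \<lfloor>t * 2 ^ k\<rfloor>"
      using assms by (simp add: le_nat_floor nat_floor_neg le_nat_iff le_floor_iff)
    also have "\<dots> \<longleftrightarrow> j = dyadic_index k t"
      unfolding dyadic_index_def j by (auto simp: min_def)
    finally show ?thesis .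
  next
    case False
    hence j: "j < 2 ^ k - 1" using assms by simp
    have "t \<in> dyadic_interval k j \<longleftrightarrow> real j \<le> t * 2 ^ k \<and> t * 2 ^ k < real j + 1"
      using False by (simp add: dyadic_interval_def field_simps)
    also have "\<dots> \<longleftrightarrow> \<lfloor>t * 2 ^ k\<rfloor> = int j"
      by (auto simp: floor_eq_iff)
    also have "\<dots> \<longleftrightarrow> nat \<lfloor>t * 2 ^ k\<rfloor> = j"
      using assms by (simp add: nat_eq_iff) 
    also have "\<dots> \<longleftrightarrow> j = dyadic_index k t"
      unfolding dyadic_index_def using j by (auto simp: min_def)
    finally show ?thesis .
  qed
qed

lemma dyadic_interval_subset:
  assumes "j < 2 ^ k" shows "dyadic_interval k j \<subseteq> {0..1}"
proof -
  have "real (Suc j) \<le> 2 ^ k" using assms by (metis Suc_leI of_nat_le_iff of_nat_numeral of_nat_power)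
  moreover have "0 \<le> real j / 2 ^ k" by simp
  moreover have "real (Suc j) / 2 ^ k \<le> 1" using calculation by simp
  ultimately have "0 \<le> t \<and> t \<le> 1" if "t \<in> dyadic_interval k j" for t
    using that order_trans[of 0 "real j / 2 ^ k" t] order_trans[of t "real (Suc j) / 2 ^ k" 1]
    unfolding dyadic_interval_def by (auto simp del: of_nat_Suc split: if_splits)
  thus ?thesis by auto
qed

lemma dyadic_cubes_eq: "dyadic_cubes k = indexed_cube k ` {j. \<forall>i. j i < 2 ^ k}"
  unfolding dyadic_cubes_def indexed_cube_def ..

lemma mem_indexed_cube_iff:
  assumes "\<forall>i. j i < 2 ^ k"
  shows "x \<in> indexed_cube k j \<longleftrightarrow> x \<in> unit_cube \<and> j = (\<lambda>i. dyadic_index k (x $ i))"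
proof -
  have "x \<in> indexed_cube k j \<Longrightarrow> x \<in> unit_cube"
  proof -
    assume "x \<in> indexed_cube k j"
    hence "x $ i \<in> {0..1}" for i
      using dyadic_interval_subset[of "j i" k] assms unfolding indexed_cube_def by blast
    thus "x \<in> unit_cube" by (simp add: unit_cube_def)
  qed
  moreover have "x \<in> indexed_cube k j \<longleftrightarrow> j = (\<lambda>i. dyadic_index k (x $ i))" if "x \<in> unit_cube"
    using that assms unfolding indexed_cube_def unit_cube_def
    by (auto simp: mem_dyadic_interval_iff fun_eq_iff)
  ultimately show ?thesis by blast
qed

lemma dyadic_cube_at_eq:
  assumes "x \<in> unit_cube"
  shows "dyadic_cube_at k x = {y \<in> unit_cube. \<forall>i. dyadic_index k (y $ i) = dyadic_index k (x $ i)}" (is "_ = ?R")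
    and "dyadic_cube_at k x \<in> dyadic_cubes k"
proof -
  let ?j = "\<lambda>i. dyadic_index k (x $ i)"
  have R: "?R = indexed_cube k ?j"
    using dyadic_index_less by (auto simp: mem_indexed_cube_iff fun_eq_iff)
  have 1: "indexed_cube k ?j \<in> dyadic_cubes k" unfolding dyadic_cubes_eq using dyadic_index_less by blast
  have "dyadic_cube_at k x = indexed_cube k ?j"
    unfolding dyadic_cube_at_def
  proof (rule the_equality)
    show "indexed_cube k ?j \<in> dyadic_cubes k \<and> x \<in> indexed_cube k ?j"
      using 1 assms dyadic_index_less by (auto simp: mem_indexed_cube_iff)
    fix Q assume "Q \<in> dyadic_cubes k \<and> x \<in> Q"
    then obtain j where "\<forall>i. j i < 2 ^ k" "Q = indexed_cube k j" "x \<in> indexed_cube k j"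
      unfolding dyadic_cubes_eq by auto
    thus "Q = indexed_cube k ?j" using mem_indexed_cube_iff[of j k x] by simp
  qed
  thus "dyadic_cube_at k x = ?R" "dyadic_cube_at k x \<in> dyadic_cubes k" using R 1 by auto
qed

lemma mem_dyadic_cube_at: "x \<in> unit_cube \<Longrightarrow> x \<in> dyadic_cube_at k x"
  by (simp add: dyadic_cube_at_eq)

lemma dyadic_cube_subset_unit: "Q \<in> dyadic_cubes k \<Longrightarrow> Q \<subseteq> unit_cube"
  unfolding dyadic_cubes_eq by (auto simp: mem_indexed_cube_iff)

lemma dyadic_cube_at_unique: 
  assumes "Q \<in> dyadic_cubes k" "x \<in> Q" shows "dyadic_cube_at k x = Q"
proof -
  have "x \<in> unit_cube" using assms dyadic_cube_subset_unit by blast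
  thus ?thesis using assms unfolding dyadic_cubes_eq 
    by (auto simp: mem_indexed_cube_iff dyadic_cube_at_eq fun_eq_iff)
qed

lemma Union_dyadic_cubes: "\<Union>(dyadic_cubes k) = unit_cube"
  using dyadic_cube_subset_unit mem_dyadic_cube_at dyadic_cube_at_eq(2) by blast

lemma finite_index_funs: "finite {j :: 'n::finite \<Rightarrow> nat. \<forall>i. j i < c}" "card {j :: 'n::finite \<Rightarrow> nat. \<forall>i. j i < c} = c ^ CARD('n)"
proof -
  have "{j :: 'n::finite \<Rightarrow> nat. \<forall>i. j i < c} = UNIV \<rightarrow>\<^sub>E {..<c}" by auto
  thus "finite {j :: 'n::finite \<Rightarrow> nat. \<forall>i. j i < c}" "card {j :: 'n::finite \<Rightarrow> nat. \<forall>i. j i < c} = c ^ CARD('n)"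
    by (simp_all add: finite_PiE card_PiE)
qed

lemma finite_dyadic_cubes: "finite (dyadic_cubes k :: (real^'n) set set)"
  unfolding dyadic_cubes_eq using finite_index_funs by blast

lemma card_dyadic_cubes: "card (dyadic_cubes k :: (real^'n) set set) \<le> 2 ^ (CARD('n) * k)"
proof -
  have "card (dyadic_cubes k :: (real^'n) set set) \<le> card {j :: 'n \<Rightarrow> nat. \<forall>i. j i < 2 ^ k}"
    unfolding dyadic_cubes_eq by (rule card_image_le[OF finite_index_funs(1)])
  also have "\<dots> = 2 ^ (CARD('n) * k)"
    unfolding finite_index_funs(2) power_mult[symmetric] by (simp add: mult.commute)
  finally show ?thesis .
qed

lemma borel_dyadic_cube: "Q \<in> dyadic_cubes k \<Longrightarrow> Q \<in> sets borel"
proof -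
  assume "Q \<in> dyadic_cubes k"
  then obtain j where Q: "Q = indexed_cube k j" unfolding dyadic_cubes_eq by blast
  have [measurable]: "dyadic_interval k n \<in> sets borel" for n
    unfolding dyadic_interval_def by (cases "Suc n = 2 ^ k") auto
  have "Q = (\<Inter>i\<in>UNIV. (\<lambda>x. x $ i) -` dyadic_interval k (j i) \<inter> space borel)"
    unfolding Q indexed_cube_def by auto
  also have "\<dots> \<in> sets borel"
    by (intro sets.finite_INT measurable_sets[OF borel_measurable_nth] \<open>dyadic_interval k _ \<in> _\<close>) auto
  finally show ?thesis .
qed

lemma borel_unit_cube: "unit_cube \<in> sets borel"
  unfolding Union_dyadic_cubes[of 0, symmetric]
  by (intro sets.finite_Union finite_dyadic_cubes subsetI borel_dyadic_cube)

text \<open>The strict upper bound can fail only in the closed last interval, at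
  \<open>t = 1\<close>. The separation arguments need strictness, and they always have a larger
  index at hand that excludes this interval.\<close>

lemma dyadic_index_bounds:
  assumes "0 \<le> t" "t \<le> 1"
  shows "real (dyadic_index k t) \<le> t * 2 ^ k" "t * 2 ^ k \<le> real (dyadic_index k t) + 1"
    "Suc (dyadic_index k t) < 2 ^ k \<Longrightarrow> t * 2 ^ k < real (dyadic_index k t) + 1"
proof -
  have "t \<in> dyadic_interval k (dyadic_index k t)"
    using assms by (simp add: mem_dyadic_interval_iff dyadic_index_less)
  hence "real (dyadic_index k t) \<le> t * 2 ^ k \<and> t * 2 ^ k \<le> real (dyadic_index k t) + 1 \<and>
    (Suc (dyadic_index k t) < 2 ^ k \<longrightarrow> t * 2 ^ k < real (dyadic_index k t) + 1)"
  proof (cases "Suc (dyadic_index k t) = 2 ^ k")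
    case True
    hence "real (dyadic_index k t) + 1 = 2 ^ k"
      by (metis Suc_eq_plus1 of_nat_1 of_nat_add of_nat_numeral of_nat_power)
    moreover have "t * 2 ^ k \<le> 2 ^ k" using assms by simp
    ultimately show ?thesis using True \<open>t \<in> _\<close> by (simp add: dyadic_interval_def field_simps)
  qed (auto simp: dyadic_interval_def field_simps)
  thus "real (dyadic_index k t) \<le> t * 2 ^ k" "t * 2 ^ k \<le> real (dyadic_index k t) + 1"
    "Suc (dyadic_index k t) < 2 ^ k \<Longrightarrow> t * 2 ^ k < real (dyadic_index k t) + 1" by blast+
qed

lemma infnorm_dyadic_cube_at:
  assumes "x \<in> unit_cube" "y \<in> dyadic_cube_at k x"
  shows "infnorm (x - y) \<le> 1 / 2 ^ k"
  unfolding infnorm_le_iff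
proof
  fix i
  have b: "0 \<le> x $ i" "x $ i \<le> 1" "0 \<le> y $ i" "y $ i \<le> 1" "dyadic_index k (y $ i) = dyadic_index k (x $ i)"
    using assms by (auto simp: dyadic_cube_at_eq) (auto simp: unit_cube_def)
  have "\<bar>x $ i * 2 ^ k - y $ i * 2 ^ k\<bar> \<le> 1"
    using dyadic_index_bounds[OF b(1,2), of k] dyadic_index_bounds[OF b(3,4), of k] b(5) by simp
  hence "\<bar>x $ i - y $ i\<bar> * 2 ^ k \<le> 1" by (simp add: abs_mult left_diff_distrib[symmetric])
  thus "\<bar>(x - y) $ i\<bar> \<le> 1 / 2 ^ k" by (simp add: field_simps)
qed

lemma infnorm_dyadic_cube:
  assumes "Q \<in> dyadic_cubes k" "x \<in> Q" "y \<in> Q"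
  shows "infnorm (x - y) \<le> 1 / 2 ^ k"
  using assms infnorm_dyadic_cube_at[of x y k] dyadic_cube_at_unique[of Q k x] dyadic_cube_subset_unit by blast

lemma dyadic_index_diff:
  assumes "0 \<le> s" "s \<le> 1" "0 \<le> t" "t \<le> 1" "\<bar>s - t\<bar> \<le> 2 / 2 ^ k"
  shows "dyadic_index k t \<le> dyadic_index k s + 2"
proof (rule ccontr)
  assume "\<not> ?thesis"
  hence g: "dyadic_index k s + 3 \<le> dyadic_index k t" by simp
  \<comment> \<open>A larger index exists, so \<open>s\<close> is not in the closed last interval
    and the strict bound applies.\<close>
  hence "s * 2 ^ k < real (dyadic_index k s) + 1"
    using dyadic_index_less[of k t] assms by (intro dyadic_index_bounds) auto
  moreover have "real (dyadic_index k t) \<le> t * 2 ^ k" using assms dyadic_index_bounds by blast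
  moreover have "real (dyadic_index k s) + 3 \<le> real (dyadic_index k t)" using g by linarith
  ultimately have "(t - s) * 2 ^ k > 2" by (simp add: left_diff_distrib)
  thus False using assms by (simp add: field_simps abs_le_iff)
qed

text \<open>Seen from one point of \<open>U\<close>, every coordinate index varies by at most 2 in
  either direction, which leaves 5 values. The diameter \<open>2 / 2 ^ k\<close> is that of a ball
  of radius \<open>1 / 2 ^ k\<close>, the case needed near a quantizer.\<close>

lemma card_cubes_meeting:
  fixes U :: "(real ^ 'n) set"
  assumes "\<And>x y. x \<in> U \<Longrightarrow> y \<in> U \<Longrightarrow> infnorm (x - y) \<le> 2 / 2 ^ k"
  shows "card {Q \<in> dyadic_cubes k. Q \<inter> U \<noteq> {}} \<le> 5 ^ CARD('n)"
proof (cases "U \<inter> unit_cube = {}")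
  case True
  hence "{Q \<in> dyadic_cubes k. Q \<inter> U \<noteq> {}} = {}" using dyadic_cube_subset_unit by blast
  thus ?thesis by (metis card.empty le0)
next
  case False
  then obtain z where z: "z \<in> U" "z \<in> unit_cube" by blast
  \<comment> \<open>Offsets -2..2 from the index of \<open>z\<close> are stored as 0..4. Only a
    superset of the cubes is wanted, so tuples at which the subtraction truncates do no
    harm.\<close>
  let ?g = "\<lambda>j. indexed_cube k (\<lambda>i. j i + dyadic_index k (z $ i) - 2)"
  have "{Q \<in> dyadic_cubes k. Q \<inter> U \<noteq> {}} \<subseteq> ?g ` {j. \<forall>i. j i < 5}"
  proof
    fix Q assume "Q \<in> {Q \<in> dyadic_cubes k. Q \<inter> U \<noteq> {}}"
    then obtain x j where x: "x \<in> U" "x \<in> Q" and j: "\<forall>i. j i < 2 ^ k" "Q = indexed_cube k j"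
      unfolding dyadic_cubes_eq by auto
    have xj: "x \<in> unit_cube" "j = (\<lambda>i. dyadic_index k (x $ i))"
      using x j mem_indexed_cube_iff by blast+
    have le: "dyadic_index k (x $ i) \<le> dyadic_index k (z $ i) + 2 \<and> dyadic_index k (z $ i) \<le> dyadic_index k (x $ i) + 2" for i
    proof -
      have "\<bar>(x - z) $ i\<bar> \<le> 2 / 2 ^ k"
        using assms[OF x(1) z(1)] infnorm_le_iff by blast
      moreover have "\<bar>z $ i - x $ i\<bar> = \<bar>(x - z) $ i\<bar>" "\<bar>x $ i - z $ i\<bar> = \<bar>(x - z) $ i\<bar>" by simp_all
      ultimately show ?thesis using z(2) xj(1) unfolding unit_cube_def
        by (intro conjI dyadic_index_diff) (simp_all del: vector_minus_component)
    qed
    have "Q = ?g (\<lambda>i. j i + 2 - dyadic_index k (z $ i))"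
      using le unfolding j(2) xj(2) by simp
    moreover have "\<forall>i. j i + 2 - dyadic_index k (z $ i) < 5"
    proof
      fix i show "j i + 2 - dyadic_index k (z $ i) < 5"
        using le[of i] unfolding xj(2) by linarith
    qed
    ultimately show "Q \<in> ?g ` {j. \<forall>i. j i < 5}"
      by (intro image_eqI[where x="\<lambda>i. j i + 2 - dyadic_index k (z $ i)"]) auto
  qed
  hence "card {Q \<in> dyadic_cubes k. Q \<inter> U \<noteq> {}} \<le> card {j :: 'n \<Rightarrow> nat. \<forall>i. j i < 5}"
    using finite_index_funs(1)[where 'n='n and c=5] by (meson card_image_le card_mono finite_imageI le_trans)
  thus ?thesis using finite_index_funs(2)[where 'n='n and c=5] by simp
qed

text \<open>Distinct indices of equal parity differ by at least 2, so a full interval lies between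
  the two points. The strict inequality is what makes closed balls of radius half of 2^(-k) around
  them disjoint.\<close>

lemma infnorm_parity_class:
  assumes "x \<in> unit_cube" "y \<in> unit_cube" "dyadic_cube_at k x \<noteq> dyadic_cube_at k y"
    and "\<And>i. even (dyadic_index k (x $ i)) \<longleftrightarrow> even (dyadic_index k (y $ i))"
  shows "infnorm (x - y) > 1 / 2 ^ k"
proof -
  obtain i where i: "dyadic_index k (x $ i) \<noteq> dyadic_index k (y $ i)"
    using assms(1-3) unfolding dyadic_cube_at_eq(1)[OF assms(1)] dyadic_cube_at_eq(1)[OF assms(2)] by force
  have *: "\<bar>s - t\<bar> > 1 / 2 ^ k" if "dyadic_index k s < dyadic_index k t" "even (dyadic_index k s) \<longleftrightarrow> even (dyadic_index k t)"
    "0 \<le> s" "s \<le> 1" "0 \<le> t" "t \<le> 1" for s t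
  proof -
    have g: "dyadic_index k s + 2 \<le> dyadic_index k t"
      using that(1,2) by presburger
    hence "s * 2 ^ k < real (dyadic_index k s) + 1"
      using dyadic_index_less[of k t] that by (intro dyadic_index_bounds) auto
    moreover have "real (dyadic_index k t) \<le> t * 2 ^ k" using that dyadic_index_bounds by blast
    moreover have "real (dyadic_index k s) + 2 \<le> real (dyadic_index k t)" using g by linarith
    ultimately have "(t - s) * 2 ^ k > 1" by (simp add: left_diff_distrib)
    hence "t - s > 1 / 2 ^ k" by (simp add: field_simps)
    thus ?thesis by linarith
  qed
  have "\<bar>x $ i - y $ i\<bar> > 1 / 2 ^ k"
  proof (cases "dyadic_index k (x $ i) < dyadic_index k (y $ i)")
    case True thus ?thesis using assms *[of "x $ i" "y $ i"] by (auto simp: unit_cube_def)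
  next
    case False thus ?thesis using i assms *[of "y $ i" "x $ i"] by (auto simp: unit_cube_def abs_minus_commute)
  qed
  thus ?thesis using component_le_infnorm_cart[of "x - y" i] by simp
qed

subsection \<open>Measures with polynomially small dyadic cubes\<close>

text \<open>By the Lindelof property, countably many null open sets already exhaust the complement
  of the support.\<close>

lemma emeasure_msupport_compl:
  fixes \<mu> :: "'a::second_countable_topology measure"
  assumes "sets \<mu> = sets borel"
  shows "emeasure \<mu> (- msupport \<mu>) = 0" and closed_msupport: "closed (msupport \<mu>)"
proof -
  let ?F = "{U. open U \<and> emeasure \<mu> U = 0}"
  have eq: "- msupport \<mu> = \<Union>?F"
    unfolding msupport_def by (auto simp: zero_less_iff_neq_zero)
  obtain F' where F': "F' \<subseteq> ?F" "countable F'" "\<Union>F' = \<Union>?F"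
    using Lindelof[of ?F] by (metis (mono_tags, lifting) mem_Collect_eq)
  have "(\<Union>U\<in>F'. U) \<in> null_sets \<mu>"
    using F' assms by (intro null_sets_UN') (auto simp: null_sets_def)
  thus "emeasure \<mu> (- msupport \<mu>) = 0"
    using eq F'(3) by auto
  have "open (- msupport \<mu>)" unfolding eq by (intro open_Union) auto
  thus "closed (msupport \<mu>)" by (simp add: closed_def)
qed

text \<open>With the discrete space of cubes as target, any function of the cube becomes measurable
  by composition. Outside the unit cube the definite description has no candidate, hence is one and
  the same dummy \<open>c\<close> for all points.\<close>

lemma measurable_dyadic_cube_at [measurable]:
  "dyadic_cube_at k \<in> measurable borel (count_space (UNIV :: (real ^ 'n) set set))"
proof (rule measurableI)
  fix A :: "(real ^ 'n) set set"
  define c :: "(real ^ 'n) set" where "c = (THE Q. False)"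
  have out: "dyadic_cube_at k x = c" if "x \<notin> unit_cube" for x
  proof -
    have "(\<lambda>Q. Q \<in> dyadic_cubes k \<and> x \<in> Q) = (\<lambda>Q. False)"
      using that dyadic_cube_subset_unit by blast
    thus ?thesis unfolding dyadic_cube_at_def c_def by simp
  qed
  have "dyadic_cube_at k -` A \<inter> space borel = \<Union>{Q \<in> dyadic_cubes k. Q \<in> A} \<union> (if c \<in> A then - unit_cube else {})"
    (is "?L = ?R")
  proof (intro set_eqI)
    fix x show "x \<in> ?L \<longleftrightarrow> x \<in> ?R"
    proof (cases "x \<in> unit_cube")
      case True
      have "Q = dyadic_cube_at k x" if "Q \<in> dyadic_cubes k" "x \<in> Q" for Q
        using dyadic_cube_at_unique[OF that] by simp
      thus ?thesis using dyadic_cube_at_eq(2)[OF True] mem_dyadic_cube_at[OF True] True by auto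
    next
      case False
      thus ?thesis using out[OF False] dyadic_cube_subset_unit by auto
    qed
  qed
  also have "\<dots> \<in> sets borel"
    using borel_unit_cube finite_dyadic_cubes[of k] borel_dyadic_cube
    by (intro sets.Un sets.finite_Union) (auto intro: borel_comp)
  finally show "dyadic_cube_at k -` A \<inter> space borel \<in> sets borel" .
qed auto

section \<open>Integration of functions of the dyadic cube\<close>

locale dyadic_measure = prob_space \<nu> for \<nu> :: "(real ^ 'n) measure" +
  fixes a C :: real
  assumes sets_eq [measurable_cong]: "sets \<nu> = sets borel"
    and support: "msupport \<nu> \<subseteq> unit_cube"
    and a_pos: "a > 0" and C_ge: "C \<ge> 1"
    and mass_le: "Q \<in> dyadic_cubes k \<Longrightarrow> measure \<nu> Q \<le> C * 2 powr (- a * real k)"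
begin

abbreviation mass :: "nat \<Rightarrow> real ^ 'n \<Rightarrow> real" where
  "mass k x \<equiv> measure \<nu> (dyadic_cube_at k x)"

lemma space_eq: "space \<nu> = UNIV"
  using sets_eq_imp_space_eq[OF sets_eq] by simp

lemma AE_unit_cube: "AE x in \<nu>. x \<in> unit_cube"
proof (rule AE_I[where N="- msupport \<nu>"])
  show "emeasure \<nu> (- msupport \<nu>) = 0" by (rule emeasure_msupport_compl(1)[OF sets_eq])
  show "- msupport \<nu> \<in> sets \<nu>"
    using closed_msupport[OF sets_eq] by (simp add: sets_eq closed_def)
  show "{x \<in> space \<nu>. x \<notin> unit_cube} \<subseteq> - msupport \<nu>" using support by auto
qed

lemma measurable_cube_at [measurable]: "dyadic_cube_at k \<in> measurable \<nu> (count_space UNIV)"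
  using measurable_cong_sets[OF sets_eq refl] measurable_dyadic_cube_at by blast

lemma measurable_cube_fun: "(\<lambda>x. f (dyadic_cube_at k x)) \<in> measurable \<nu> N" if "range f \<subseteq> space N"
  using measurable_compose[OF measurable_cube_at, of f N k] that by (auto simp: measurable_def)

lemma borel_cube_fun: "(\<lambda>x. f (dyadic_cube_at k x) :: real) \<in> borel_measurable \<nu>"
  by (rule measurable_cube_fun) simp

lemma borel_info_rate [measurable]: "info_rate \<nu> k \<in> borel_measurable \<nu>"
  unfolding info_rate_def by (intro borel_cube_fun)

lemma cubes_measurable: "Q \<in> dyadic_cubes k \<Longrightarrow> Q \<in> sets \<nu>"
  using borel_dyadic_cube sets_eq by blast

text \<open>Almost everywhere such a function is a finite combination of cube indicators.
  Integrability is thus automatic, and expectations of rates, entropies and partition sums are all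
  the same finite sums.\<close>

lemma integral_cube_fun:
  fixes f :: "(real ^ 'n) set \<Rightarrow> real"
  shows "integrable \<nu> (\<lambda>x. f (dyadic_cube_at k x))"
    and "(LINT x|\<nu>. f (dyadic_cube_at k x)) = (\<Sum>Q\<in>dyadic_cubes k. f Q * measure \<nu> Q)"
proof -
  let ?g = "\<lambda>x. \<Sum>Q\<in>dyadic_cubes k. f Q * indicator Q x"
  have eq: "f (dyadic_cube_at k x) = ?g x" if "x \<in> unit_cube" for x
  proof -
    have "?g x = (\<Sum>Q\<in>dyadic_cubes k. if Q = dyadic_cube_at k x then f Q else 0)"
      using dyadic_cube_at_unique mem_dyadic_cube_at[OF that]
      by (intro sum.cong) (auto simp: indicator_def)
    also have "\<dots> = f (dyadic_cube_at k x)"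
      using dyadic_cube_at_eq(2)[OF that] by (subst sum.delta[OF finite_dyadic_cubes]) simp
    finally show ?thesis ..
  qed
  have ae: "AE x in \<nu>. f (dyadic_cube_at k x) = ?g x"
    using AE_unit_cube by eventually_elim (rule eq)
  have int: "integrable \<nu> (\<lambda>x. f Q * indicator Q x)" if "Q \<in> dyadic_cubes k" for Q
  proof -
    have "emeasure \<nu> Q < \<infinity>" by (simp add: emeasure_eq_measure)
    thus ?thesis using cubes_measurable[OF that] by (intro integrable_mult_right integrable_real_indicator)
  qed
  have mg: "?g \<in> borel_measurable \<nu>" using borel_measurable_integrable[OF int] by (rule borel_measurable_sum)
  show "integrable \<nu> (\<lambda>x. f (dyadic_cube_at k x))"
    by (subst integrable_cong_AE[OF borel_cube_fun mg ae]) (rule Bochner_Integration.integrable_sum[OF int])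
  have "(LINT x|\<nu>. f (dyadic_cube_at k x)) = (LINT x|\<nu>. ?g x)"
    by (rule integral_cong_AE[OF borel_cube_fun mg ae])
  also have "\<dots> = (\<Sum>Q\<in>dyadic_cubes k. LINT x|\<nu>. f Q * indicator Q x)"
    by (rule Bochner_Integration.integral_sum[OF int])
  also have "\<dots> = (\<Sum>Q\<in>dyadic_cubes k. f Q * measure \<nu> Q)"
    by (intro sum.cong) (auto simp: space_eq)
  finally show "(LINT x|\<nu>. f (dyadic_cube_at k x)) = (\<Sum>Q\<in>dyadic_cubes k. f Q * measure \<nu> Q)" .
qed

lemma sum_cubes: "(\<Sum>Q\<in>dyadic_cubes k. measure \<nu> Q) = 1"
  using integral_cube_fun(2)[of "\<lambda>_. 1" k] by (simp add: prob_space)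

lemma prob_cube_pred:
  "measure \<nu> {x. P (dyadic_cube_at k x)} = (\<Sum>Q\<in>{Q \<in> dyadic_cubes k. P Q}. measure \<nu> Q)"
proof -
  have "dyadic_cube_at k -` Collect P \<inter> space \<nu> \<in> sets \<nu>"
    by (rule measurable_sets[OF measurable_cube_at]) simp
  moreover have "dyadic_cube_at k -` Collect P \<inter> space \<nu> = {x. P (dyadic_cube_at k x)}"
    by (auto simp: space_eq)
  ultimately have "measure \<nu> {x. P (dyadic_cube_at k x)} = (LINT x|\<nu>. indicator {x. P (dyadic_cube_at k x)} x)"
    by (simp add: space_eq)
  also have "\<dots> = (LINT x|\<nu>. (if P (dyadic_cube_at k x) then 1 else 0))"
    by (intro Bochner_Integration.integral_cong) (auto simp: indicator_def)
  also have "\<dots> = (\<Sum>Q\<in>dyadic_cubes k. (if P Q then 1 else 0) * measure \<nu> Q)"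
    by (rule integral_cube_fun(2))
  also have "\<dots> = (\<Sum>Q\<in>dyadic_cubes k. if P Q then measure \<nu> Q else 0)"
    by (intro sum.cong) auto
  also have "\<dots> = (\<Sum>Q\<in>{Q \<in> dyadic_cubes k. P Q}. measure \<nu> Q)"
    by (rule sum.inter_filter[OF finite_dyadic_cubes, symmetric])
  finally show ?thesis .
qed

lemma AE_mass_pos: "AE x in \<nu>. \<forall>k. mass k x > 0"
  unfolding AE_all_countable
proof
  fix k
  have "measure \<nu> {x. measure \<nu> (dyadic_cube_at k x) = 0} = 0"
    by (subst prob_cube_pred[where P="\<lambda>Q. measure \<nu> Q = 0"]) simp
  moreover have "{x \<in> space \<nu>. mass k x = 0} \<in> sets \<nu>" by measurable
  ultimately have "AE x in \<nu>. x \<notin> {x. mass k x = 0}"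
    by (intro AE_not_in) (auto simp: null_sets_def emeasure_eq_measure space_eq)
  thus "AE x in \<nu>. mass k x > 0"
    by eventually_elim (simp add: zero_less_measure_iff)
qed

text \<open>The full-measure set on which no logarithm of a cube mass takes a default value.\<close>

definition good :: "(real ^ 'n) set" where
  "good = {x \<in> unit_cube. \<forall>k. mass k x > 0}"

lemma AE_good: "AE x in \<nu>. x \<in> good"
  using AE_unit_cube AE_mass_pos by eventually_elim (simp add: good_def)

lemma good_measurable [measurable]: "good \<in> sets \<nu>"
proof -
  have "{x \<in> space \<nu>. \<forall>k. mass k x > 0} \<in> sets \<nu>" by measurable
  moreover have "unit_cube \<in> sets \<nu>" using borel_unit_cube sets_eq by blast
  ultimately have "unit_cube \<inter> {x \<in> space \<nu>. \<forall>k. mass k x > 0} \<in> sets \<nu>" by blast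
  moreover have "unit_cube \<inter> {x \<in> space \<nu>. \<forall>k. mass k x > 0} = good" by (auto simp: good_def space_eq)
  ultimately show ?thesis by simp
qed

lemma good_unit: "x \<in> good \<Longrightarrow> x \<in> unit_cube" by (simp add: good_def)
lemma good_mass: "x \<in> good \<Longrightarrow> mass k x > 0" by (simp add: good_def)

lemma mass_eq_powr:
  assumes "x \<in> good" "k > 0"
  shows "mass k x = 2 powr (- real k * info_rate \<nu> k x)"
  using assms good_mass[OF assms(1), of k] unfolding info_rate_def by simp

lemma mass_le_bound: "x \<in> unit_cube \<Longrightarrow> mass k x \<le> C * 2 powr (- a * real k)"
  using dyadic_cube_at_eq(2) mass_le by blast

lemma info_rate_ge:
  assumes "x \<in> good" "k > 0"
  shows "info_rate \<nu> k x \<ge> a - log 2 C / real k"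
proof -
  have "log 2 (mass k x) \<le> log 2 (C * 2 powr (- a * real k))"
    using assms good_mass mass_le_bound good_unit C_ge by simp
  also have "\<dots> = log 2 C - a * real k" using C_ge by (simp add: log_mult)
  finally have "log 2 (mass k x) / real k \<le> (log 2 C - a * real k) / real k"
    using assms by (intro divide_right_mono) auto
  thus ?thesis unfolding info_rate_def using assms by (simp add: diff_divide_distrib)
qed

lemma info_rate_nonneg: "info_rate \<nu> k x \<ge> 0"
proof -
  \<comment> \<open>For a cube of mass 0 this holds through the convention
    \<open>log 2 0 = 0\<close>.\<close>
  have "log 2 (mass k x) \<le> 0"
    by (cases "mass k x = 0") (auto simp: log_def ln_le_zero_iff zero_less_measure_iff divide_nonpos_pos)
  thus ?thesis unfolding info_rate_def by (simp add: divide_nonpos_nonneg)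
qed

text \<open>Markov's inequality in counting form. It limits both the size of the quantizer made of
  heavy cubes and the covers that bound the Hausdorff dimension from above.\<close>

lemma card_heavy_cubes:
  assumes "c > 0"
  shows "real (card {Q \<in> dyadic_cubes k. measure \<nu> Q \<ge> c}) \<le> 1 / c"
proof -
  have "real (card {Q \<in> dyadic_cubes k. measure \<nu> Q \<ge> c}) * c \<le> (\<Sum>Q\<in>{Q \<in> dyadic_cubes k. measure \<nu> Q \<ge> c}. measure \<nu> Q)"
    using sum_bounded_below[of "{Q \<in> dyadic_cubes k. measure \<nu> Q \<ge> c}" c "measure \<nu>"] by auto
  also have "\<dots> \<le> (\<Sum>Q\<in>dyadic_cubes k. measure \<nu> Q)"
    using finite_dyadic_cubes by (intro sum_mono2) auto
  finally show ?thesis using assms by (simp add: sum_cubes field_simps)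
qed

lemma measure_le_sum_meeting:
  assumes "S \<in> sets \<nu>" and "\<Q> \<subseteq> dyadic_cubes k" and "S \<inter> good \<subseteq> \<Union>\<Q>"
  shows "measure \<nu> S \<le> (\<Sum>Q\<in>\<Q>. measure \<nu> Q)"
proof -
  have fin: "finite \<Q>" using assms(2) finite_dyadic_cubes finite_subset by blast
  have "measure \<nu> S = measure \<nu> (S \<inter> good)"
    using AE_good assms(1) by (intro measure_eq_AE) auto
  also have "\<dots> \<le> measure \<nu> (\<Union>\<Q>)"
    using assms cubes_measurable fin by (intro finite_measure_mono sets.finite_Union) auto
  also have "\<dots> \<le> (\<Sum>Q\<in>\<Q>. measure \<nu> Q)"
    using finite_measure_subadditive_finite[OF fin, of "\<lambda>Q. Q"] assms(2) cubes_measurable by auto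
  finally show ?thesis .
qed

lemma measure_small_set_le:
  assumes "S \<in> sets \<nu>" and "\<And>x y. x \<in> S \<Longrightarrow> y \<in> S \<Longrightarrow> infnorm (x - y) \<le> 2 / 2 ^ k"
  shows "measure \<nu> S \<le> 5 ^ CARD('n) * (C * 2 powr (- a * real k))"
proof -
  let ?Q = "{Q \<in> dyadic_cubes k. Q \<inter> S \<noteq> {}}"
  have "S \<inter> good \<subseteq> \<Union>?Q"
    using good_unit dyadic_cube_at_eq(2) mem_dyadic_cube_at by blast
  hence "measure \<nu> S \<le> (\<Sum>Q\<in>?Q. measure \<nu> Q)"
    by (intro measure_le_sum_meeting[OF assms(1)]) auto
  also have "\<dots> \<le> real (card ?Q) * (C * 2 powr (- a * real k))"
    using sum_bounded_above[of ?Q "measure \<nu>"] mass_le by auto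
  also have "\<dots> \<le> 5 ^ CARD('n) * (C * 2 powr (- a * real k))"
  proof (rule mult_right_mono)
    show "real (card ?Q) \<le> 5 ^ CARD('n)"
      using of_nat_mono[OF card_cubes_meeting[of S k, OF assms(2)], where 'a=real] by simp
  qed (use C_ge in simp)
  finally show ?thesis .
qed

lemma mass_bound_tendsto: "(\<lambda>k. B * (C * 2 powr (- a * real k))) \<longlonglongrightarrow> 0"
proof -
  have "(\<lambda>k. (2 powr (- a)) ^ k) \<longlonglongrightarrow> 0"
    using a_pos by (intro LIMSEQ_power_zero) (simp add: powr_less_one)
  hence "(\<lambda>k. B * (C * (2 powr (- a)) ^ k)) \<longlonglongrightarrow> B * (C * 0)" by (intro tendsto_mult tendsto_const)
  thus ?thesis by (simp add: powr_powr powr_realpow[symmetric])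
qed

text \<open>A point meets boundedly many cubes of each level, and their masses tend to 0. Finite
  sets are therefore negligible, in particular the points where the distance to a quantizer
  vanishes.\<close>

lemma atomless: "measure \<nu> {x} = 0"
proof -
  have "measure \<nu> {x} \<le> 5 ^ CARD('n) * (C * 2 powr (- a * real k))" for k
    by (rule measure_small_set_le) (auto simp: sets_eq infnorm_0)
  hence "measure \<nu> {x} \<le> 0"
    using LIMSEQ_le_const[OF mass_bound_tendsto] by blast
  thus ?thesis by (simp add: measure_le_0_iff)
qed

end

subsection \<open>The limit law of the information rates\<close>

text \<open>Skorohod's representation realizes the laws by convergent variables on one space. The
  event that \<open>Y_seq n\<close> and \<open>Y\<close> differ by more than \<epsilon> has
  probability tending to 0, and off this event the sublevel sets are nested after a shift by
  \<epsilon>. That event does not involve \<open>y\<close>, whence the uniformity.\<close>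

lemma weak_conv_levy:
  fixes \<mu> :: "nat \<Rightarrow> real measure"
  assumes "\<And>n. real_distribution (\<mu> n)" "real_distribution M" "weak_conv_m \<mu> M" and "\<epsilon> > 0"
  shows "\<forall>\<^sub>F n in sequentially. \<forall>y. cdf (\<mu> n) y \<le> cdf M (y + \<epsilon>) + \<epsilon> \<and> cdf M (y - \<epsilon>) - \<epsilon> \<le> cdf (\<mu> n) y"
proof -
  obtain \<Omega> :: "real measure" and Y_seq Y where "prob_space \<Omega>"
    and ms [measurable]: "\<And>n. Y_seq n \<in> borel_measurable \<Omega>" and ds: "\<And>n. distr \<Omega> borel (Y_seq n) = \<mu> n"
    and m [measurable]: "Y \<in> borel_measurable \<Omega>" and d: "distr \<Omega> borel Y = M"
    and conv: "\<And>x. x \<in> space \<Omega> \<Longrightarrow> (\<lambda>n. Y_seq n x) \<longlonglongrightarrow> Y x"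
    using Skorohod[OF assms(1-3)] by force
  interpret prob_space \<Omega> by fact
  let ?A = "\<lambda>n. {x \<in> space \<Omega>. \<bar>Y_seq n x - Y x\<bar> > \<epsilon>}"
  have "(\<lambda>n. LINT x|\<Omega>. indicator (?A n) x :: real) \<longlonglongrightarrow> (LINT x|\<Omega>. 0)"
  proof (rule integral_dominated_convergence[where w="\<lambda>_. 1"])
    show "AE x in \<Omega>. (\<lambda>n. indicator (?A n) x :: real) \<longlonglongrightarrow> 0"
    proof (rule AE_I2)
      fix x assume "x \<in> space \<Omega>"
      hence "(\<lambda>n. \<bar>Y_seq n x - Y x\<bar>) \<longlonglongrightarrow> \<bar>Y x - Y x\<bar>" by (intro tendsto_intros conv)
      hence "\<forall>\<^sub>F n in sequentially. \<bar>Y_seq n x - Y x\<bar> < \<epsilon>"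
        using assms(4) by (auto dest: order_tendstoD)
      hence "\<forall>\<^sub>F n in sequentially. indicator (?A n) x = (0 :: real)"
        by eventually_elim auto
      thus "(\<lambda>n. indicator (?A n) x :: real) \<longlonglongrightarrow> 0" by (rule tendsto_eventually)
    qed
  qed (auto simp: indicator_def)
  moreover have "(LINT x|\<Omega>. indicator (?A n) x :: real) = prob (?A n)" for n by simp
  ultimately have "(\<lambda>n. prob (?A n)) \<longlonglongrightarrow> 0" by simp
  hence "\<forall>\<^sub>F n in sequentially. prob (?A n) < \<epsilon>" using assms(4) by (auto dest: order_tendstoD)
  thus ?thesis
  proof eventually_elim
    case (elim n)
    have cdf_n: "cdf (\<mu> n) y = prob {x \<in> space \<Omega>. Y_seq n x \<le> y}" for y
      unfolding cdf_def ds[symmetric] by (subst measure_distr) (auto intro!: arg_cong[where f=prob])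
    have cdf_M: "cdf M y = prob {x \<in> space \<Omega>. Y x \<le> y}" for y
      unfolding cdf_def d[symmetric] by (subst measure_distr) (auto intro!: arg_cong[where f=prob])
    have "prob {x \<in> space \<Omega>. Y_seq n x \<le> y} \<le> prob ({x \<in> space \<Omega>. Y x \<le> y + \<epsilon>} \<union> ?A n)" for y
      by (intro finite_measure_mono) auto
    moreover have "prob ({x \<in> space \<Omega>. Y x \<le> y + \<epsilon>} \<union> ?A n) \<le> prob {x \<in> space \<Omega>. Y x \<le> y + \<epsilon>} + prob (?A n)" for y
      by (rule measure_Un_le) auto
    moreover have "prob {x \<in> space \<Omega>. Y x \<le> y - \<epsilon>} \<le> prob ({x \<in> space \<Omega>. Y_seq n x \<le> y} \<union> ?A n)" for y
      by (intro finite_measure_mono) auto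
    moreover have "prob ({x \<in> space \<Omega>. Y_seq n x \<le> y} \<union> ?A n) \<le> prob {x \<in> space \<Omega>. Y_seq n x \<le> y} + prob (?A n)" for y
      by (rule measure_Un_le) auto
    ultimately show ?case unfolding cdf_n cdf_M using elim by (smt (verit))
  qed
qed

text \<open>Half of the power of \<open>p\<close> is spent on the logarithm, through z^2 \<le> 2 exp
  z at \<open>z = - ln p / 2\<close>.\<close>

lemma square_le_powr_half:
  fixes p :: real assumes "0 \<le> p" "p \<le> 1"
  shows "p * (log 2 p)\<^sup>2 \<le> 8 / (ln 2)\<^sup>2 * sqrt p"
proof (cases "p = 0")
  case False
  hence p: "p > 0" using assms by simp
  define z where "z = - ln p / 2"
  have z: "z \<ge> 0" unfolding z_def using assms p by (simp add: ln_le_zero_iff)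
  have "1 + z + z\<^sup>2 / 2 \<le> exp z" by (rule exp_lower_Taylor_quadratic[OF z])
  hence z2: "z\<^sup>2 \<le> 2 * exp z" using z by simp
  have e: "exp z * sqrt p = 1"
  proof -
    have "sqrt p = exp (ln p / 2)"
      using p by (simp add: powr_half_sqrt[symmetric] powr_def)
    thus ?thesis by (simp add: z_def exp_add[symmetric])
  qed
  have "(log 2 p)\<^sup>2 = 4 / (ln 2)\<^sup>2 * z\<^sup>2"
    unfolding log_def z_def by (simp add: power_divide)
  hence "p * (log 2 p)\<^sup>2 = 4 / (ln 2)\<^sup>2 * (p * z\<^sup>2)" by simp
  also have "\<dots> \<le> 4 / (ln 2)\<^sup>2 * (p * (2 * exp z))"
    using z2 p by (intro mult_left_mono) auto
  also have "p * (2 * exp z) = 2 * (sqrt p * (sqrt p * exp z))" using p by (simp add: mult.assoc[symmetric])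
  also have "\<dots> = 2 * sqrt p" using e by (simp add: mult.commute)
  finally show ?thesis by simp
qed simp

locale info_rate_limit = dyadic_measure \<nu> a C + R: real_distribution \<rho>
  for \<nu> :: "(real ^ 'n) measure" and a C :: real and \<rho> :: "real measure" +
  assumes weak: "weak_conv_m (\<lambda>k. distr \<nu> borel (info_rate \<nu> k)) \<rho>"
begin

abbreviation X :: "nat \<Rightarrow> real ^ 'n \<Rightarrow> real" where "X \<equiv> info_rate \<nu>"

lemma real_distribution_X: "real_distribution (distr \<nu> borel (X k))"
  by simp

lemma X_sets: "{x. X k x \<le> y} \<in> sets \<nu>"
proof -
  have "{x \<in> space \<nu>. X k x \<le> y} \<in> sets \<nu>" by measurable
  thus ?thesis by (simp add: space_eq)
qed

lemma cdf_X: "cdf (distr \<nu> borel (X k)) y = measure \<nu> {x. X k x \<le> y}"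
  unfolding cdf_def by (subst measure_distr) (auto intro!: arg_cong[where f=prob] simp: space_eq)

section \<open>Localization of the limit law\<close>

lemma levy:
  assumes "\<epsilon> > 0"
  shows "\<forall>\<^sub>F k in sequentially. \<forall>y. measure \<nu> {x. X k x \<le> y} \<le> cdf \<rho> (y + \<epsilon>) + \<epsilon> \<and>
    cdf \<rho> (y - \<epsilon>) - \<epsilon> \<le> measure \<nu> {x. X k x \<le> y}"
  using weak_conv_levy[OF real_distribution_X R.real_distribution_axioms weak assms]
  unfolding cdf_X .

lemma rate_lower_eventually:
  assumes "\<epsilon> > 0"
  shows "\<forall>\<^sub>F k in sequentially. \<forall>x\<in>good. X k x > a - \<epsilon>"
proof -
  have "(\<lambda>k. log 2 C / real k) \<longlonglongrightarrow> 0" by real_asymp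
  hence "\<forall>\<^sub>F k in sequentially. log 2 C / real k < \<epsilon>" using assms by (rule order_tendstoD)
  thus ?thesis using eventually_gt_at_top[of 0]
  proof eventually_elim
    case (elim k)
    show ?case using info_rate_ge[of _ k] elim by force
  qed
qed

text \<open>Eventually the rates of good points exceed any number below \<open>a\<close>. The Levy
  bound carries this to the limit law with a loss of \<epsilon>, which is then sent to 0.\<close>

lemma cdf_below_a:
  assumes "y < a" shows "cdf \<rho> y = 0"
proof -
  have **: "cdf \<rho> y \<le> \<epsilon>" if "0 < \<epsilon>" "\<epsilon> < a - y" for \<epsilon>
  proof -
    have "a - y - \<epsilon> > 0" using that by simp
    from levy[OF that(1)] rate_lower_eventually[OF this]
    have "\<forall>\<^sub>F k in sequentially. cdf \<rho> y \<le> \<epsilon>"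
    proof eventually_elim
      case (elim k)
      have "measure \<nu> {x. X k x \<le> y + \<epsilon>} = 0"
      proof -
        have "AE x in \<nu>. x \<notin> {x. X k x \<le> y + \<epsilon>}"
          using AE_good by eventually_elim (use elim in force)
        thus ?thesis using X_sets by (subst (asm) AE_iff_measurable[OF _ refl]) (auto simp: space_eq measure_def)
      qed
      moreover have "cdf \<rho> ((y + \<epsilon>) - \<epsilon>) - \<epsilon> \<le> measure \<nu> {x. X k x \<le> y + \<epsilon>}" using elim by blast
      ultimately show ?case by simp
    qed
    thus ?thesis by (simp add: eventually_const)
  qed
  have "cdf \<rho> y \<le> 0"
  proof (rule field_le_epsilon)
    fix e :: real assume "e > 0"
    moreover have "min e ((a - y) / 2) < a - y" using assms by (simp add: min_less_iff_disj)
    ultimately have "cdf \<rho> y \<le> min e ((a - y) / 2)" using assms by (intro **) auto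
    thus "cdf \<rho> y \<le> 0 + e" by simp
  qed
  thus ?thesis using R.cdf_nonneg[of y] by simp
qed

text \<open>Union bound: at most 2^(dk) cubes, each of mass at most 2^(-(d+t)k).\<close>

lemma light_mass:
  assumes "k > 0" "t \<ge> 0"
  shows "measure \<nu> {x. X k x > real CARD('n) + t} \<le> 2 powr (- t * real k)"
proof -
  let ?P = "\<lambda>Q. - (1 / real k) * log 2 (measure \<nu> Q) > real CARD('n) + t"
  have le: "measure \<nu> Q \<le> 2 powr (- (real CARD('n) + t) * real k)" if "?P Q" for Q
  proof (cases "measure \<nu> Q = 0")
    case False
    hence p: "measure \<nu> Q > 0" by (simp add: zero_less_measure_iff)
    have "log 2 (measure \<nu> Q) \<le> - (real CARD('n) + t) * real k"
      using that assms by (simp add: field_simps)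
    thus ?thesis using p by (simp add: log_le_iff)
  qed simp
  have "measure \<nu> {x. X k x > real CARD('n) + t} = (\<Sum>Q\<in>{Q \<in> dyadic_cubes k. ?P Q}. measure \<nu> Q)"
    unfolding info_rate_def by (rule prob_cube_pred)
  also have "\<dots> \<le> real (card {Q \<in> (dyadic_cubes k :: (real ^ 'n) set set). ?P Q}) * 2 powr (- (real CARD('n) + t) * real k)"
    by (rule sum_bounded_above) (use le in auto)
  also have "\<dots> \<le> 2 ^ (CARD('n) * k) * 2 powr (- (real CARD('n) + t) * real k)"
  proof (rule mult_right_mono)
    have "card {Q \<in> (dyadic_cubes k :: (real ^ 'n) set set). ?P Q} \<le> 2 ^ (CARD('n) * k)"
      using card_mono[OF finite_dyadic_cubes, of "{Q \<in> (dyadic_cubes k :: (real ^ 'n) set set). ?P Q}" k] card_dyadic_cubes[of k, where 'n='n]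
      by (auto intro: order_trans)
    thus "real (card {Q \<in> (dyadic_cubes k :: (real ^ 'n) set set). ?P Q}) \<le> 2 ^ (CARD('n) * k)"
      using of_nat_mono[where 'a=real] by fastforce
  qed simp
  also have "\<dots> = 2 powr (real CARD('n) * real k) * 2 powr (- (real CARD('n) + t) * real k)" by (simp add: powr_realpow[symmetric])
  also have "\<dots> = 2 powr (- t * real k)" by (simp add: powr_add[symmetric] algebra_simps)
  finally show ?thesis .
qed

lemma cdf_above_d:
  assumes "y > real CARD('n)" shows "cdf \<rho> y = 1"
proof -
  \<comment> \<open>One \<epsilon> is lost in the Levy comparison, the other to the mass of light
    cubes.\<close>
  have **: "cdf \<rho> y \<ge> 1 - 2 * \<epsilon>" if "0 < \<epsilon>" "\<epsilon> < y - real CARD('n)" for \<epsilon>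
  proof -
    let ?t = "y - real CARD('n) - \<epsilon>"
    define t where "t = ?t"
    have "t > 0" using that by (simp add: t_def)
    hence "(\<lambda>k. 2 powr (- t * real k)) \<longlonglongrightarrow> 0" by real_asymp
    hence "(\<lambda>k. 2 powr (- ?t * real k)) \<longlonglongrightarrow> 0" by (simp add: t_def)
    hence "\<forall>\<^sub>F k in sequentially. 2 powr (- ?t * real k) < \<epsilon>" using that by (auto dest: order_tendstoD)
    hence "\<forall>\<^sub>F k in sequentially. 1 - 2 * \<epsilon> \<le> cdf \<rho> y"
      using levy[OF that(1)] eventually_gt_at_top[of 0]
    proof eventually_elim
      case (elim k)
      have "measure \<nu> {x. X k x \<le> y - \<epsilon>} = 1 - measure \<nu> {x. X k x > real CARD('n) + ?t}"
      proof -
        have "space \<nu> - {x. X k x \<le> y - \<epsilon>} = {x. X k x > real CARD('n) + ?t}" by (auto simp: space_eq)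
        thus ?thesis using prob_compl[OF X_sets, of k "y - \<epsilon>"] by simp
      qed
      moreover have "measure \<nu> {x. X k x > real CARD('n) + ?t} \<le> 2 powr (- ?t * real k)"
        using light_mass[of k ?t] elim that by simp
      moreover have "measure \<nu> {x. X k x \<le> y - \<epsilon>} \<le> cdf \<rho> ((y - \<epsilon>) + \<epsilon>) + \<epsilon>" using elim by blast
      ultimately show ?case using elim by simp
    qed
    thus ?thesis by (simp add: eventually_const)
  qed
  have "1 \<le> cdf \<rho> y + e" if "e > 0" for e
  proof -
    let ?e = "min (e / 2) ((y - real CARD('n)) / 2)"
    have "0 < ?e" "?e < y - real CARD('n)" "2 * ?e \<le> e"
      using that assms by (auto simp: min_def)
    thus ?thesis using **[of ?e] by linarith
  qed
  hence "1 \<le> cdf \<rho> y" by (rule field_le_epsilon)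
  thus ?thesis using R.cdf_bounded_prob[of y] by simp
qed

lemma AE_support: "AE y in \<rho>. y \<in> msupport \<rho>"
proof (rule AE_I[where N="- msupport \<rho>"])
  show "emeasure \<rho> (- msupport \<rho>) = 0" by (rule emeasure_msupport_compl(1)) simp
  show "- msupport \<rho> \<in> sets \<rho>" using closed_msupport[of \<rho>] by (simp add: closed_def)
qed auto

lemma support_subset: "msupport \<rho> \<subseteq> {a..real CARD('n)}"
proof
  fix y assume y: "y \<in> msupport \<rho>"
  hence pos: "measure \<rho> U > 0" if "open U" "y \<in> U" for U
    using that by (auto simp: msupport_def R.emeasure_eq_measure)
  have "\<not> y < a"
  proof
    assume "y < a"
    then obtain z where z: "y < z" "z < a" using dense by blast
    have "measure \<rho> {..<z} \<le> cdf \<rho> z" unfolding cdf_def by (rule R.finite_measure_mono) auto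
    thus False using cdf_below_a[OF z(2)] pos[of "{..<z}"] z(1) by simp
  qed
  moreover have "\<not> y > real CARD('n)"
  proof
    assume "y > real CARD('n)"
    then obtain z where z: "real CARD('n) < z" "z < y" using dense by blast
    have "measure \<rho> (space \<rho> - {..z}) = 1 - cdf \<rho> z" unfolding cdf_def by (rule R.prob_compl) simp
    also have "space \<rho> - {..z} = {z<..}" by auto
    finally show False using cdf_above_d[OF z(1)] pos[of "{z<..}"] z(2) by simp
  qed
  ultimately show "y \<in> {a..real CARD('n)}" by simp
qed

lemma support_nonempty: "msupport \<rho> \<noteq> {}"
proof
  assume "msupport \<rho> = {}"
  hence "emeasure \<rho> UNIV = 0" using emeasure_msupport_compl(1)[of \<rho>] by simp
  thus False using R.emeasure_space_1 by simp
qed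

text \<open>\<open>Inf\<close> and \<open>Sup\<close> can be handled by boundedness alone; that they
  are the least and greatest elements rests on the closedness of the support.\<close>

definition m :: real where "m = Inf (msupport \<rho>)"
definition M :: real where "M = Sup (msupport \<rho>)"

lemma bdd_support: "bdd_below (msupport \<rho>)" "bdd_above (msupport \<rho>)"
  using bdd_below_mono[OF bdd_below_Icc support_subset] bdd_above_mono[OF bdd_above_Icc support_subset] by auto

lemma m_in: "m \<in> msupport \<rho>" and M_in: "M \<in> msupport \<rho>"
  unfolding m_def M_def
  using closed_contains_Inf[OF support_nonempty bdd_support(1)] closed_contains_Sup[OF support_nonempty bdd_support(2)]
    closed_msupport[of \<rho>] by auto

lemma support_between: "msupport \<rho> \<subseteq> {m..M}"
  unfolding m_def M_def using bdd_support by (auto intro: cInf_lower cSup_upper)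

lemma Least_support: "(LEAST y. y \<in> msupport \<rho>) = m" and Greatest_support: "(GREATEST y. y \<in> msupport \<rho>) = M"
  using m_in M_in support_between by (auto intro!: Least_equality Greatest_equality)

lemma m_bounds: "a \<le> m" "m \<le> M" "M \<le> real CARD('n)" "0 < m" "0 < M"
  using m_in M_in support_subset support_between a_pos by (force)+

lemma AE_between: "AE y in \<rho>. m \<le> y \<and> y \<le> M"
  using AE_support by eventually_elim (use support_between in auto)

lemma mass_left_of: "m < y \<Longrightarrow> measure \<rho> {..<y} > 0"
  using m_in unfolding msupport_def by (auto simp: R.emeasure_eq_measure)

lemma mass_right_of: "y < M \<Longrightarrow> measure \<rho> {y<..} > 0"
  using M_in unfolding msupport_def by (auto simp: R.emeasure_eq_measure)

section \<open>Convergence of the first two moments\<close>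

lemma integrable_support:
  assumes "f \<in> borel_measurable borel" "\<And>y. m \<le> y \<Longrightarrow> y \<le> M \<Longrightarrow> \<bar>f y\<bar> \<le> B"
  shows "integrable \<rho> (f :: real \<Rightarrow> real)"
proof (rule R.integrable_const_bound[where B=B])
  show "AE x in \<rho>. norm (f x) \<le> B" using AE_between by eventually_elim (use assms in auto)
qed (use assms in simp)

text \<open>Weak convergence only tests bounded continuous functions. Clipping to
  \<open>{0..B}\<close> makes \<open>f\<close> bounded and is invisible to \<rho>, whose support
  lies in \<open>{a..real CARD('n)}\<close>.\<close>

lemma clipped_moment_tendsto:
  assumes "continuous_on UNIV (f :: real \<Rightarrow> real)"  "B \<ge> real CARD('n)" 
  shows "(\<lambda>k. LINT x|\<nu>. f (max 0 (min (X k x) B))) \<longlonglongrightarrow> (LINT y|\<rho>. f y)"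
proof -
  let ?g = "\<lambda>y. f (max 0 (min y B))"
  have B: "B \<ge> 0" using assms(2) by (meson of_nat_0_le_iff order_trans)
  have "compact (f ` {0..B})"
    using assms(1) by (intro compact_continuous_image) (auto intro: continuous_on_subset)
  then obtain K where K: "\<And>y. y \<in> {0..B} \<Longrightarrow> \<bar>f y\<bar> \<le> K"
    using compact_imp_bounded[of "f ` {0..B}"] unfolding bounded_real by (auto simp del: atLeastAtMost_iff)
  have "(\<lambda>k. integral\<^sup>L (distr \<nu> borel (X k)) ?g) \<longlonglongrightarrow> integral\<^sup>L \<rho> ?g"
  proof (rule weak_conv_imp_integral_bdd_continuous_conv[OF real_distribution_X R.real_distribution_axioms weak])
    show "isCont ?g x" for x
    proof (rule continuous_on_interior[of UNIV])
      show "continuous_on UNIV ?g"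
        by (rule continuous_on_compose2[OF assms(1)]) (auto intro!: continuous_intros)
    qed simp
    show "norm (?g y) \<le> K" for y using K[of "max 0 (min y B)"] B by auto
  qed
  moreover have "integral\<^sup>L (distr \<nu> borel (X k)) ?g = (LINT x|\<nu>. ?g (X k x))" for k
    using assms(1) by (intro integral_distr) (auto intro!: borel_measurable_continuous_onI continuous_on_compose2[OF assms(1)] continuous_intros)
  moreover have "integral\<^sup>L \<rho> ?g = (LINT y|\<rho>. f y)"
  proof (rule integral_cong_AE)
    show "AE y in \<rho>. ?g y = f y"
      using AE_between by eventually_elim (use assms(2) m_bounds in \<open>auto simp: max_def min_def\<close>)
  qed (use assms(1) in \<open>auto intro!: R.measurable_finite_borel borel_measurable_continuous_onI continuous_on_compose2[OF assms(1)] continuous_intros\<close>)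
  ultimately show ?thesis by simp
qed

text \<open>Uniform integrability. Above the threshold 2d+3 a cube has mass at most 2^(-(2d+3)k),
  and trading \<open>p * (log 2 p)\<^sup>2\<close> for \<open>sqrt p\<close> leaves a multiple of
  2^(-(d+3/2)k) per cube. The factor 2 in the threshold pays for the square root, the summand 3 for
  beating the 2^(dk) cubes.\<close>

lemma tail_second_moment:
  "(\<lambda>k. LINT x|\<nu>. (if X k x > 2 * real CARD('n) + 3 then (X k x)\<^sup>2 else 0)) \<longlonglongrightarrow> 0"
proof (rule tendsto_sandwich)
  let ?c = "8 / (ln 2)\<^sup>2 :: real"
  let ?f = "\<lambda>k Q. let y = - (1 / real k) * log 2 (measure \<nu> Q) in (if y > 2 * real CARD('n) + 3 then y\<^sup>2 else 0)"
  have eq: "(LINT x|\<nu>. (if X k x > 2 * real CARD('n) + 3 then (X k x)\<^sup>2 else 0)) = (\<Sum>Q\<in>dyadic_cubes k. ?f k Q * measure \<nu> Q)" for k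
    unfolding info_rate_def integral_cube_fun(2)[symmetric] Let_def ..
  show "\<forall>\<^sub>F k in sequentially. 0 \<le> (LINT x|\<nu>. (if X k x > 2 * real CARD('n) + 3 then (X k x)\<^sup>2 else 0))"
    by (intro always_eventually allI integral_nonneg_AE) auto
  show "\<forall>\<^sub>F k in sequentially. (LINT x|\<nu>. (if X k x > 2 * real CARD('n) + 3 then (X k x)\<^sup>2 else 0)) \<le> ?c * 2 powr (- (3/2) * real k)"
    using eventually_gt_at_top[of 0]
  proof eventually_elim
    case (elim k)
    have "?f k Q * measure \<nu> Q \<le> ?c * 2 powr (- (real CARD('n) + 3/2) * real k)" if "Q \<in> dyadic_cubes k" for Q
    proof (cases "- (1 / real k) * log 2 (measure \<nu> Q) > 2 * real CARD('n) + 3 \<and> measure \<nu> Q \<noteq> 0")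
      case True
      let ?p = "measure \<nu> Q"
      have p: "?p > 0" using True by (simp add: zero_less_measure_iff)
      have "?f k Q * ?p = (1 / (real k)\<^sup>2) * (?p * (log 2 ?p)\<^sup>2)"
        using True by (simp add: power2_eq_square)
      also have "\<dots> \<le> 1 * (?p * (log 2 ?p)\<^sup>2)"
        using elim by (intro mult_right_mono) auto
      also have "\<dots> \<le> ?c * sqrt ?p" using square_le_powr_half[of ?p] by simp
      also have "\<dots> \<le> ?c * 2 powr (- (real CARD('n) + 3/2) * real k)"
      proof (rule mult_left_mono)
        show "sqrt ?p \<le> 2 powr (- (real CARD('n) + 3/2) * real k)"
        proof -
        have "log 2 ?p \<le> - (2 * real CARD('n) + 3) * real k" using True elim by (simp add: field_simps)
        hence "?p \<le> 2 powr (- (2 * real CARD('n) + 3) * real k)" using p by (simp add: log_le_iff)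
        have sq: "sqrt (2 powr z) = 2 powr (z / 2)" for z :: real
          by (simp add: powr_half_sqrt[symmetric] powr_powr)
        from \<open>?p \<le> _\<close> have "sqrt ?p \<le> sqrt (2 powr (- (2 * real CARD('n) + 3) * real k))" by simp
        also have "\<dots> = 2 powr (- (real CARD('n) + 3/2) * real k)"
          unfolding sq by (rule arg_cong[where f="\<lambda>z. 2 powr z"]) (simp add: field_simps)
        finally show ?thesis .
        qed
      qed simp
      finally show ?thesis .
    next
      case False thus ?thesis by (auto simp: Let_def)
    qed
    hence "(\<Sum>Q\<in>dyadic_cubes k. ?f k Q * measure \<nu> Q) \<le> real (card (dyadic_cubes k :: (real ^ 'n) set set)) * (?c * 2 powr (- (real CARD('n) + 3/2) * real k))"
      by (rule sum_bounded_above)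
    also have "\<dots> \<le> 2 ^ (CARD('n) * k) * (?c * 2 powr (- (real CARD('n) + 3/2) * real k))"
      using of_nat_mono[OF card_dyadic_cubes[of k, where 'n='n], where 'a=real] by (intro mult_right_mono) simp_all
    also have "2 ^ (CARD('n) * k) = 2 powr (real CARD('n) * real k)"
      using powr_realpow[of 2 "CARD('n) * k"] by simp
    also have "2 powr (real CARD('n) * real k) * (?c * 2 powr (- (real CARD('n) + 3/2) * real k))
        = ?c * (2 powr (real CARD('n) * real k) * 2 powr (- (real CARD('n) + 3/2) * real k))" by simp
    also have "\<dots> = ?c * 2 powr (- (3/2) * real k)" by (simp only: powr_add[symmetric]) (simp add: algebra_simps)
    finally show ?case unfolding eq .
  qed
  show "(\<lambda>k. ?c * 2 powr (- (3/2) * real k)) \<longlonglongrightarrow> 0" by real_asymp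
qed simp

text \<open>The moment lies between the clipped moment and the clipped moment plus the quadratic
  tail. The same tail serves \<open>j = 1\<close>, because the threshold exceeds 1.\<close>

lemma moment_tendsto:
  assumes j: "j = 1 \<or> j = 2"
  shows "(\<lambda>k. LINT x|\<nu>. (X k x) ^ j) \<longlonglongrightarrow> (LINT y|\<rho>. y ^ j)"
proof -
  let ?B = "2 * real CARD('n) + 3"
  let ?T = "\<lambda>k. LINT x|\<nu>. (if X k x > ?B then (X k x)\<^sup>2 else 0)"
  let ?c = "\<lambda>k. LINT x|\<nu>. (max 0 (min (X k x) ?B)) ^ j"
  have c: "?c \<longlonglongrightarrow> (LINT y|\<rho>. y ^ j)"
    by (rule clipped_moment_tendsto) (auto intro!: continuous_intros)
  have i1: "integrable \<nu> (\<lambda>x. (X k x) ^ j)" for k unfolding info_rate_def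
    using integral_cube_fun(1)[of "\<lambda>Q. (- (1 / real k) * log 2 (measure \<nu> Q)) ^ j" k] .
  have i2: "integrable \<nu> (\<lambda>x. (max 0 (min (X k x) ?B)) ^ j)" for k unfolding info_rate_def
    using integral_cube_fun(1)[of "\<lambda>Q. (max 0 (min (- (1 / real k) * log 2 (measure \<nu> Q)) ?B)) ^ j" k] .
  have i3: "integrable \<nu> (\<lambda>x. if X k x > ?B then (X k x)\<^sup>2 else 0)" for k unfolding info_rate_def
    using integral_cube_fun(1)[of "\<lambda>Q. if - (1 / real k) * log 2 (measure \<nu> Q) > ?B then (- (1 / real k) * log 2 (measure \<nu> Q))\<^sup>2 else 0" k] .
  have pw: "(max 0 (min (X k x) ?B)) ^ j \<le> (X k x) ^ j"
    "(X k x) ^ j \<le> (max 0 (min (X k x) ?B)) ^ j + (if X k x > ?B then (X k x)\<^sup>2 else 0)" for k x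
  proof -
    have X0: "X k x \<ge> 0" by (rule info_rate_nonneg)
    show "(max 0 (min (X k x) ?B)) ^ j \<le> (X k x) ^ j" using X0 by (intro power_mono) auto
    show "(X k x) ^ j \<le> (max 0 (min (X k x) ?B)) ^ j + (if X k x > ?B then (X k x)\<^sup>2 else 0)"
    proof (cases "X k x > ?B")
      case True
      hence "1 \<le> X k x" by (smt (verit) of_nat_0_le_iff)
      hence "(X k x) ^ j \<le> (X k x)\<^sup>2" using j by (intro power_increasing) auto
      moreover have "0 \<le> (max 0 (min (X k x) ?B)) ^ j" by simp
      ultimately show ?thesis unfolding if_P[OF True] by linarith
    next
      case False thus ?thesis using X0 by (simp add: max_def min_def)
    qed
  qed
  have "(\<lambda>k. ?c k + ?T k) \<longlonglongrightarrow> (LINT y|\<rho>. y ^ j) + 0"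
    by (intro tendsto_add c tail_second_moment)
  hence c2: "(\<lambda>k. ?c k + ?T k) \<longlonglongrightarrow> (LINT y|\<rho>. y ^ j)" by simp
  show ?thesis
  proof (rule tendsto_sandwich[OF _ _ c c2])
    show "\<forall>\<^sub>F k in sequentially. ?c k \<le> (LINT x|\<nu>. (X k x) ^ j)"
      by (intro always_eventually allI integral_mono i1 i2 pw)
    show "\<forall>\<^sub>F k in sequentially. (LINT x|\<nu>. (X k x) ^ j) \<le> ?c k + ?T k"
    proof (intro always_eventually allI)
      fix k
      have "(LINT x|\<nu>. (X k x) ^ j) \<le> (LINT x|\<nu>. (max 0 (min (X k x) ?B)) ^ j + (if X k x > ?B then (X k x)\<^sup>2 else 0))"
        by (intro integral_mono i1 i2 i3 pw Bochner_Integration.integrable_add)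
      also have "\<dots> = ?c k + ?T k" by (intro Bochner_Integration.integral_add i2 i3)
      finally show "(LINT x|\<nu>. (X k x) ^ j) \<le> ?c k + ?T k" .
    qed
  qed
qed

lemma entropy_rate_eq: "entropy_rate \<nu> k = (LINT x|\<nu>. X k x)"
  unfolding entropy_rate_def info_rate_def
  by (subst integral_cube_fun(2)) (simp add: sum_distrib_left mult.commute mult.left_commute)

definition h :: real where "h = (LINT y|\<rho>. y)"

lemma entropy_rate_tendsto: "entropy_rate \<nu> \<longlonglongrightarrow> h"
proof -
  have "entropy_rate \<nu> = (\<lambda>k. LINT x|\<nu>. (X k x) ^ 1)" by (simp add: entropy_rate_eq fun_eq_iff)
  thus ?thesis using moment_tendsto[of 1] unfolding h_def by simp
qed

lemma entropy_dim_eq: "entropy_dim \<nu> = h"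
  unfolding entropy_dim_def using entropy_rate_tendsto by (rule limI)

end

subsection \<open>The geometric-mean quantization dimension\<close>

lemma linf_setdist_less_iff:
  assumes "finite A" "A \<noteq> {}"
  shows "linf_setdist x A < r \<longleftrightarrow> (\<exists>y\<in>A. infnorm (x - y) < r)"
  unfolding linf_setdist_def using assms by (subst cINF_less_iff) auto

lemma linf_setdist_le: "finite A \<Longrightarrow> y \<in> A \<Longrightarrow> linf_setdist x A \<le> infnorm (x - y)"
  unfolding linf_setdist_def by (intro cINF_lower) auto

lemma linf_setdist_pos:
  assumes "finite A" "A \<noteq> {}" "x \<notin> A" shows "linf_setdist x A > 0"
proof -
  have "linf_setdist x A \<in> (\<lambda>y. infnorm (x - y)) ` A"
    unfolding linf_setdist_def using assms by (subst cInf_eq_Min) (auto intro: Min_in simp del: image_iff)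
  thus ?thesis using assms by (auto simp: infnorm_pos_lt)
qed

lemma linf_setdist_nonneg:
  assumes "A \<noteq> {}" shows "linf_setdist x A \<ge> 0"
  unfolding linf_setdist_def using assms by (intro cINF_greatest) (auto simp: infnorm_pos_le)

lemma borel_infnorm [measurable]: "(\<lambda>x :: real ^ 'n. infnorm (x - y)) \<in> borel_measurable borel"
  by (intro borel_measurable_continuous_onI continuous_intros)

lemma borel_linf_setdist:
  assumes "finite A"
  shows "(\<lambda>x :: real ^ 'n. linf_setdist x A) \<in> borel_measurable borel"
  unfolding linf_setdist_def using countable_finite[OF assms]
  by (intro borel_measurable_cINF_real) auto

section \<open>Layers of the logarithmic distance and counts of multiples\<close>

lemma sum_powr_geometric_le:
  fixes b :: real assumes "b > 0"
  shows "(\<Sum>k\<le>n. 2 powr (- b * real k)) \<le> 1 / (1 - 2 powr (- b))"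
    and "summable (\<lambda>k. 2 powr (- b * real k))"
    and "(\<Sum>k. 2 powr (- b * real k)) = 1 / (1 - 2 powr (- b))"
proof -
  have eq: "2 powr (- b * real k) = (2 powr (- b)) ^ k" for k
    by (simp add: powr_realpow[symmetric] powr_powr)
  have l: "norm (2 powr (- b)) < 1" using assms by (simp add: powr_less_one)
  show s: "summable (\<lambda>k. 2 powr (- b * real k))" unfolding eq using l by (rule summable_geometric)
  show e: "(\<Sum>k. 2 powr (- b * real k)) = 1 / (1 - 2 powr (- b))" unfolding eq using l by (rule suminf_geometric)
  show "(\<Sum>k\<le>n. 2 powr (- b * real k)) \<le> 1 / (1 - 2 powr (- b))"
    unfolding e[symmetric] by (rule sum_le_suminf[OF s]) auto
qed

text \<open>For 0 < r < 1 all levels below the ceiling of \<open>- log 2 r\<close> are counted. At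
  \<open>r = 0\<close> the left side is the default 0, and for \<open>r \<ge> 1\<close> the
  embedding \<open>ennreal\<close> truncates it to 0.\<close>

lemma neg_log_le_layers:
  fixes r :: real assumes "r \<ge> 0"
  shows "ennreal (- log 2 r) \<le> (\<Sum>k. indicator {k. r < 1 / 2 ^ k} k)"
proof (cases "r = 0 \<or> r \<ge> 1")
  case True
  hence "- log 2 r \<le> 0" by (auto simp: log_def)
  thus ?thesis by (simp add: ennreal_neg)
next
  case False
  hence r: "0 < r" "r < 1" using assms by auto
  define t where "t = - log 2 r"
  have t: "t > 0" using r by (simp add: t_def)
  define K where "K = nat \<lceil>t\<rceil>"
  have "r < 1 / 2 ^ k" if "k < K" for k
  proof -
    have "real k < t" using that t unfolding K_def by linarith
    hence "log 2 r < - real k" by (simp add: t_def)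
    hence "r < 2 powr (- real k)" using r by (simp add: log_less_iff)
    thus ?thesis by (simp add: two_powr_minus_nat)
  qed
  hence "(\<Sum>k<K. indicator {k. r < 1 / 2 ^ k} k :: ennreal) = of_nat K"
    by (simp add: indicator_def)
  moreover have "(\<Sum>k<K. indicator {k. r < 1 / 2 ^ k} k :: ennreal) \<le> (\<Sum>k. indicator {k. r < 1 / 2 ^ k} k)"
    by (rule sum_le_suminf) auto
  moreover have "ennreal t \<le> of_nat K"
    using t unfolding K_def ennreal_of_nat_eq_real_of_nat by (intro ennreal_leI) linarith
  ultimately have "ennreal t \<le> (\<Sum>k. indicator {k. r < 1 / 2 ^ k} k)" by (metis order_trans)
  thus ?thesis by (simp only: t_def)
qed

lemma sum_if_le_card:
  fixes P :: "nat \<Rightarrow> bool" shows "(\<Sum>k\<in>{1..K}. if P k then 1 else 0 :: real) = real (card {k \<in> {1..K}. P k})"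
  by (simp add: sum.If_cases Int_def)

lemma count_multiples_le:
  fixes n y :: real assumes "n \<ge> 0" "y > 0"
  shows "real (card {k \<in> {1..K}. real k * y \<le> n}) \<le> n / y"
proof -
  have "{k \<in> {1..K}. real k * y \<le> n} \<subseteq> {1..nat \<lfloor>n / y\<rfloor>}"
    using assms by (auto simp: le_nat_floor field_simps)
  hence "card {k \<in> {1..K}. real k * y \<le> n} \<le> nat \<lfloor>n / y\<rfloor>"
    using card_mono[of "{1..nat \<lfloor>n / y\<rfloor>}"] by fastforce
  hence "real (card {k \<in> {1..K}. real k * y \<le> n}) \<le> real (nat \<lfloor>n / y\<rfloor>)" by linarith
  also have "\<dots> \<le> n / y" using assms by simp
  finally show ?thesis .
qed

text \<open>The condition on \<open>K\<close> ensures that no multiple up to \<open>n\<close> is cut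
  off; the loss of 1 is that of the floor.\<close>

lemma count_multiples_ge:
  fixes n y :: real assumes "n \<ge> 0" "y > 0" "n / y < real K + 1"
  shows "n / y - 1 \<le> real (card {k \<in> {1..K}. real k * y \<le> n})"
proof -
  have "{1..nat \<lfloor>n / y\<rfloor>} \<subseteq> {k \<in> {1..K}. real k * y \<le> n}"
  proof
    fix k assume k: "k \<in> {1..nat \<lfloor>n / y\<rfloor>}"
    hence "real k \<le> n / y" using assms by (auto simp: le_nat_floor nat_le_iff le_nat_iff le_floor_iff)
    moreover from this have "k \<le> K" using assms by linarith
    ultimately show "k \<in> {k \<in> {1..K}. real k * y \<le> n}" using k assms by (auto simp: field_simps)
  qed
  hence "card {1..nat \<lfloor>n / y\<rfloor>} \<le> card {k \<in> {1..K}. real k * y \<le> n}" by (intro card_mono) auto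
  hence "real (nat \<lfloor>n / y\<rfloor>) \<le> real (card {k \<in> {1..K}. real k * y \<le> n})" by simp
  moreover have "n / y - 1 \<le> real (nat \<lfloor>n / y\<rfloor>)" using assms by linarith
  ultimately show ?thesis by linarith
qed

context info_rate_limit
begin

text \<open>The mean inverse rate. It is the limit of -log e_N / log N, so its reciprocal is the
  quantization dimension.\<close>

definition H :: real where "H = (LINT y|\<rho>. 1 / y)"

lemma integrable_inverse: "integrable \<rho> (\<lambda>y. 1 / (y + c))" if "c > - m"
  using that m_bounds by (intro integrable_support[where B="1 / (m + c)"]) (auto intro!: frac_le)

lemma measure_rho_UNIV [simp]: "measure \<rho> UNIV = 1"
  using R.prob_space by simp

lemma H_bounds: "1 / M \<le> H" "H > 0"
proof -
  have "(LINT y|\<rho>. 1 / M) \<le> H" unfolding H_def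
    using integrable_inverse[of 0] m_bounds
  proof (intro integral_mono_AE)
    show "AE y in \<rho>. 1 / M \<le> 1 / y"
      using AE_between by eventually_elim (use m_bounds in \<open>auto intro!: divide_left_mono\<close>)
  qed auto
  thus "1 / M \<le> H" by simp
  thus "H > 0" using m_bounds by (smt (verit) divide_pos_pos)
qed

section \<open>Mass in the neighbourhood of a finite set\<close>

lemma setdist_sets:
  assumes "finite A" "A \<noteq> {}"
  shows "{x. linf_setdist x A < r} \<in> sets \<nu>"
  using borel_linf_setdist[OF assms(1), THEN measurable_sets, of "{..<r}"] sets_eq by (simp add: vimage_def)

lemma cubes_near_finite_set:
  assumes "finite A" "A \<noteq> {}" "card A \<le> N"
  shows "card {Q \<in> dyadic_cubes k. Q \<inter> {x :: real ^ 'n. linf_setdist x A < 1 / 2 ^ k} \<noteq> {}} \<le> N * 5 ^ CARD('n)"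
proof -
  let ?B = "\<lambda>y. {x :: real ^ 'n. infnorm (x - y) < 1 / 2 ^ k}"
  let ?Q = "\<lambda>S. {Q \<in> dyadic_cubes k. Q \<inter> S \<noteq> {}}"
  have small: "infnorm (u - v) \<le> 2 / 2 ^ k" if "u \<in> ?B y" "v \<in> ?B y" for u v y
    using that infnorm_triangle[of "u - y" "y - v"] infnorm_sub[of v y] by simp
  have "?Q {x. linf_setdist x A < 1 / 2 ^ k} = (\<Union>y\<in>A. ?Q (?B y))"
    using linf_setdist_less_iff[OF assms(1,2)] by auto
  hence "card (?Q {x. linf_setdist x A < 1 / 2 ^ k}) \<le> (\<Sum>y\<in>A. card (?Q (?B y)))"
    using card_UN_le[OF assms(1)] by simp
  also have "\<dots> \<le> (\<Sum>y\<in>A. 5 ^ CARD('n))" by (intro sum_mono card_cubes_meeting small)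
  also have "\<dots> = card A * 5 ^ CARD('n)" by simp
  also have "\<dots> \<le> N * 5 ^ CARD('n)" using assms(3) by simp
  finally show ?thesis .
qed

text \<open>The crude bound for high levels: once 2^(-ak) beats \<open>N\<close> it decays
  geometrically. It also gives integrability of the logarithmic distance.\<close>

lemma near_measure_le1:
  assumes "finite A" "A \<noteq> {}" "card A \<le> N"
  shows "measure \<nu> {x. linf_setdist x A < 1 / 2 ^ k} \<le> real N * 5 ^ CARD('n) * C * 2 powr (- a * real k)"
proof -
  let ?S = "{x. linf_setdist x A < 1 / 2 ^ k}"
  let ?Q = "{Q \<in> dyadic_cubes k. Q \<inter> ?S \<noteq> {}}"
  have "?S \<inter> good \<subseteq> \<Union>?Q" using good_unit dyadic_cube_at_eq(2) mem_dyadic_cube_at by blast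
  hence "measure \<nu> ?S \<le> (\<Sum>Q\<in>?Q. measure \<nu> Q)"
    by (intro measure_le_sum_meeting[OF setdist_sets[OF assms(1,2)]]) auto
  also have "\<dots> \<le> real (card ?Q) * (C * 2 powr (- a * real k))"
    using sum_bounded_above[of ?Q "measure \<nu>"] mass_le by auto
  also have "\<dots> \<le> real (N * 5 ^ CARD('n)) * (C * 2 powr (- a * real k))"
    using C_ge by (intro mult_right_mono of_nat_mono cubes_near_finite_set[OF assms]) auto
  finally show ?thesis by simp
qed

text \<open>The sharp bound for low levels. Points of rate at most \<open>l\<close> are left to the
  law of \<open>X k\<close>; all other good points lie in cubes of mass at most 2^(-kl), and only
  \<open>N * 5 ^ CARD('n)\<close> cubes are near \<open>A\<close>. Taking \<open>l\<close> slightly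
  above log(N 5^d) / k makes the second term summable.\<close>

lemma near_measure_le2:
  assumes "finite A" "A \<noteq> {}" "card A \<le> N"
  shows "measure \<nu> {x. linf_setdist x A < 1 / 2 ^ k} \<le> measure \<nu> {x. X k x \<le> l} + real N * 5 ^ CARD('n) * 2 powr (- real k * l)"
proof (cases "k = 0")
  case True
  \<comment> \<open>At level 0 the rate is the default value 0, so the sign of \<open>l\<close>
    decides which of the two terms on the right is at least 1.\<close>
  show ?thesis
  proof (cases "l \<ge> 0")
    case True
    hence "{x. X k x \<le> l} = space \<nu>" using \<open>k = 0\<close> by (auto simp: info_rate_def space_eq)
    hence "measure \<nu> {x. X k x \<le> l} = 1" by (simp add: prob_space)
    moreover have "measure \<nu> {x. linf_setdist x A < 1 / 2 ^ k} \<le> 1" by simp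
    moreover have "0 \<le> real N * 5 ^ CARD('n) * 2 powr (- real k * l)" by simp
    ultimately show ?thesis by linarith
  next
    case False
    have "N \<ge> 1" using assms by (metis One_nat_def Suc_leI card_gt_0_iff le_trans)
    hence "1 * 1 \<le> real N * 5 ^ CARD('n)" by (intro mult_mono) auto
    hence "1 \<le> real N * 5 ^ CARD('n) * 2 powr (- real k * l)" using \<open>k = 0\<close> by simp
    moreover have "measure \<nu> {x. linf_setdist x A < 1 / 2 ^ k} \<le> 1" by simp
    moreover have "0 \<le> measure \<nu> {x. X k x \<le> l}" by simp
    ultimately show ?thesis by linarith
  qed
next
  case False
  hence k: "k > 0" by simp
  let ?S = "{x. linf_setdist x A < 1 / 2 ^ k}"
  let ?L = "{x. X k x \<le> l}"
  let ?Q = "{Q \<in> dyadic_cubes k. Q \<inter> ?S \<noteq> {} \<and> measure \<nu> Q \<le> 2 powr (- real k * l)}"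
  have S: "?S \<in> sets \<nu>" by (rule setdist_sets[OF assms(1,2)])
  have L: "?L \<in> sets \<nu>" by (rule X_sets)
  have "(?S - ?L) \<inter> good \<subseteq> \<Union>?Q"
  proof
    fix x assume x: "x \<in> (?S - ?L) \<inter> good"
    hence "mass k x = 2 powr (- real k * X k x)" using mass_eq_powr k by blast
    also have "\<dots> \<le> 2 powr (- real k * l)" using x k by (intro powr_mono) auto
    finally have "dyadic_cube_at k x \<in> ?Q"
      using x good_unit dyadic_cube_at_eq(2) mem_dyadic_cube_at by blast
    thus "x \<in> \<Union>?Q" using x good_unit mem_dyadic_cube_at by blast
  qed
  hence "measure \<nu> (?S - ?L) \<le> (\<Sum>Q\<in>?Q. measure \<nu> Q)"
    using S L by (intro measure_le_sum_meeting) auto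
  also have "\<dots> \<le> real (card ?Q) * 2 powr (- real k * l)"
    by (rule sum_bounded_above) auto
  also have "\<dots> \<le> real (N * 5 ^ CARD('n)) * 2 powr (- real k * l)"
  proof (intro mult_right_mono of_nat_mono)
    have "card ?Q \<le> card {Q \<in> dyadic_cubes k. Q \<inter> ?S \<noteq> {}}"
      by (intro card_mono finite_subset[OF _ finite_dyadic_cubes[of k]]) auto
    thus "card ?Q \<le> N * 5 ^ CARD('n)" using cubes_near_finite_set[OF assms] le_trans by blast
  qed simp
  finally have 1: "measure \<nu> (?S - ?L) \<le> real N * 5 ^ CARD('n) * 2 powr (- real k * l)" by simp
  have "measure \<nu> ?S \<le> measure \<nu> (?L \<union> (?S - ?L))" using S L by (intro finite_measure_mono) auto
  also have "\<dots> \<le> measure \<nu> ?L + measure \<nu> (?S - ?L)" using S L by (intro measure_Un_le) auto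
  finally show ?thesis using 1 by linarith
qed

text \<open>The layer count integrated. With nonnegative integrals it applies before integrability
  is known, and indeed provides it.\<close>

lemma nn_integral_log_dist_le:
  assumes A: "finite A" "A \<noteq> {}"
    and b: "\<And>k. measure \<nu> {x. linf_setdist x A < 1 / 2 ^ k} \<le> b k" "summable b"
  shows "(\<integral>\<^sup>+x. ennreal (- log 2 (linf_setdist x A)) \<partial>\<nu>) \<le> ennreal (\<Sum>k. b k)"
proof -
  have b0: "b k \<ge> 0" for k using b(1)[of k] measure_nonneg order_trans by blast
  let ?S = "\<lambda>k. {x. linf_setdist x A < 1 / 2 ^ k}"
  have "(\<integral>\<^sup>+x. ennreal (- log 2 (linf_setdist x A)) \<partial>\<nu>) \<le> (\<integral>\<^sup>+x. (\<Sum>k. indicator (?S k) x) \<partial>\<nu>)"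
  proof (rule nn_integral_mono)
    fix x
    have "ennreal (- log 2 (linf_setdist x A)) \<le> (\<Sum>k. indicator {k. linf_setdist x A < 1 / 2 ^ k} k)"
      by (rule neg_log_le_layers[OF linf_setdist_nonneg[OF A(2)]])
    thus "ennreal (- log 2 (linf_setdist x A)) \<le> (\<Sum>k. indicator (?S k) x)"
      by (simp add: indicator_def)
  qed
  also have "\<dots> = (\<Sum>k. (\<integral>\<^sup>+x. indicator (?S k) x \<partial>\<nu>))"
    using setdist_sets[OF A] by (intro nn_integral_suminf) auto
  also have "\<dots> = (\<Sum>k. emeasure \<nu> (?S k))"
    using setdist_sets[OF A] by (intro suminf_cong nn_integral_indicator)
  also have "\<dots> \<le> (\<Sum>k. ennreal (b k))"
    using b(1) by (intro suminf_le) (auto simp: emeasure_eq_measure intro: ennreal_leI)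
  also have "\<dots> = ennreal (\<Sum>k. b k)" by (rule suminf_ennreal2[OF b0 b(2)])
  finally show ?thesis .
qed

text \<open>The negative part is summed over layers by the crude mass bound; the positive part is
  bounded, as any \<open>y\<close> in \<open>A\<close> is within \<open>1 + infnorm y\<close> of the
  unit cube. Without integrability the integral would default to 0 and pointwise lower bounds could
  not be integrated.\<close>

lemma integrable_log_dist:
  assumes A: "finite A" "A \<noteq> {}"
  shows "integrable \<nu> (\<lambda>x. log 2 (linf_setdist x A))"
proof -
  have meas: "(\<lambda>x. linf_setdist x A) \<in> borel_measurable \<nu>"
    using borel_linf_setdist[OF A(1)] measurable_cong_sets[OF sets_eq refl] by blast
  obtain y where y: "y \<in> A" using A by blast
  let ?B = "1 + infnorm y"
  have B: "AE x in \<nu>. log 2 (linf_setdist x A) \<le> log 2 ?B"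
    using AE_good
  proof eventually_elim
    case (elim x)
    have "infnorm x \<le> 1" using good_unit[OF elim] by (auto simp: infnorm_le_iff unit_cube_def)
    moreover have "linf_setdist x A \<le> infnorm (x - y)" by (rule linf_setdist_le[OF A(1) y])
    moreover have "infnorm (x - y) \<le> infnorm x + infnorm y"
      using infnorm_triangle[of x "- y"] by (simp add: infnorm_neg)
    ultimately have "linf_setdist x A \<le> ?B" by simp
    moreover have "1 \<le> ?B" by (simp add: infnorm_pos_le)
    ultimately show ?case using linf_setdist_nonneg[OF A(2), of x]
      by (cases "linf_setdist x A = 0") (auto simp: log_def divide_right_mono)
  qed
  have lB: "0 \<le> log 2 ?B" using infnorm_pos_le[of y] by simp
  let ?b = "\<lambda>k. real (card A) * 5 ^ CARD('n) * C * 2 powr (- a * real k)"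
  have sb: "summable ?b" using sum_powr_geometric_le(2)[OF a_pos] by (rule summable_mult)
  have fin: "(\<integral>\<^sup>+x. ennreal (- log 2 (linf_setdist x A)) \<partial>\<nu>) < \<infinity>"
    using nn_integral_log_dist_le[OF A near_measure_le1[OF A order_refl] sb]
    by (rule order.strict_trans1) simp
  show ?thesis
  proof (rule integrableI_bounded)
    show "(\<lambda>x. log 2 (linf_setdist x A)) \<in> borel_measurable \<nu>" using meas by measurable
    have "(\<integral>\<^sup>+x. ennreal (norm (log 2 (linf_setdist x A))) \<partial>\<nu>) \<le>
       (\<integral>\<^sup>+x. ennreal (- log 2 (linf_setdist x A)) + ennreal (log 2 ?B) \<partial>\<nu>)"
    proof (rule nn_integral_mono_AE)
      show "AE x in \<nu>. ennreal (norm (log 2 (linf_setdist x A))) \<le> ennreal (- log 2 (linf_setdist x A)) + ennreal (log 2 ?B)"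
        using B
      proof eventually_elim
        case (elim x)
        show ?case
        proof (cases "log 2 (linf_setdist x A) \<ge> 0")
          case True
          thus ?thesis using elim by (simp add: ennreal_neg ennreal_leI)
        next
          case False
          thus ?thesis by (simp add: add_increasing2)
        qed
      qed
    qed
    also have "\<dots> = (\<integral>\<^sup>+x. ennreal (- log 2 (linf_setdist x A)) \<partial>\<nu>) + (\<integral>\<^sup>+x. ennreal (log 2 ?B) \<partial>\<nu>)"
      using meas by (intro nn_integral_add) auto
    also have "\<dots> < \<infinity>" using fin by (simp add: emeasure_space_1)
    finally show "(\<integral>\<^sup>+x. ennreal (norm (log 2 (linf_setdist x A))) \<partial>\<nu>) < \<infinity>" .
  qed
qed

text \<open>Exchange of the sum over levels with the expectation: \<open>y \<le> n / k + c\<close>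
  says that the \<open>k\<close>-th multiple of \<open>y - c\<close> is at most \<open>n\<close>,
  and about \<open>n / (y - c)\<close> multiples are. This is how the mean of 1/Y enters.\<close>

lemma sum_cdf_eq:
  "(\<Sum>k\<in>{1..K}. cdf \<rho> (n / real k + c)) = (LINT y|\<rho>. real (card {k \<in> {1..K}. real k * (y - c) \<le> n}))"
proof -
  have "(\<Sum>k\<in>{1..K}. cdf \<rho> (n / real k + c)) = (\<Sum>k\<in>{1..K}. LINT y|\<rho>. indicator {..n / real k + c} y)"
    by (simp add: cdf_def)
  also have "\<dots> = (LINT y|\<rho>. (\<Sum>k\<in>{1..K}. indicator {..n / real k + c} y))"
    by (rule Bochner_Integration.integral_sum[symmetric]) (auto simp: R.emeasure_eq_measure)
  also have "\<dots> = (LINT y|\<rho>. real (card {k \<in> {1..K}. real k * (y - c) \<le> n}))"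
  proof (rule Bochner_Integration.integral_cong[OF refl])
    fix y
    have "(\<Sum>k\<in>{1..K}. indicator {..n / real k + c} y) = (\<Sum>k\<in>{1..K}. if real k * (y - c) \<le> n then 1 else 0 :: real)"
      by (intro sum.cong) (auto simp: indicator_def field_simps)
    thus "(\<Sum>k\<in>{1..K}. indicator {..n / real k + c} y) = real (card {k \<in> {1..K}. real k * (y - c) \<le> n})"
      using sum_if_le_card by simp
  qed
  finally show ?thesis .
qed

lemma integrable_count: "integrable \<rho> (\<lambda>y. real (card {k \<in> {1..K}. real k * (y - c) \<le> n}))"
proof -
  have "(\<lambda>y. real (card {k \<in> {1..K}. real k * (y - c) \<le> n})) = (\<lambda>y. \<Sum>k\<in>{1..K}. if real k * (y - c) \<le> n then 1 else 0)"
    using sum_if_le_card by simp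
  moreover have "integrable \<rho> (\<lambda>y. \<Sum>k\<in>{1..K}. if real k * (y - c) \<le> n then 1 else 0 :: real)"
    by (intro Bochner_Integration.integrable_sum R.integrable_const_bound[where B=1]) auto
  ultimately show ?thesis by simp
qed

text \<open>Since \<open>c \<le> a / 2\<close> keeps \<open>y - c\<close> above
  \<open>a / 2\<close>, replacing \<open>1 / (y - c)\<close> by \<open>1 / y\<close> costs at most c
  / (a * a/2).\<close>

lemma sum_cdf_le:
  assumes "n \<ge> 0" "0 < c" "c \<le> a / 2"
  shows "(\<Sum>k\<in>{1..K}. cdf \<rho> (n / real k + c)) \<le> n * (H + 2 * c / a\<^sup>2)"
proof -
  have "(LINT y|\<rho>. real (card {k \<in> {1..K}. real k * (y - c) \<le> n})) \<le> (LINT y|\<rho>. n * (1 / y + 2 * c / a\<^sup>2))"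
  proof (rule integral_mono_AE[OF integrable_count])
    show "integrable \<rho> (\<lambda>y. n * (1 / y + 2 * c / a\<^sup>2))" using integrable_inverse[of 0] m_bounds by simp
    show "AE y in \<rho>. real (card {k \<in> {1..K}. real k * (y - c) \<le> n}) \<le> n * (1 / y + 2 * c / a\<^sup>2)"
      using AE_between
    proof eventually_elim
      case (elim y)
      have y: "a \<le> y" "0 < y" "a / 2 \<le> y - c" "0 < y - c" using elim m_bounds assms a_pos by auto
      have "1 / (y - c) - 1 / y = c / (y * (y - c))" using y by (simp add: field_simps)
      also have "\<dots> \<le> c / (a * (a / 2))" using y assms a_pos by (intro divide_left_mono mult_mono) auto
      finally have "1 / (y - c) \<le> 1 / y + 2 * c / a\<^sup>2" by (simp add: power2_eq_square mult.commute)
      hence "n * (1 / (y - c)) \<le> n * (1 / y + 2 * c / a\<^sup>2)" using assms by (intro mult_left_mono) auto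
      thus ?case using count_multiples_le[OF assms(1) y(4), of K] by simp
    qed
  qed
  also have "\<dots> = n * (H + 2 * c / a\<^sup>2)"
    unfolding H_def using integrable_inverse[of 0] m_bounds by simp
  finally show ?thesis unfolding sum_cdf_eq .
qed

text \<open>Replacing \<open>1 / (y + c)\<close> by \<open>1 / y\<close> costs at most c / a^2, and
  the floor in the count costs 1.\<close>

lemma sum_cdf_ge:
  assumes "n \<ge> 0" "0 < c" "n / a < real K + 1"
  shows "(\<Sum>k\<in>{1..K}. cdf \<rho> (n / real k - c)) \<ge> n * (H - c / a\<^sup>2) - 1"
proof -
  have "n * (H - c / a\<^sup>2) - 1 = (LINT y|\<rho>. n * (1 / y - c / a\<^sup>2) - 1)"
    unfolding H_def using integrable_inverse[of 0] m_bounds by simp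
  also have "\<dots> \<le> (LINT y|\<rho>. real (card {k \<in> {1..K}. real k * (y - (- c)) \<le> n}))"
  proof (rule integral_mono_AE[OF _ integrable_count])
    show "integrable \<rho> (\<lambda>y. n * (1 / y - c / a\<^sup>2) - 1)" using integrable_inverse[of 0] m_bounds by simp
    show "AE y in \<rho>. n * (1 / y - c / a\<^sup>2) - 1 \<le> real (card {k \<in> {1..K}. real k * (y - (- c)) \<le> n})"
      using AE_between
    proof eventually_elim
      case (elim y)
      have y: "a \<le> y" "0 < y" "0 < y + c" using elim m_bounds assms a_pos by auto
      have "1 / y - 1 / (y + c) = c / (y * (y + c))" using y by (simp add: field_simps)
      also have "\<dots> \<le> c / (a * a)" using y assms a_pos by (intro divide_left_mono mult_mono) auto
      finally have "1 / y - c / a\<^sup>2 \<le> 1 / (y + c)" by (simp add: power2_eq_square)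
      hence "n * (1 / y - c / a\<^sup>2) \<le> n * (1 / (y + c))" using assms by (intro mult_left_mono) auto
      moreover have "n / (y + c) \<le> n / a" using y a_pos assms by (intro divide_left_mono) auto
      ultimately show ?case using count_multiples_ge[OF assms(1) y(3), of K] assms(3) by simp
    qed
  qed
  finally show ?thesis using sum_cdf_eq[of n "- c" K] by simp
qed

text \<open>Layers up to about \<open>n / a\<close> are bounded by \<open>near_measure_le2\<close>,
  later ones by \<open>near_measure_le1\<close>. Here \<open>n\<close> is the logarithm of
  \<open>N * 5 ^ CARD('n)\<close>, so that the neighbouring cubes only change the constant. It
  matters that \<open>c\<close> depends on neither \<open>N\<close> nor \<open>A\<close>.\<close>

lemma log_dist_upper:
  assumes "\<eta> > 0"
  shows "\<exists>c. \<forall>N A. finite A \<longrightarrow> A \<noteq> {} \<longrightarrow> card A \<le> N \<longrightarrow>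
    - (LINT x|\<nu>. log 2 (linf_setdist x A)) \<le> log 2 (real N) * (H + \<eta>) + c"
proof -
  \<comment> \<open>The bound \<open>a / 4\<close> makes the total shift
    \<open>2 * \<epsilon>\<close> admissible in \<open>sum_cdf_le\<close>. The other bound gives
    \<eta> room for the cost \<open>4 * \<epsilon> / a\<^sup>2\<close> of this shift and the cost
    \<open>\<epsilon> / a\<close> of Levy errors on about \<open>n / a\<close> levels.\<close>
  define \<epsilon> where "\<epsilon> = min (a / 4) (\<eta> / (4 / a\<^sup>2 + 1 / a))"
  have pos: "4 / a\<^sup>2 + 1 / a > 0" using a_pos by (simp add: add_pos_pos)
  have "\<epsilon> > 0" using a_pos assms pos by (simp add: \<epsilon>_def)
  moreover have "\<epsilon> \<le> a / 4" unfolding \<epsilon>_def by (rule min.cobounded1)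
  ultimately have \<epsilon>: "\<epsilon> > 0" "\<epsilon> \<le> a / 4" by auto
  have "\<epsilon> \<le> \<eta> / (4 / a\<^sup>2 + 1 / a)" by (simp add: \<epsilon>_def)
  hence \<epsilon>\<eta>: "\<epsilon> * (4 / a\<^sup>2 + 1 / a) \<le> \<eta>" using pos by (simp add: pos_le_divide_eq)
  obtain k0 where k0: "\<And>k y. k \<ge> k0 \<Longrightarrow> measure \<nu> {x. X k x \<le> y} \<le> cdf \<rho> (y + \<epsilon>) + \<epsilon>"
    using levy[OF \<epsilon>(1)] unfolding eventually_sequentially by blast
  \<comment> \<open>In order: level 0, the levels below \<open>k0\<close>, the rounding in the
    number of levels, and the geometric series of the low and of the high levels.\<close>
  define c0 where "c0 = 1 + real k0 + 2 * \<epsilon> + 1 / (1 - 2 powr (- \<epsilon>)) + C / (1 - 2 powr (- a))"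
  define c where "c = real CARD('n) * log 2 5 * (H + \<eta>) + c0"
  show ?thesis
  proof (intro exI[of _ c] allI impI)
    fix N and A :: "(real ^ 'n) set" assume A: "finite A" "A \<noteq> {}" "card A \<le> N"
    have N: "N \<ge> 1" using A by (metis One_nat_def Suc_leI card_gt_0_iff le_trans)
    define n where "n = log 2 (real N * 5 ^ CARD('n))"
    have n_eq: "n = log 2 (real N) + real CARD('n) * log 2 5"
      unfolding n_def using N by (simp add: log_mult log_nat_power)
    have n0: "n \<ge> 0" unfolding n_eq using N by simp
    have pn: "2 powr n = real N * 5 ^ CARD('n)" unfolding n_def using N by simp
    define K where "K = nat \<lceil>n / a\<rceil>"
    have K: "n / a \<le> real K" "real K \<le> n / a + 1" unfolding K_def using n0 a_pos by (linarith, simp add: ceiling_correct of_nat_nat) 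
    \<comment> \<open>With threshold \<open>n / k + \<epsilon>\<close> the light near cubes carry at
      most 2^n * 2^(-n - \<epsilon> k); the surplus \<epsilon> makes this summable in
      \<open>k\<close>.\<close>
    let ?F = "\<lambda>k. measure \<nu> {x. X k x \<le> n / real k + \<epsilon>} + 2 powr (- \<epsilon> * real k)"
    let ?G = "\<lambda>k. C * 2 powr (- a * (real k - real K))"
    define b where "b k = (if k \<le> K then ?F k else ?G k)" for k
    have b_le: "measure \<nu> {x. linf_setdist x A < 1 / 2 ^ k} \<le> b k" for k
    proof (cases "k \<le> K")
      case True
      have "real N * 5 ^ CARD('n) * 2 powr (- real k * (n / real k + \<epsilon>)) \<le> 2 powr (- \<epsilon> * real k)" if "k > 0"
      proof -
        have "- real k * (n / real k + \<epsilon>) = - n + (- \<epsilon> * real k)" using that by (simp add: field_simps)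
        thus ?thesis unfolding pn[symmetric] by (simp add: powr_add[symmetric])
      qed
      moreover have "measure \<nu> {x. linf_setdist x A < 1 / 2 ^ k} \<le> ?F k" if "k = 0"
      proof -
        have "{x. X k x \<le> n / real k + \<epsilon>} = space \<nu>" using that \<epsilon> by (auto simp: info_rate_def space_eq)
        hence "measure \<nu> {x. X k x \<le> n / real k + \<epsilon>} = 1" by (simp add: prob_space)
        moreover have "measure \<nu> {x. linf_setdist x A < 1 / 2 ^ k} \<le> 1" by simp
        ultimately show ?thesis by (smt (verit) powr_ge_zero)
      qed
      ultimately have "measure \<nu> {x. linf_setdist x A < 1 / 2 ^ k} \<le> ?F k"
        using near_measure_le2[OF A, of k "n / real k + \<epsilon>"] by (cases "k = 0") fastforce+
      thus ?thesis using True by (simp add: b_def)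
    next
      case False
      have "real N * 5 ^ CARD('n) * C * 2 powr (- a * real k) = C * (2 powr n * 2 powr (- a * real k))"
        unfolding pn by simp
      also have "\<dots> = C * 2 powr (n - a * real k)" by (simp add: powr_add[symmetric])
      also have "\<dots> \<le> ?G k"
      proof (intro mult_left_mono powr_mono)
        have "n \<le> a * real K" using K(1) a_pos by (simp add: field_simps)
        thus "n - a * real k \<le> - a * (real k - real K)" by (simp add: algebra_simps)
      qed (use C_ge in auto)
      finally show ?thesis using near_measure_le1[OF A, of k] False by (simp add: b_def)
    qed
    have G_shift: "?G (j + Suc K) = C * 2 powr (- a) * 2 powr (- a * real j)" for j
      by (simp add: powr_add[symmetric] algebra_simps)
    have b_shift: "b (j + Suc K) = C * 2 powr (- a) * 2 powr (- a * real j)" for j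
      unfolding G_shift[symmetric] by (simp add: b_def)
    have sum_shift: "summable (\<lambda>j. b (j + Suc K))"
      unfolding b_shift using sum_powr_geometric_le(2)[OF a_pos] by (rule summable_mult)
    hence sb: "summable b" by (rule summable_iff_shift[THEN iffD1])
    have "- (LINT x|\<nu>. log 2 (linf_setdist x A)) = (LINT x|\<nu>. - log 2 (linf_setdist x A))" by simp
    also have "\<dots> \<le> (\<Sum>k. b k)"
      using nn_integral_log_dist_le[OF A(1,2) b_le sb] 
    proof (intro integral_real_bounded)
      show "0 \<le> (\<Sum>k. b k)" using b_le by (intro suminf_nonneg[OF sb]) (meson measure_nonneg order_trans)
    qed
    also have "(\<Sum>k. b k) = (\<Sum>j. b (j + Suc K)) + (\<Sum>k<Suc K. b k)" by (rule suminf_split_initial_segment[OF sb])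
    also have "(\<Sum>j. b (j + Suc K)) \<le> C / (1 - 2 powr (- a))"
    proof -
      have lt1: "2 powr (- a) < (1 :: real)" using a_pos by (simp add: powr_less_one)
      have "(\<Sum>j. b (j + Suc K)) = C * 2 powr (- a) * (1 / (1 - 2 powr (- a)))"
        unfolding b_shift sum_powr_geometric_le(3)[OF a_pos, symmetric]
        using sum_powr_geometric_le(2)[OF a_pos] by (rule suminf_mult)
      also have "\<dots> \<le> C * 1 * (1 / (1 - 2 powr (- a)))"
        using C_ge lt1 by (intro mult_right_mono mult_left_mono) auto
      finally show ?thesis by simp
    qed
    also have "(\<Sum>k<Suc K. b k) = (\<Sum>k\<le>K. ?F k)" unfolding lessThan_Suc_atMost b_def by (intro sum.cong) auto
    also have "(\<Sum>k\<le>K. ?F k) = (\<Sum>k\<le>K. measure \<nu> {x. X k x \<le> n / real k + \<epsilon>}) + (\<Sum>k\<le>K. 2 powr (- \<epsilon> * real k))"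
      by (rule sum.distrib)
    also have "(\<Sum>k\<le>K. 2 powr (- \<epsilon> * real k)) \<le> 1 / (1 - 2 powr (- \<epsilon>))" by (rule sum_powr_geometric_le(1)[OF \<epsilon>(1)])
    \<comment> \<open>Level 0 and the levels below \<open>k0\<close> receive the trivial bound 1;
      the Levy comparison doubles the shift on the others.\<close>
    also have "(\<Sum>k\<le>K. measure \<nu> {x. X k x \<le> n / real k + \<epsilon>}) \<le>
        (\<Sum>k\<le>K. (if k = 0 then 1 else 0) + (if k < k0 then 1 else 0) + \<epsilon> + (if k = 0 then 0 else cdf \<rho> (n / real k + 2 * \<epsilon>)))"
    proof (rule sum_mono)
      fix k
      have c0: "cdf \<rho> (n / real k + 2 * \<epsilon>) \<ge> 0" by (rule R.cdf_nonneg)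
      have p1: "measure \<nu> {x. X k x \<le> n / real k + \<epsilon>} \<le> 1" by simp
      show "measure \<nu> {x. X k x \<le> n / real k + \<epsilon>} \<le> (if k = 0 then 1 else 0) + (if k < k0 then 1 else 0) + \<epsilon> + (if k = 0 then 0 else cdf \<rho> (n / real k + 2 * \<epsilon>))"
        using k0[of k "n / real k + \<epsilon>"] c0 p1 \<epsilon>(1) by (auto simp: add.assoc not_less simp del: prob_le_1)
    qed
    also have "\<dots> = (\<Sum>k\<le>K. if k = 0 then 1 else 0) + (\<Sum>k\<le>K. if k < k0 then 1 else 0) + (\<Sum>k\<le>K. \<epsilon>) + (\<Sum>k\<le>K. if k = 0 then 0 else cdf \<rho> (n / real k + 2 * \<epsilon>))"
      by (simp only: sum.distrib)
    also have "(\<Sum>k\<le>K. if k = 0 then 1 else 0 :: real) = 1" by simp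
    also have "(\<Sum>k\<le>K. if k < k0 then 1 else 0 :: real) \<le> real k0"
    proof -
      have "(\<Sum>k\<le>K. if k < k0 then 1 else 0 :: real) = real (card ({..K} \<inter> {k. k < k0}))" by (simp add: sum.If_cases)
      also have "\<dots> \<le> real (card {..<k0})" by (intro of_nat_mono card_mono) auto
      finally show ?thesis by simp
    qed
    also have "(\<Sum>k\<le>K. \<epsilon>) \<le> (n / a + 2) * \<epsilon>" using K(2) \<epsilon>(1) by (simp add: mult_right_mono)
    also have "(\<Sum>k\<le>K. if k = 0 then 0 else cdf \<rho> (n / real k + 2 * \<epsilon>)) = (\<Sum>k\<in>{1..K}. cdf \<rho> (n / real k + 2 * \<epsilon>))"
      by (intro sum.mono_neutral_cong_right) auto
    also have "\<dots> \<le> n * (H + 2 * (2 * \<epsilon>) / a\<^sup>2)" using \<epsilon> by (intro sum_cdf_le n0) auto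
    finally have "- (LINT x|\<nu>. log 2 (linf_setdist x A)) \<le>
      C / (1 - 2 powr (- a)) + (1 + real k0 + (n / a + 2) * \<epsilon> + n * (H + 2 * (2 * \<epsilon>) / a\<^sup>2) + 1 / (1 - 2 powr (- \<epsilon>)))"
      by simp
    also have "\<dots> = n * (H + \<epsilon> * (4 / a\<^sup>2 + 1 / a)) + c0"
      unfolding c0_def by (simp add: algebra_simps)
    also have "\<dots> \<le> n * (H + \<eta>) + c0" using \<epsilon>\<eta> n0 by (simp add: mult_left_mono)
    also have "\<dots> = log 2 (real N) * (H + \<eta>) + c" unfolding n_eq c_def by (simp add: algebra_simps)
    finally show "- (LINT x|\<nu>. log 2 (linf_setdist x A)) \<le> log 2 (real N) * (H + \<eta>) + c" .
  qed
qed

section \<open>Quantizers built from heavy cubes\<close>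

lemma cube_0: "x \<in> unit_cube \<Longrightarrow> dyadic_cube_at 0 x = unit_cube"
  using dyadic_index_less[of 0] by (auto simp: dyadic_cube_at_eq)

lemma measure_unit_cube: "measure \<nu> unit_cube = 1"
  using prob_eq_1[of unit_cube] AE_unit_cube borel_unit_cube sets_eq by blast

text \<open>If the cube of \<open>x\<close> at level \<open>k\<close> is heavy, then
  \<open>A\<close> has a point within 2^(-k) of \<open>x\<close>. Hence \<open>- log 2\<close> of
  the distance is at least the largest heavy level, and a finite set of positive integers has at
  most as many elements as its maximum. This turns the distance into the number of heavy
  levels.\<close>

lemma heavy_cubes_lower:
  assumes n: "n \<ge> 0"
  defines "K \<equiv> nat \<lfloor>n / a\<rfloor>"
  shows "\<exists>A. finite A \<and> A \<noteq> {} \<and> real (card A) \<le> (n / a + 1) * 2 powr n \<and>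
    (\<Sum>k\<in>{1..K}. measure \<nu> {x. X k x \<le> n / real k}) \<le> - (LINT x|\<nu>. log 2 (linf_setdist x A))"
proof -
  define \<Q> where "\<Q> k = {Q \<in> dyadic_cubes k. measure \<nu> Q \<ge> 2 powr (- n)}" for k
  define rep where "rep Q = (SOME x. x \<in> Q)" for Q :: "(real ^ 'n) set"
  define A where "A = (\<Union>k\<in>{..K}. rep ` \<Q> k)"
  have fin: "finite (\<Q> k)" for k unfolding \<Q>_def by (rule finite_subset[OF _ finite_dyadic_cubes[of k]]) auto
  have rep: "rep Q \<in> Q" if "Q \<in> \<Q> k" for Q k
  proof -
    have "0 < (2 :: real) powr (- n)" by simp
    also have "\<dots> \<le> measure \<nu> Q" using that unfolding \<Q>_def by simp
    finally have "measure \<nu> Q > 0" .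
    hence "Q \<noteq> {}" by auto
    thus ?thesis unfolding rep_def by (simp add: some_in_eq)
  qed
  have finA: "finite A" unfolding A_def using fin by auto
  \<comment> \<open>Level 0 contributes a point for every \<open>n\<close>. It makes
    \<open>A\<close> nonempty and settles the points for which no level is counted.\<close>
  have unit: "unit_cube \<in> \<Q> 0"
  proof -
    have "unit_cube \<noteq> ({} :: (real ^ 'n) set)" using measure_unit_cube by auto
    then obtain x :: "real ^ 'n" where "x \<in> unit_cube" by blast
    hence "(unit_cube :: (real ^ 'n) set) \<in> dyadic_cubes 0" using cube_0 dyadic_cube_at_eq(2) by metis
    moreover have "2 powr (- n) \<le> 1" using powr_mono[of "- n" 0 2] n by simp
    ultimately show ?thesis unfolding \<Q>_def using measure_unit_cube by simp
  qed
  have neA: "A \<noteq> {}" unfolding A_def using unit by blast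
  have "real (card A) \<le> (\<Sum>k\<le>K. real (card (rep ` \<Q> k)))"
    unfolding A_def using card_UN_le[of "{..K}" "\<lambda>k. rep ` \<Q> k"] of_nat_mono[where 'a=real] by fastforce
  also have "\<dots> \<le> (\<Sum>k\<le>K. 2 powr n)"
  proof (rule sum_mono)
    fix k
    have "real (card (rep ` \<Q> k)) \<le> real (card (\<Q> k))" using card_image_le[OF fin] by simp
    also have "\<dots> \<le> 1 / (2 powr (- n))" unfolding \<Q>_def by (rule card_heavy_cubes) simp
    finally show "real (card (rep ` \<Q> k)) \<le> 2 powr n" by (simp add: powr_minus_divide)
  qed
  also have "\<dots> \<le> (n / a + 1) * 2 powr n"
    unfolding K_def using n a_pos by (simp add: mult_right_mono)
  finally have cardA: "real (card A) \<le> (n / a + 1) * 2 powr n" .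
  \<comment> \<open>On \<open>A\<close> itself the distance is 0 and its logarithm the default 0, so
    the pointwise bound could fail there.\<close>
  have AE_A: "AE x in \<nu>. x \<notin> A"
  proof -
    have "A \<in> null_sets \<nu>"
    proof -
      have "(\<Union>x\<in>A. {x}) \<in> null_sets \<nu>"
        using finA atomless by (intro null_sets_UN') (auto simp: null_sets_def emeasure_eq_measure sets_eq countable_finite)
      thus ?thesis by simp
    qed
    thus ?thesis by (rule AE_not_in)
  qed
  have close: "linf_setdist x A \<le> 1 / 2 ^ k" if "x \<in> good" "k \<le> K" "mass k x \<ge> 2 powr (- n)" for x k
  proof -
    have Q: "dyadic_cube_at k x \<in> \<Q> k"
      unfolding \<Q>_def using that good_unit dyadic_cube_at_eq(2) by blast
    hence "rep (dyadic_cube_at k x) \<in> A" unfolding A_def using that by blast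
    hence "linf_setdist x A \<le> infnorm (x - rep (dyadic_cube_at k x))" by (rule linf_setdist_le[OF finA])
    also have "\<dots> \<le> 1 / 2 ^ k" using rep[OF Q] good_unit[OF that(1)] infnorm_dyadic_cube_at by blast
    finally show ?thesis .
  qed
  have count: "(\<Sum>k\<in>{1..K}. indicator {x. X k x \<le> n / real k} x) \<le> - log 2 (linf_setdist x A)"
    if x: "x \<in> good" "x \<notin> A" for x
  proof -
    define J where "J = {k \<in> {1..K}. X k x \<le> n / real k}"
    have pos: "linf_setdist x A > 0" by (rule linf_setdist_pos[OF finA neA x(2)])
    have sumJ: "(\<Sum>k\<in>{1..K}. indicator {x. X k x \<le> n / real k} x :: real) = real (card J)"
      unfolding J_def sum_if_le_card[symmetric] by (intro sum.cong) (auto simp: indicator_def)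
    have layer: "real k \<le> - log 2 (linf_setdist x A)" if "k \<le> K" "mass k x \<ge> 2 powr (- n)" for k
    proof -
      have "log 2 (linf_setdist x A) \<le> log 2 (1 / 2 ^ k)" using close[OF x(1) that] pos by simp
      also have "\<dots> = - real k" by (simp add: log_divide log_nat_power)
      finally show ?thesis by simp
    qed
    show ?thesis
    proof (cases "J = {}")
      case True
      \<comment> \<open>No level from 1 to \<open>K\<close> counts, but level 0 still shows that
        \<open>- log 2\<close> of the distance is nonnegative.\<close>
      have "mass 0 x \<ge> 2 powr (- n)" using unit cube_0[OF good_unit[OF x(1)]] unfolding \<Q>_def by simp
      thus ?thesis using layer[of 0] True sumJ by simp
    next
      case False
      have finJ: "finite J" unfolding J_def by simp
      let ?k = "Max J"
      have kJ: "?k \<in> J" using finJ False by simp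
      hence k: "?k \<le> K" "?k > 0" "X ?k x \<le> n / real ?k" unfolding J_def by auto
      have "2 powr (- n) \<le> 2 powr (- real ?k * X ?k x)"
        using k by (intro powr_mono) (auto simp: field_simps)
      hence "2 powr (- n) \<le> mass ?k x" using mass_eq_powr[OF x(1) k(2)] by simp
      hence "real ?k \<le> - log 2 (linf_setdist x A)" using layer k by blast
      moreover have "card J \<le> ?k"
      proof -
        have "J \<subseteq> {1..?k}" using finJ by (auto simp: J_def)
        from card_mono[OF _ this] show ?thesis by simp
      qed
      ultimately show ?thesis using sumJ by simp
    qed
  qed
  have "(\<Sum>k\<in>{1..K}. measure \<nu> {x. X k x \<le> n / real k}) = (\<Sum>k\<in>{1..K}. LINT x|\<nu>. indicator {x. X k x \<le> n / real k} x)"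
    using X_sets by (simp add: space_eq)
  also have "\<dots> = (LINT x|\<nu>. (\<Sum>k\<in>{1..K}. indicator {x. X k x \<le> n / real k} x))"
    using X_sets by (intro Bochner_Integration.integral_sum[symmetric]) (auto simp: emeasure_eq_measure)
  also have "\<dots> \<le> (LINT x|\<nu>. - log 2 (linf_setdist x A))"
  proof (rule integral_mono_AE)
    show "integrable \<nu> (\<lambda>x. \<Sum>k\<in>{1..K}. indicator {x. X k x \<le> n / real k} x :: real)"
      using X_sets by (intro Bochner_Integration.integrable_sum) (auto simp: emeasure_eq_measure)
    show "integrable \<nu> (\<lambda>x. - log 2 (linf_setdist x A))" using integrable_log_dist[OF finA neA] by simp
    show "AE x in \<nu>. (\<Sum>k\<in>{1..K}. indicator {x. X k x \<le> n / real k} x) \<le> - log 2 (linf_setdist x A)"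
      using AE_good AE_A by eventually_elim (rule count)
  qed
  also have "\<dots> = - (LINT x|\<nu>. log 2 (linf_setdist x A))" by simp
  finally show ?thesis using finA neA cardA by blast
qed

lemma log_dist_lower:
  assumes "\<eta> > 0"
  shows "\<exists>c. \<forall>n\<ge>0. \<exists>A. finite A \<and> A \<noteq> {} \<and> real (card A) \<le> (n / a + 1) * 2 powr n \<and>
    n * (H - \<eta>) - c \<le> - (LINT x|\<nu>. log 2 (linf_setdist x A))"
proof -
  \<comment> \<open>The share \<open>\<epsilon> / a\<^sup>2\<close> pays for the shift in
    \<open>sum_cdf_ge\<close>, the share \<open>\<epsilon> / a\<close> for the Levy errors on at
    most \<open>n / a\<close> levels.\<close>
  define \<epsilon> where "\<epsilon> = \<eta> / (1 / a\<^sup>2 + 1 / a)"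
  have pos: "1 / a\<^sup>2 + 1 / a > 0" using a_pos by (simp add: add_pos_pos)
  have \<epsilon>: "\<epsilon> > 0" using assms pos by (simp add: \<epsilon>_def)
  have \<epsilon>\<eta>: "\<epsilon> * (1 / a\<^sup>2 + 1 / a) = \<eta>" using pos by (simp add: \<epsilon>_def)
  obtain k0 where k0: "\<And>k y. k \<ge> k0 \<Longrightarrow> cdf \<rho> (y - \<epsilon>) - \<epsilon> \<le> measure \<nu> {x. X k x \<le> y}"
    using levy[OF \<epsilon>(1)] unfolding eventually_sequentially by blast
  show ?thesis
  \<comment> \<open>The constant is the number \<open>k0\<close> of levels without Levy bound, plus
    the floor loss in \<open>sum_cdf_ge\<close>.\<close>
  proof (intro exI[of _ "real k0 + 1"] allI impI)
    fix n :: real assume n: "n \<ge> 0"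
    let ?K = "nat \<lfloor>n / a\<rfloor>"
    from heavy_cubes_lower[OF n] obtain A where A: "finite A" "A \<noteq> {}" "real (card A) \<le> (n / a + 1) * 2 powr n"
      and s: "(\<Sum>k\<in>{1..?K}. measure \<nu> {x. X k x \<le> n / real k}) \<le> - (LINT x|\<nu>. log 2 (linf_setdist x A))" by blast
    have K: "n / a < real ?K + 1" "real ?K \<le> n / a" using n a_pos by (linarith, simp)
    have "n * (H - \<epsilon> / a\<^sup>2) - 1 \<le> (\<Sum>k\<in>{1..?K}. cdf \<rho> (n / real k - \<epsilon>))"
      by (rule sum_cdf_ge[OF n \<epsilon> K(1)])
    also have "\<dots> \<le> (\<Sum>k\<in>{1..?K}. measure \<nu> {x. X k x \<le> n / real k} + (\<epsilon> + (if k < k0 then 1 else 0)))"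
    proof (rule sum_mono)
      fix k
      have "cdf \<rho> (n / real k - \<epsilon>) \<le> 1" by (rule R.cdf_bounded_prob)
      moreover have "0 \<le> measure \<nu> {x. X k x \<le> n / real k}" by simp
      ultimately show "cdf \<rho> (n / real k - \<epsilon>) \<le> measure \<nu> {x. X k x \<le> n / real k} + (\<epsilon> + (if k < k0 then 1 else 0))"
        using k0[of k "n / real k"] \<epsilon> by (cases "k < k0") (simp_all only: if_True if_False, linarith+)
    qed
    also have "\<dots> = (\<Sum>k\<in>{1..?K}. measure \<nu> {x. X k x \<le> n / real k}) + (real ?K * \<epsilon> + (\<Sum>k\<in>{1..?K}. if k < k0 then 1 else 0))"
      by (simp only: sum.distrib) simp
    also have "(\<Sum>k\<in>{1..?K}. if k < k0 then 1 else 0 :: real) \<le> real k0"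
    proof -
      have "card {k \<in> {1..?K}. k < k0} \<le> card {..<k0}" by (intro card_mono) auto
      thus ?thesis unfolding sum_if_le_card by simp
    qed
    also have "real ?K * \<epsilon> \<le> n / a * \<epsilon>" by (intro mult_right_mono K(2)) (use \<epsilon> in auto)
    finally have "n * (H - \<epsilon> / a\<^sup>2) - 1 - n / a * \<epsilon> - real k0 \<le> (\<Sum>k\<in>{1..?K}. measure \<nu> {x. X k x \<le> n / real k})"
      by simp
    also have "n * (H - \<epsilon> / a\<^sup>2) - 1 - n / a * \<epsilon> - real k0 = n * (H - \<epsilon> * (1 / a\<^sup>2 + 1 / a)) - (real k0 + 1)"
      by (simp add: algebra_simps)
    finally have "n * (H - \<eta>) - (real k0 + 1) \<le> - (LINT x|\<nu>. log 2 (linf_setdist x A))"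
      using s \<epsilon>\<eta> by simp
    thus "\<exists>A. finite A \<and> A \<noteq> {} \<and> real (card A) \<le> (n / a + 1) * 2 powr n \<and>
      n * (H - \<eta>) - (real k0 + 1) \<le> - (LINT x|\<nu>. log 2 (linf_setdist x A))" using A by blast
  qed
qed

section \<open>Asymptotics of the quantization error\<close>

lemma exp_ln_dist: "exp (LINT x|\<nu>. ln (linf_setdist x A)) = 2 powr (LINT x|\<nu>. log 2 (linf_setdist x A))"
proof -
  have "(LINT x|\<nu>. log 2 (linf_setdist x A)) = (LINT x|\<nu>. ln (linf_setdist x A)) / ln 2"
    unfolding log_def by simp
  thus ?thesis by (simp add: powr_def)
qed

lemma error_ge:
  assumes "N \<ge> 1" and "\<And>A. finite A \<Longrightarrow> A \<noteq> {} \<Longrightarrow> card A \<le> N \<Longrightarrow> - (LINT x|\<nu>. log 2 (linf_setdist x A)) \<le> B"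
  shows "2 powr (- B) \<le> geom_quant_error \<nu> N"
  unfolding geom_quant_error_def
proof (rule cINF_greatest)
  have "{0} \<in> {A :: (real ^ 'n) set. finite A \<and> 1 \<le> card A \<and> card A \<le> N}" using assms by simp
  thus "{A :: (real ^ 'n) set. finite A \<and> 1 \<le> card A \<and> card A \<le> N} \<noteq> {}" by blast
  fix A :: "(real ^ 'n) set" assume A: "A \<in> {A. finite A \<and> 1 \<le> card A \<and> card A \<le> N}"
  hence "A \<noteq> {}" by auto
  hence "- (LINT x|\<nu>. log 2 (linf_setdist x A)) \<le> B" using A by (intro assms(2)) auto
  thus "2 powr (- B) \<le> exp (LINT x|\<nu>. ln (linf_setdist x A))" unfolding exp_ln_dist by simp
qed

lemma error_le:
  assumes "finite A" "A \<noteq> {}" "card A \<le> N"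
  shows "geom_quant_error \<nu> N \<le> 2 powr (LINT x|\<nu>. log 2 (linf_setdist x A))"
  unfolding geom_quant_error_def exp_ln_dist
proof (rule cINF_lower)
  show "bdd_below ((\<lambda>A. 2 powr (LINT x|\<nu>. log 2 (linf_setdist x A))) ` {A. finite A \<and> 1 \<le> card A \<and> card A \<le> N})"
    by (intro bdd_belowI[of _ 0]) auto
  show "A \<in> {A. finite A \<and> 1 \<le> card A \<and> card A \<le> N}"
    using assms by (auto simp: Suc_le_eq card_gt_0_iff)
qed

text \<open>Positivity of each competitor does not suffice for an infimum; the bound of
  \<open>log_dist_upper\<close>, uniform in \<open>A\<close>, does.\<close>

lemma error_pos: assumes "N \<ge> 1" shows "geom_quant_error \<nu> N > 0"
proof -
  obtain c where c: "\<forall>N A. finite A \<longrightarrow> A \<noteq> {} \<longrightarrow> card A \<le> N \<longrightarrow>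
    - (LINT x|\<nu>. log 2 (linf_setdist x A)) \<le> log 2 (real N) * (H + 1) + c"
    using log_dist_upper[of 1] by auto
  have "0 < 2 powr (- (log 2 (real N) * (H + 1) + c))" by simp
  also have "\<dots> \<le> geom_quant_error \<nu> N" using c by (intro error_ge[OF assms]) blast
  finally show ?thesis .
qed

lemma log_error_tendsto: "(\<lambda>N. - log 2 (geom_quant_error \<nu> N) / log 2 (real N)) \<longlonglongrightarrow> H"
proof (rule order_tendstoI)
  fix u assume u: "H < u"
  define \<eta> where "\<eta> = (u - H) / 2"
  have \<eta>: "\<eta> > 0" "H + \<eta> < u" using u by (auto simp: \<eta>_def field_simps)
  obtain c where c: "\<forall>N A. finite A \<longrightarrow> A \<noteq> {} \<longrightarrow> card A \<le> N \<longrightarrow>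
    - (LINT x|\<nu>. log 2 (linf_setdist x A)) \<le> log 2 (real N) * (H + \<eta>) + c"
    using log_dist_upper[OF \<eta>(1)] by auto
  have "(\<lambda>N. (H + \<eta>) + c / log 2 (real N)) \<longlonglongrightarrow> (H + \<eta>) + 0"
    by (intro tendsto_add tendsto_const) real_asymp
  hence "\<forall>\<^sub>F N in sequentially. (H + \<eta>) + c / log 2 (real N) < u"
    using \<eta>(2) by (auto dest: order_tendstoD)
  thus "\<forall>\<^sub>F N in sequentially. - log 2 (geom_quant_error \<nu> N) / log 2 (real N) < u"
    using eventually_gt_at_top[of 1]
  proof eventually_elim
    case (elim N)
    hence l: "log 2 (real N) > 0" by simp
    have "2 powr (- (log 2 (real N) * (H + \<eta>) + c)) \<le> geom_quant_error \<nu> N"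
      using elim c by (intro error_ge) auto
    hence "- (log 2 (real N) * (H + \<eta>) + c) \<le> log 2 (geom_quant_error \<nu> N)"
      using error_pos[of N] elim by (subst le_log_iff) auto
    hence "- log 2 (geom_quant_error \<nu> N) \<le> log 2 (real N) * (H + \<eta>) + c" by simp
    hence "- log 2 (geom_quant_error \<nu> N) / log 2 (real N) \<le> (H + \<eta>) + c / log 2 (real N)"
      using l by (simp add: field_simps)
    thus ?case using elim by linarith
  qed
next
  fix l assume l: "l < H"
  \<comment> \<open>One \<eta> serves twice: as the error in \<open>log_dist_lower\<close>, and as
    the fraction of log N given up so that \<open>(n / a + 1) * 2 powr n\<close> points number at
    most \<open>N\<close>.\<close>
  have "((\<lambda>\<eta>. (1 - \<eta>) * (H - \<eta>)) \<longlongrightarrow> (1 - 0) * (H - 0)) (at_right (0 :: real))" by (intro tendsto_intros)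
  hence "\<forall>\<^sub>F \<eta> in at_right (0 :: real). l < (1 - \<eta>) * (H - \<eta>)" using l by (auto dest: order_tendstoD)
  moreover have "\<forall>\<^sub>F \<eta> in at_right (0 :: real). \<eta> < 1" 
    by (rule order_tendstoD(2)[OF tendsto_ident_at]) simp
  moreover have "\<forall>\<^sub>F \<eta> in at_right (0 :: real). 0 < \<eta>" by (rule eventually_at_right_less)
  ultimately have "\<forall>\<^sub>F \<eta> in at_right (0 :: real). l < (1 - \<eta>) * (H - \<eta>) \<and> \<eta> < 1 \<and> 0 < \<eta>" by eventually_elim auto
  then obtain \<eta> :: real where \<eta>: "l < (1 - \<eta>) * (H - \<eta>)" "\<eta> < 1" "0 < \<eta>"
    using eventually_happens'[OF trivial_limit_at_right_real] by blast
  obtain c where c: "\<forall>n\<ge>0. \<exists>A. finite A \<and> A \<noteq> {} \<and> real (card A) \<le> (n / a + 1) * 2 powr n \<and>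
    n * (H - \<eta>) - c \<le> - (LINT x|\<nu>. log 2 (linf_setdist x A))"
    using log_dist_lower[OF \<eta>(3)] by auto
  have "(\<lambda>N. (1 - \<eta>) * (H - \<eta>) - c / log 2 (real N)) \<longlonglongrightarrow> (1 - \<eta>) * (H - \<eta>) - 0"
    by (intro tendsto_diff tendsto_const) real_asymp
  hence "\<forall>\<^sub>F N in sequentially. l < (1 - \<eta>) * (H - \<eta>) - c / log 2 (real N)"
    using \<eta>(1) by (auto dest: order_tendstoD)
  moreover have "\<forall>\<^sub>F N in sequentially. ((1 - \<eta>) * log 2 (real N) / a + 1) * 2 powr ((1 - \<eta>) * log 2 (real N)) \<le> real N"
  proof -
    have "(\<lambda>N. ((1 - \<eta>) * log 2 (real N) / a + 1) * real N powr (- \<eta>)) \<longlonglongrightarrow> 0"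
      using \<eta> a_pos by real_asymp
    hence "\<forall>\<^sub>F N in sequentially. ((1 - \<eta>) * log 2 (real N) / a + 1) * real N powr (- \<eta>) < 1"
      by (rule order_tendstoD) simp
    thus ?thesis using eventually_gt_at_top[of 0]
    proof eventually_elim
      case (elim N)
      have "2 powr ((1 - \<eta>) * log 2 (real N)) = (2 powr (log 2 (real N))) powr (1 - \<eta>)"
        by (simp add: powr_powr mult.commute)
      also have "\<dots> = real N powr (1 - \<eta>)" using elim by simp
      also have "\<dots> = real N powr (- \<eta>) * real N" using elim by (simp add: powr_add[symmetric] powr_diff powr_minus_divide)
      finally have "((1 - \<eta>) * log 2 (real N) / a + 1) * 2 powr ((1 - \<eta>) * log 2 (real N)) =
        (((1 - \<eta>) * log 2 (real N) / a + 1) * real N powr (- \<eta>)) * real N" by simp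
      also have "\<dots> \<le> 1 * real N" using elim by (intro mult_right_mono) auto
      finally show ?case by simp
    qed
  qed
  ultimately show "\<forall>\<^sub>F N in sequentially. l < - log 2 (geom_quant_error \<nu> N) / log 2 (real N)"
    using eventually_gt_at_top[of 1]
  proof eventually_elim
    case (elim N)
    hence lN: "log 2 (real N) > 0" by simp
    let ?n = "(1 - \<eta>) * log 2 (real N)"
    have n: "?n \<ge> 0" using lN \<eta> by simp
    obtain A where A: "finite A" "A \<noteq> {}" "real (card A) \<le> (?n / a + 1) * 2 powr ?n"
      and s: "?n * (H - \<eta>) - c \<le> - (LINT x|\<nu>. log 2 (linf_setdist x A))" using c n by blast
    have "real (card A) \<le> real N" using A(3) elim(2) by linarith
    hence "geom_quant_error \<nu> N \<le> 2 powr (LINT x|\<nu>. log 2 (linf_setdist x A))"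
      using A by (intro error_le) auto
    hence "log 2 (geom_quant_error \<nu> N) \<le> (LINT x|\<nu>. log 2 (linf_setdist x A))"
      using error_pos[of N] elim by (simp add: log_le_iff)
    hence "?n * (H - \<eta>) - c \<le> - log 2 (geom_quant_error \<nu> N)" using s by linarith
    hence "(?n * (H - \<eta>) - c) / log 2 (real N) \<le> - log 2 (geom_quant_error \<nu> N) / log 2 (real N)"
      using lN by (intro divide_right_mono) auto
    also have "(?n * (H - \<eta>) - c) / log 2 (real N) = (1 - \<eta>) * (H - \<eta>) - c / log 2 (real N)"
      using lN by (simp add: field_simps)
    finally show ?case using elim by linarith
  qed
qed

definition D :: real where "D = 1 / H"

lemma geom_quant_ratio_tendsto: "geom_quant_ratio \<nu> \<longlonglongrightarrow> D"
proof -
  have "(\<lambda>N. inverse (- log 2 (geom_quant_error \<nu> N) / log 2 (real N))) \<longlonglongrightarrow> inverse H"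
    using log_error_tendsto H_bounds(2) by (intro tendsto_inverse) auto
  thus ?thesis unfolding D_def geom_quant_ratio_def[abs_def] by (simp add: inverse_eq_divide)
qed

lemma geom_quant_dim_eq: "geom_quant_dim \<nu> = D"
  unfolding geom_quant_dim_def using geom_quant_ratio_tendsto by (rule limI)

end

subsection \<open>The spectrum near 1\<close>

text \<open>\<open>Lim\<close> in the one-sided derivatives means something only if the limit
  exists. Monotone bounded difference quotients supply it.\<close>

lemma tendsto_Inf_at_right:
  fixes f :: "real \<Rightarrow> real"
  assumes mono: "\<And>x y. c < x \<Longrightarrow> x \<le> y \<Longrightarrow> y < b \<Longrightarrow> f x \<le> f y" and "c < b"
    and lower: "\<And>x. c < x \<Longrightarrow> x < b \<Longrightarrow> l \<le> f x"
  shows "(f \<longlongrightarrow> Inf (f ` {c<..<b})) (at_right c)"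
proof (rule order_tendstoI)
  have bdd: "bdd_below (f ` {c<..<b})" using lower by (intro bdd_belowI[of _ l]) auto
  have ne: "f ` {c<..<b} \<noteq> {}" using assms(2) by simp
  have ev: "\<forall>\<^sub>F x in at_right c. x \<in> {c<..<b}" by (rule eventually_at_right_real[OF assms(2)])
  fix u
  show "\<forall>\<^sub>F x in at_right c. u < f x" if "u < Inf (f ` {c<..<b})"
    using ev
  proof eventually_elim
    case (elim x)
    show ?case using cInf_lower[OF imageI[OF elim, of f] bdd] that by simp
  qed
  show "\<forall>\<^sub>F x in at_right c. f x < u" if less: "Inf (f ` {c<..<b}) < u"
  proof -
    obtain x0 where x0: "c < x0" "x0 < b" "f x0 < u"
      using cInf_lessD[OF ne less] by auto
    show ?thesis
      using eventually_at_right_real[OF x0(1)]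
    proof eventually_elim
      case (elim x)
      show ?case using mono[of x x0] x0 elim by simp
    qed
  qed
qed

lemma tendsto_Sup_at_left:
  fixes f :: "real \<Rightarrow> real"
  assumes mono: "\<And>x y. b < x \<Longrightarrow> x \<le> y \<Longrightarrow> y < c \<Longrightarrow> f x \<le> f y" and "b < c"
    and upper: "\<And>x. b < x \<Longrightarrow> x < c \<Longrightarrow> f x \<le> l"
  shows "(f \<longlongrightarrow> Sup (f ` {b<..<c})) (at_left c)"
proof (rule order_tendstoI)
  have bdd: "bdd_above (f ` {b<..<c})" using upper by (intro bdd_aboveI[of _ l]) auto
  have ne: "f ` {b<..<c} \<noteq> {}" using assms(2) by simp
  have ev: "\<forall>\<^sub>F x in at_left c. x \<in> {b<..<c}" by (rule eventually_at_left_real[OF assms(2)])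
  fix u
  show "\<forall>\<^sub>F x in at_left c. f x < u" if "Sup (f ` {b<..<c}) < u"
    using ev
  proof eventually_elim
    case (elim x)
    show ?case using cSup_upper[OF imageI[OF elim, of f] bdd] that by simp
  qed
  show "\<forall>\<^sub>F x in at_left c. u < f x" if less: "u < Sup (f ` {b<..<c})"
  proof -
    obtain x0 where x0: "b < x0" "x0 < c" "u < f x0"
      using less_cSupD[OF ne less] by auto
    show ?thesis
      using eventually_at_left_real[OF x0(2)]
    proof eventually_elim
      case (elim x)
      show ?case using mono[of x0 x] x0 elim by simp
    qed
  qed
qed

section \<open>The spectrum as a moment of the cube mass\<close>

context info_rate_limit
begin

definition charged :: "nat \<Rightarrow> (real ^ 'n) set set" where
  "charged k = {Q \<in> dyadic_cubes k. measure \<nu> Q > 0}"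

lemma charged: "finite (charged k)" "charged k \<subseteq> dyadic_cubes k" "Q \<in> charged k \<Longrightarrow> measure \<nu> Q > 0"
  unfolding charged_def by (rule finite_subset[OF _ finite_dyadic_cubes[of k]]) auto

lemma sum_charged: "(\<Sum>Q\<in>charged k. f Q * measure \<nu> Q) = (LINT x|\<nu>. f (dyadic_cube_at k x))"
  unfolding integral_cube_fun(2) charged_def
  by (rule sum.mono_neutral_left[OF finite_dyadic_cubes]) (auto simp: zero_less_measure_iff)

lemma sum_charged_1: "(\<Sum>Q\<in>charged k. measure \<nu> Q) = 1"
  using sum_charged[of "\<lambda>_. 1" k] by (simp add: prob_space)

lemma charged_nonempty: "charged k \<noteq> {}"
  using sum_charged_1[of k] by (metis sum.empty zero_neq_one)

lemma partition_pos: "(\<Sum>Q\<in>charged k. measure \<nu> Q powr q) > 0"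
  using charged_nonempty charged by (intro sum_pos) (auto simp: zero_less_measure_iff dest!: charged(3))

lemma spectrum_eq: "spectrum \<nu> k q = (1 / real k) * log 2 (\<Sum>Q\<in>charged k. measure \<nu> Q powr q)"
  unfolding spectrum_def charged_def ..

lemma partition_integral: "(\<Sum>Q\<in>charged k. measure \<nu> Q powr (1 + u)) = (LINT x|\<nu>. mass k x powr u)"
  unfolding sum_charged[of "\<lambda>Q. measure \<nu> Q powr u", symmetric]
  by (intro sum.cong) (auto simp: powr_add dest!: charged(3))

lemma integral_mass_pos: "(LINT x|\<nu>. mass k x powr u) > 0"
  unfolding partition_integral[symmetric] by (rule partition_pos)

lemma spectrum_integral: "spectrum \<nu> k (1 + u) = (1 / real k) * log 2 (LINT x|\<nu>. mass k x powr u)"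
  unfolding spectrum_eq partition_integral ..

lemma integrable_mass_powr: "integrable \<nu> (\<lambda>x. mass k x powr u)"
  by (rule integral_cube_fun(1))

text \<open>Jensen: by monotonicity of power means, \<open>u \<mapsto> \<beta>\<^sub>k(1 + u) / u\<close> is nondecreasing on either side of 0.\<close>

lemma spectrum_power_mean:
  assumes "r \<ge> 1"
  shows "r * spectrum \<nu> k (1 + w) \<le> spectrum \<nu> k (1 + r * w)"
proof -
  let ?S = "\<lambda>u. \<Sum>Q\<in>charged k. measure \<nu> Q powr (1 + u)"
  have split: "?S u = (\<Sum>Q\<in>charged k. measure \<nu> Q * measure \<nu> Q powr u)" for u
    by (intro sum.cong) (auto simp: powr_add dest!: charged(3))
  have "(\<lambda>x. x powr r) (\<Sum>Q\<in>charged k. measure \<nu> Q *\<^sub>R (measure \<nu> Q powr w)) \<le>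
      (\<Sum>Q\<in>charged k. measure \<nu> Q * (measure \<nu> Q powr w) powr r)"
    using charged charged_nonempty sum_charged_1
    by (intro convex_on_sum[where C="{0<..}"] powr_convex[OF assms]) (auto simp: less_imp_le dest!: charged(3))
  hence "?S w powr r \<le> ?S (r * w)" unfolding split by (simp add: powr_powr mult.commute)
  hence "log 2 (?S w powr r) \<le> log 2 (?S (r * w))" using partition_pos[of "1 + w" k] partition_pos[of "1 + r * w" k] by simp
  hence "r * log 2 (?S w) \<le> log 2 (?S (r * w))" using partition_pos[of "1 + w" k] by (simp add: log_powr)
  hence "(1 / real k) * (r * log 2 (?S w)) \<le> (1 / real k) * log 2 (?S (r * w))" by (intro mult_left_mono) auto
  thus ?thesis unfolding spectrum_eq by simp
qed

text \<open>The moment is restricted to \<open>S\<close>; a set of mass at least \<open>c\<close>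
  costs only \<open>log 2 c / k\<close>. The condition is a product with \<open>u\<close>, so one
  statement serves both sides of 1: \<open>S\<close> consists of rates at most \<open>l\<close> for
  \<open>u > 0\<close> and of rates above \<open>l\<close> for \<open>u < 0\<close>.\<close>

lemma spectrum_ge:
  assumes "c > 0" "k > 0" "S \<in> sets \<nu>" "c \<le> measure \<nu> S"
    and "\<And>x. x \<in> good \<Longrightarrow> x \<in> S \<Longrightarrow> l * u \<ge> X k x * u"
  shows "spectrum \<nu> k (1 + u) \<ge> - l * u + log 2 c / real k"
proof -
  let ?w = "2 powr (- real k * l * u)"
  have "?w * c \<le> ?w * measure \<nu> S" using assms(4) by (intro mult_left_mono) auto
  also have "\<dots> = (LINT x|\<nu>. ?w * indicator S x)" using assms(3) by (simp add: space_eq)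
  also have "\<dots> \<le> (LINT x|\<nu>. mass k x powr u)"
  proof (rule integral_mono_AE[OF _ integrable_mass_powr])
    show "integrable \<nu> (\<lambda>x. ?w * indicator S x)"
      using assms(3) by (intro integrable_mult_right) (auto simp: emeasure_eq_measure)
    show "AE x in \<nu>. ?w * indicator S x \<le> mass k x powr u"
      using AE_good
    proof eventually_elim
      fix x assume x: "x \<in> good"
      have "?w \<le> 2 powr (- real k * X k x * u)" if "x \<in> S"
        using mult_left_mono[OF assms(5)[OF x that], of "real k"] by (intro powr_mono) (auto simp: mult.assoc)
      thus "?w * indicator S x \<le> mass k x powr u"
        using mass_eq_powr[OF x assms(2)] by (auto simp: indicator_def powr_powr)
    qed
  qed
  finally have "log 2 (?w * c) \<le> log 2 (LINT x|\<nu>. mass k x powr u)"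
    using assms(1) integral_mass_pos[of k u] by simp
  hence "- real k * l * u + log 2 c \<le> log 2 (LINT x|\<nu>. mass k x powr u)"
    using assms(1) by (subst (asm) log_mult) auto
  hence "(1 / real k) * (- real k * l * u + log 2 c) \<le> spectrum \<nu> k (1 + u)"
    unfolding spectrum_integral by (intro mult_left_mono) auto
  moreover have "(1 / real k) * (- real k * l * u + log 2 c) = - l * u + log 2 c / real k"
    using assms(2) by (simp add: field_simps)
  ultimately show ?thesis by simp
qed

lemma spectrum_ge_right:
  assumes "u > 0" "l > m"
  shows "\<exists>c>0. \<forall>\<^sub>F k in sequentially. spectrum \<nu> k (1 + u) \<ge> - l * u + log 2 c / real k"
proof -
  obtain y where y: "m < y" "y < l" using assms(2) dense by blast
  define c where "c = measure \<rho> {..<y}"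
  have c: "c > 0" unfolding c_def by (rule mass_left_of[OF y(1)])
  \<comment> \<open>The bound \<open>l - y\<close> leaves room for the Levy shift, and
    \<open>c / 2\<close> lets half of the mass \<open>c\<close> survive.\<close>
  define \<epsilon> where "\<epsilon> = min (l - y) (c / 2)"
  have \<epsilon>: "\<epsilon> > 0" using y c by (simp add: \<epsilon>_def)
  have "\<forall>\<^sub>F k in sequentially. spectrum \<nu> k (1 + u) \<ge> - l * u + log 2 (c / 2) / real k"
    using levy[OF \<epsilon>] eventually_gt_at_top[of 0]
  proof eventually_elim
    case (elim k)
    have "c \<le> cdf \<rho> (l - \<epsilon>)" unfolding c_def cdf_def by (intro R.finite_measure_mono) (auto simp: \<epsilon>_def)
    moreover have "cdf \<rho> (l - \<epsilon>) - \<epsilon> \<le> measure \<nu> {x. X k x \<le> l}" using elim by blast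
    ultimately have "c / 2 \<le> measure \<nu> {x. X k x \<le> l}" unfolding \<epsilon>_def by linarith
    thus ?case using c elim X_sets assms(1) by (intro spectrum_ge) auto
  qed
  thus ?thesis using c by (intro exI[of _ "c / 2"]) auto
qed

lemma spectrum_ge_left:
  assumes "u < 0" "l < M"
  shows "\<exists>c>0. \<forall>\<^sub>F k in sequentially. spectrum \<nu> k (1 + u) \<ge> - l * u + log 2 c / real k"
proof -
  obtain y where y: "l < y" "y < M" using assms(2) dense by blast
  define c where "c = measure \<rho> {y<..}"
  have c: "c > 0" unfolding c_def by (rule mass_right_of[OF y(2)])
  define \<epsilon> where "\<epsilon> = min (y - l) (c / 2)"
  have \<epsilon>: "\<epsilon> > 0" using y c by (simp add: \<epsilon>_def)
  have "\<forall>\<^sub>F k in sequentially. spectrum \<nu> k (1 + u) \<ge> - l * u + log 2 (c / 2) / real k"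
    using levy[OF \<epsilon>] eventually_gt_at_top[of 0]
  proof eventually_elim
    case (elim k)
    have "c + cdf \<rho> (l + \<epsilon>) = measure \<rho> ({y<..} \<union> {..l + \<epsilon>})"
      unfolding c_def cdf_def by (rule R.finite_measure_Union[symmetric]) (auto simp: \<epsilon>_def)
    also have "\<dots> \<le> 1" by (rule R.prob_le_1)
    finally have "c + cdf \<rho> (l + \<epsilon>) \<le> 1" .
    moreover have "measure \<nu> {x. X k x \<le> l} \<le> cdf \<rho> (l + \<epsilon>) + \<epsilon>" using elim by blast
    moreover have "measure \<nu> (space \<nu> - {x. X k x \<le> l}) = 1 - measure \<nu> {x. X k x \<le> l}" by (rule prob_compl[OF X_sets])
    ultimately have "c / 2 \<le> measure \<nu> (space \<nu> - {x. X k x \<le> l})" unfolding \<epsilon>_def by linarith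
    thus ?case using c elim X_sets assms(1) by (intro spectrum_ge) (auto simp: mult_right_mono_neg)
  qed
  thus ?thesis using c by (intro exI[of _ "c / 2"]) auto
qed

text \<open>The uniform mass bound, read as a bound for moments; it is the source of the positivity
  of \<open>sigma_minus\<close>.\<close>

lemma spectrum_le_right:
  assumes "u > 0" "k > 0"
  shows "spectrum \<nu> k (1 + u) \<le> - a * u + u * log 2 C / real k"
proof -
  have "(LINT x|\<nu>. mass k x powr u) \<le> (LINT x|\<nu>. (C * 2 powr (- a * real k)) powr u)"
  proof (rule integral_mono_AE[OF integrable_mass_powr])
    show "AE x in \<nu>. mass k x powr u \<le> (C * 2 powr (- a * real k)) powr u"
      using AE_unit_cube by eventually_elim (use assms mass_le_bound in \<open>auto intro!: powr_mono2\<close>)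
  qed simp
  hence "(LINT x|\<nu>. mass k x powr u) \<le> (C * 2 powr (- a * real k)) powr u" by (simp add: prob_space)
  hence "log 2 (LINT x|\<nu>. mass k x powr u) \<le> log 2 ((C * 2 powr (- a * real k)) powr u)"
    using integral_mass_pos[of k u] C_ge by simp
  also have "\<dots> = u * (log 2 C - a * real k)" using C_ge by (simp add: log_powr log_mult)
  finally have "spectrum \<nu> k (1 + u) \<le> (1 / real k) * (u * (log 2 C - a * real k))"
    unfolding spectrum_integral by (intro mult_left_mono) auto
  also have "\<dots> = - a * u + u * log 2 C / real k" using assms by (simp add: field_simps)
  finally show ?thesis .
qed

text \<open>Left of 1 this keeps the upper limit finite, so that \<open>real_of_ereal\<close> does
  not return a default value.\<close>

lemma spectrum_le_dim:
  assumes "q \<ge> 0" "k > 0"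
  shows "spectrum \<nu> k q \<le> real CARD('n)"
proof -
  have "(\<Sum>Q\<in>charged k. measure \<nu> Q powr q) \<le> (\<Sum>Q\<in>charged k. 1)"
    using assms by (intro sum_mono) (auto intro: powr_le1 dest!: charged(3))
  also have "\<dots> \<le> real (card (dyadic_cubes k :: (real ^ 'n) set set))"
    using card_mono[OF finite_dyadic_cubes charged(2)] by simp
  also have "\<dots> \<le> 2 ^ (CARD('n) * k)"
    using of_nat_mono[OF card_dyadic_cubes[of k, where 'n='n], where 'a=real] by simp
  finally have "log 2 (\<Sum>Q\<in>charged k. measure \<nu> Q powr q) \<le> log 2 (2 ^ (CARD('n) * k))"
    using partition_pos[of q k] by (subst log_le_cancel_iff) auto
  also have "\<dots> = real CARD('n) * real k" by (simp add: log_nat_power)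
  finally have "spectrum \<nu> k q \<le> (1 / real k) * (real CARD('n) * real k)"
    unfolding spectrum_eq by (intro mult_left_mono) auto
  thus ?thesis using assms by simp
qed

section \<open>Upper limits and one-sided derivatives at 1\<close>

lemma upper_spectrum_1: "upper_spectrum \<nu> 1 = 0"
proof -
  have "(\<Sum>Q\<in>charged k. measure \<nu> Q powr 1) = 1" for k using sum_charged_1[of k] by simp
  hence "spectrum \<nu> k 1 = 0" for k by (simp add: spectrum_eq)
  thus ?thesis unfolding upper_spectrum_def by (simp add: Limsup_const)
qed

abbreviation limsup_spectrum :: "real \<Rightarrow> ereal" where
  "limsup_spectrum q \<equiv> limsup (\<lambda>k. ereal (spectrum \<nu> k q))"

lemma limsup_spectrum_ge:
  assumes "\<exists>c>0. \<forall>\<^sub>F k in sequentially. spectrum \<nu> k q \<ge> b + log 2 c / real k"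
  shows "ereal b \<le> limsup_spectrum q"
proof -
  obtain c where c: "\<forall>\<^sub>F k in sequentially. spectrum \<nu> k q \<ge> b + log 2 c / real k" using assms by blast
  have "(\<lambda>k. b + log 2 c / real k) \<longlonglongrightarrow> b + 0" by (intro tendsto_add tendsto_const) real_asymp
  hence "(\<lambda>k. ereal (b + log 2 c / real k)) \<longlonglongrightarrow> ereal b" by simp
  hence "ereal b = limsup (\<lambda>k. ereal (b + log 2 c / real k))" by (intro lim_imp_Limsup[symmetric]) auto
  also have "\<dots> \<le> limsup_spectrum q"
    using c by (intro Limsup_mono) (auto elim: eventually_mono)
  finally show ?thesis .
qed

text \<open>Finiteness comes first, as only then does the real number stand for the upper limit. The
  slope \<open>- l\<close> is available for every \<open>l > m\<close>, and
  \<open>l = m + e / u\<close> approaches \<open>m\<close>.\<close>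

lemma upper_spectrum_right:
  assumes "u > 0"
  shows "ereal (upper_spectrum \<nu> (1 + u)) = limsup_spectrum (1 + u)"
    and "- m * u \<le> upper_spectrum \<nu> (1 + u)" "upper_spectrum \<nu> (1 + u) \<le> - a * u"
proof -
  have lo: "ereal (- l * u) \<le> limsup_spectrum (1 + u)" if "l > m" for l
    by (rule limsup_spectrum_ge[OF spectrum_ge_right[OF assms that]])
  have "(\<lambda>k. - a * u + u * log 2 C / real k) \<longlonglongrightarrow> - a * u + 0" by (intro tendsto_add tendsto_const) real_asymp
  hence "(\<lambda>k. ereal (- a * u + u * log 2 C / real k)) \<longlonglongrightarrow> ereal (- a * u)" by simp
  hence "limsup (\<lambda>k. ereal (- a * u + u * log 2 C / real k)) = ereal (- a * u)" by (intro lim_imp_Limsup) auto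
  moreover have "limsup_spectrum (1 + u) \<le> limsup (\<lambda>k. ereal (- a * u + u * log 2 C / real k))"
    using spectrum_le_right[OF assms] by (intro Limsup_mono eventually_mono[OF eventually_gt_at_top[of 0]]) auto
  ultimately have hi: "limsup_spectrum (1 + u) \<le> ereal (- a * u)" by simp
  show eq: "ereal (upper_spectrum \<nu> (1 + u)) = limsup_spectrum (1 + u)"
    unfolding upper_spectrum_def using lo[of "m + 1"] hi by (intro ereal_real') auto
  show "upper_spectrum \<nu> (1 + u) \<le> - a * u" using hi unfolding eq[symmetric] by simp
  show "- m * u \<le> upper_spectrum \<nu> (1 + u)"
  proof (rule field_le_epsilon)
    fix e :: real assume e: "e > 0"
    have "ereal (- (m + e / u) * u) \<le> limsup_spectrum (1 + u)" using e assms by (intro lo) auto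
    hence "- (m + e / u) * u \<le> upper_spectrum \<nu> (1 + u)" unfolding eq[symmetric] by simp
    moreover have "- (m + e / u) * u = - m * u - e" using assms by (simp add: field_simps)
    ultimately show "- m * u \<le> upper_spectrum \<nu> (1 + u) + e" by linarith
  qed
qed

lemma upper_spectrum_left:
  assumes "u < 0" "u > - 1"
  shows "ereal (upper_spectrum \<nu> (1 + u)) = limsup_spectrum (1 + u)"
    and "- M * u \<le> upper_spectrum \<nu> (1 + u)"
proof -
  have lo: "ereal (- l * u) \<le> limsup_spectrum (1 + u)" if "l < M" for l
    by (rule limsup_spectrum_ge[OF spectrum_ge_left[OF assms(1) that]])
  have hi: "limsup_spectrum (1 + u) \<le> ereal (real CARD('n))"
    using spectrum_le_dim[of "1 + u"] assms by (intro Limsup_bounded eventually_mono[OF eventually_gt_at_top[of 0]]) auto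
  show eq: "ereal (upper_spectrum \<nu> (1 + u)) = limsup_spectrum (1 + u)"
    unfolding upper_spectrum_def using lo[of "M - 1"] hi by (intro ereal_real') auto
  show "- M * u \<le> upper_spectrum \<nu> (1 + u)"
  proof (rule field_le_epsilon)
    fix e :: real assume e: "e > 0"
    have "ereal (- (M + e / u) * u) \<le> limsup_spectrum (1 + u)" using e assms by (intro lo) (auto simp: divide_pos_neg)
    hence "- (M + e / u) * u \<le> upper_spectrum \<nu> (1 + u)" unfolding eq[symmetric] by simp
    moreover have "- (M + e / u) * u = - M * u - e" using assms by (simp add: field_simps)
    ultimately show "- M * u \<le> upper_spectrum \<nu> (1 + u) + e" by linarith
  qed
qed

lemma limsup_spectrum_power_mean:
  assumes "r \<ge> 1"
  shows "ereal r * limsup_spectrum (1 + w) \<le> limsup_spectrum (1 + r * w)"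
proof -
  have "ereal r * limsup_spectrum (1 + w) = limsup (\<lambda>k. ereal r * ereal (spectrum \<nu> k (1 + w)))"
    using assms by (intro limsup_ereal_mult_left[symmetric]) auto
  also have "\<dots> \<le> limsup_spectrum (1 + r * w)"
    using spectrum_power_mean[OF assms] by (intro Limsup_mono always_eventually) auto
  finally show ?thesis .
qed

text \<open>Monotone quotients from the point 1 are all the convexity that one-sided derivatives
  require. They are the power mean inequality with exponent \<open>v / u\<close>.\<close>

lemma right_quotient_mono:
  assumes "0 < u" "u \<le> v"
  shows "upper_spectrum \<nu> (1 + u) / u \<le> upper_spectrum \<nu> (1 + v) / v"
proof -
  have "ereal (v / u) * ereal (upper_spectrum \<nu> (1 + u)) \<le> ereal (upper_spectrum \<nu> (1 + v))"
    using limsup_spectrum_power_mean[of "v / u" u] assms upper_spectrum_right(1)[of u] upper_spectrum_right(1)[of v]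
    by simp
  hence "v / u * upper_spectrum \<nu> (1 + u) \<le> upper_spectrum \<nu> (1 + v)" by simp
  thus ?thesis using assms by (simp add: field_simps)
qed

text \<open>For negative arguments the ratio that is at least 1 is \<open>u / v\<close>, so the
  roles are exchanged; dividing by a negative number restores the direction.\<close>

lemma left_quotient_mono:
  assumes "- 1 < u" "u \<le> v" "v < 0"
  shows "upper_spectrum \<nu> (1 + u) / u \<le> upper_spectrum \<nu> (1 + v) / v"
proof -
  have r: "u / v \<ge> 1" using assms by (simp add: field_simps)
  have "ereal (u / v) * ereal (upper_spectrum \<nu> (1 + v)) \<le> ereal (upper_spectrum \<nu> (1 + u))"
    using limsup_spectrum_power_mean[OF r, of v] assms upper_spectrum_left(1)[of u] upper_spectrum_left(1)[of v]
    by simp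
  hence "u / v * upper_spectrum \<nu> (1 + v) \<le> upper_spectrum \<nu> (1 + u)" by simp
  thus ?thesis using assms by (simp add: field_simps)
qed

lemma sigma_minus_bounds: "a \<le> sigma_minus \<nu>" "sigma_minus \<nu> \<le> m"
proof -
  let ?f = "\<lambda>y. (upper_spectrum \<nu> y - upper_spectrum \<nu> 1) / (y - 1)"
  have f: "?f y = upper_spectrum \<nu> (1 + (y - 1)) / (y - 1)" for y by (simp add: upper_spectrum_1)
  have bounds: "- m \<le> ?f y \<and> ?f y \<le> - a" if "1 < y" for y
    unfolding f using upper_spectrum_right(2,3)[of "y - 1"] that by (auto simp: field_simps)
  have "(?f \<longlongrightarrow> Inf (?f ` {1<..<2})) (at_right 1)"
  proof (rule tendsto_Inf_at_right[where l="- m"])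
    show "?f x \<le> ?f y" if "1 < x" "x \<le> y" "y < 2" for x y unfolding f using that by (intro right_quotient_mono) auto
  qed (use bounds in auto)
  moreover from this have "right_deriv (upper_spectrum \<nu>) 1 = Inf (?f ` {1<..<2})"
    unfolding right_deriv_def by (intro tendsto_Lim) auto
  ultimately have lim: "(?f \<longlongrightarrow> right_deriv (upper_spectrum \<nu>) 1) (at_right 1)" by simp
  have ev: "\<forall>\<^sub>F y in at_right (1 :: real). 1 < y" by (rule eventually_at_right_less)
  have "- m \<le> right_deriv (upper_spectrum \<nu>) 1"
    by (rule tendsto_lowerbound[OF lim]) (use ev bounds in \<open>auto elim!: eventually_mono\<close>)
  thus "sigma_minus \<nu> \<le> m" unfolding sigma_minus_def by simp
  have "right_deriv (upper_spectrum \<nu>) 1 \<le> - a"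
    by (rule tendsto_upperbound[OF lim]) (use ev bounds in \<open>auto elim!: eventually_mono\<close>)
  thus "a \<le> sigma_minus \<nu>" unfolding sigma_minus_def by simp
qed

lemma sigma_plus_ge: "M \<le> sigma_plus \<nu>"
proof -
  let ?f = "\<lambda>y. (upper_spectrum \<nu> y - upper_spectrum \<nu> 1) / (y - 1)"
  have f: "?f y = upper_spectrum \<nu> (1 + (y - 1)) / (y - 1)" for y by (simp add: upper_spectrum_1)
  have bounds: "?f y \<le> - M" if "0 < y" "y < 1" for y
    unfolding f using upper_spectrum_left(2)[of "y - 1"] that by (auto simp: field_simps)
  have "(?f \<longlongrightarrow> Sup (?f ` {0<..<1})) (at_left 1)"
  proof (rule tendsto_Sup_at_left[where l="- M"])
    show "?f x \<le> ?f y" if "0 < x" "x \<le> y" "y < 1" for x y unfolding f using that by (intro left_quotient_mono) auto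
  qed (use bounds in auto)
  moreover from this have "left_deriv (upper_spectrum \<nu>) 1 = Sup (?f ` {0<..<1})"
    unfolding left_deriv_def by (intro tendsto_Lim) auto
  ultimately have lim: "(?f \<longlongrightarrow> left_deriv (upper_spectrum \<nu>) 1) (at_left 1)" by simp
  have "\<forall>\<^sub>F y in at_left (1 :: real). y \<in> {0<..<1}" by (rule eventually_at_left_real) simp
  hence "left_deriv (upper_spectrum \<nu>) 1 \<le> - M"
    by (intro tendsto_upperbound[OF lim]) (use bounds in \<open>auto elim!: eventually_mono\<close>)
  thus ?thesis unfolding sigma_plus_def by simp
qed

text \<open>Up to the factor 1 / (k ln 2), the spectrum is a log-partition function. Its second
  derivative at \<open>q\<close> is the variance of \<open>ln (mass k x)\<close> under the law
  tilted by \<open>q\<close>, and at 1 there is no tilt. Since \<open>ln (mass k x)\<close> equals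
  \<open>- k * ln 2 * X k x\<close>, a factor \<open>k * ln 2\<close> remains.\<close>

lemma spectrum_second_deriv:
  assumes "k > 0"
  shows "deriv (deriv (spectrum \<nu> k)) 1 / (real k * ln 2) = (LINT x|\<nu>. (X k x)\<^sup>2) - (LINT x|\<nu>. X k x)\<^sup>2"
proof -
  let ?S = "\<lambda>q. \<Sum>Q\<in>charged k. measure \<nu> Q powr q"
  let ?S1 = "\<lambda>q. \<Sum>Q\<in>charged k. ln (measure \<nu> Q) * measure \<nu> Q powr q"
  let ?S2 = "\<lambda>q. \<Sum>Q\<in>charged k. (ln (measure \<nu> Q))\<^sup>2 * measure \<nu> Q powr q"
  let ?c = "1 / (real k * ln 2)"
  have p: "((\<lambda>q. measure \<nu> Q powr q) has_field_derivative ln (measure \<nu> Q) * measure \<nu> Q powr q) (at q)"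
    if "Q \<in> charged k" for Q q
    using charged(3)[OF that] by (auto intro!: derivative_eq_intros)
  have S: "(?S has_field_derivative ?S1 q) (at q)" for q
    by (intro DERIV_sum p)
  have S1: "(?S1 has_field_derivative ?S2 q) (at q)" for q
  proof (rule DERIV_sum)
    fix Q assume "Q \<in> charged k"
    from DERIV_cmult[OF p[OF this], of "ln (measure \<nu> Q)" q]
    show "((\<lambda>q. ln (measure \<nu> Q) * measure \<nu> Q powr q) has_field_derivative (ln (measure \<nu> Q))\<^sup>2 * measure \<nu> Q powr q) (at q)"
      by (simp add: power2_eq_square mult.assoc)
  qed
  have eq: "spectrum \<nu> k = (\<lambda>q. ?c * ln (?S q))" unfolding spectrum_eq[abs_def] log_def by simp
  have d1: "deriv (spectrum \<nu> k) q = ?c * (?S1 q / ?S q)" for q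
  proof (rule DERIV_imp_deriv)
    have "((\<lambda>q. ln (?S q)) has_field_derivative inverse (?S q) * ?S1 q) (at q)"
      by (rule DERIV_chain2[OF DERIV_ln[OF partition_pos] S])
    from DERIV_cmult[OF this, of ?c] show "(spectrum \<nu> k has_field_derivative ?c * (?S1 q / ?S q)) (at q)"
      unfolding eq by (simp add: divide_inverse mult.commute)
  qed
  \<comment> \<open>Normalization at \<open>q = 1\<close> removes the denominators left by the
    quotient rule.\<close>
  have one: "?S 1 = 1" using sum_charged_1[of k] by (simp cong: sum.cong)
  have d2: "deriv (deriv (spectrum \<nu> k)) 1 = ?c * (?S2 1 - (?S1 1)\<^sup>2)"
  proof (rule DERIV_imp_deriv)
    have "?S 1 \<noteq> 0" unfolding one by simp
    from DERIV_cmult[OF DERIV_divide[OF S1 S this], of ?c]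
    show "(deriv (spectrum \<nu> k) has_field_derivative ?c * (?S2 1 - (?S1 1)\<^sup>2)) (at 1)"
      unfolding d1[abs_def] one by (simp add: power2_eq_square)
  qed
  have X: "ln (mass k x) = - real k * ln 2 * X k x" for x
    unfolding info_rate_def log_def using assms by simp
  have "?S1 1 = (\<Sum>Q\<in>charged k. ln (measure \<nu> Q) * measure \<nu> Q)" by simp
  also have "\<dots> = (LINT x|\<nu>. ln (mass k x))" by (rule sum_charged)
  also have "\<dots> = - (real k * ln 2) * (LINT x|\<nu>. X k x)" unfolding X by simp
  finally have s1: "?S1 1 = - (real k * ln 2) * (LINT x|\<nu>. X k x)" .
  have "?S2 1 = (\<Sum>Q\<in>charged k. (ln (measure \<nu> Q))\<^sup>2 * measure \<nu> Q)" by simp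
  also have "\<dots> = (LINT x|\<nu>. (ln (mass k x))\<^sup>2)" by (rule sum_charged)
  also have "\<dots> = (real k * ln 2)\<^sup>2 * (LINT x|\<nu>. (X k x)\<^sup>2)" unfolding X by (simp add: power_mult_distrib)
  finally have s2: "?S2 1 = (real k * ln 2)\<^sup>2 * (LINT x|\<nu>. (X k x)\<^sup>2)" .
  have "1 / L * (L\<^sup>2 * p - (- L * q)\<^sup>2) / L = p - q\<^sup>2" if "L \<noteq> 0" for L p q :: real
    using that by (simp add: field_simps power2_eq_square)
  from this[of "real k * ln 2"] show ?thesis unfolding d2 s1 s2 using assms by simp
qed

definition V :: real where "V = R.variance (\<lambda>y. y)"

lemma integrable_powers: "integrable \<rho> (\<lambda>y. y)" "integrable \<rho> (\<lambda>y. y\<^sup>2)"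
proof -
  show "integrable \<rho> (\<lambda>y. y)" using m_bounds by (intro integrable_support[where B="M"]) auto
  show "integrable \<rho> (\<lambda>y. y\<^sup>2)"
  proof (rule integrable_support[where B="M\<^sup>2"])
    fix y assume "m \<le> y" "y \<le> M"
    hence "y\<^sup>2 \<le> M\<^sup>2" using m_bounds by (intro power_mono) auto
    thus "\<bar>y\<^sup>2\<bar> \<le> M\<^sup>2" by simp
  qed simp
qed

lemma V_eq: "V = (LINT y|\<rho>. y\<^sup>2) - h\<^sup>2"
  unfolding V_def h_def by (rule R.variance_eq[OF integrable_powers])

lemma second_deriv_tendsto: "(\<lambda>k. deriv (deriv (spectrum \<nu> k)) 1 / (real k * ln 2)) \<longlonglongrightarrow> V"
proof -
  have 2: "(\<lambda>k. LINT x|\<nu>. (X k x)\<^sup>2) \<longlonglongrightarrow> (LINT y|\<rho>. y\<^sup>2)" by (rule moment_tendsto) simp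
  have 1: "(\<lambda>k. LINT x|\<nu>. X k x) \<longlonglongrightarrow> h" using entropy_rate_tendsto unfolding entropy_rate_eq[abs_def] .
  have "(\<lambda>k. (LINT x|\<nu>. (X k x)\<^sup>2) - (LINT x|\<nu>. X k x)\<^sup>2) \<longlonglongrightarrow> V"
    unfolding V_eq by (intro tendsto_diff 2 tendsto_power 1)
  thus ?thesis
    by (rule Lim_transform_eventually) (use spectrum_second_deriv in \<open>auto intro!: eventually_mono[OF eventually_gt_at_top[of 0]]\<close>)
qed

lemma second_deriv_smallo_iff: "(\<lambda>k. deriv (deriv (spectrum \<nu> k)) 1) \<in> o(\<lambda>k. real k) \<longleftrightarrow> V = 0"
proof
  let ?f = "\<lambda>k. deriv (deriv (spectrum \<nu> k)) 1"
  assume "?f \<in> o(\<lambda>k. real k)"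
  hence "(\<lambda>k. ?f k / real k) \<longlonglongrightarrow> 0" by (rule smalloD_tendsto)
  hence "(\<lambda>k. ?f k / real k / ln 2) \<longlonglongrightarrow> 0 / ln 2" by (intro tendsto_divide) auto
  hence "(\<lambda>k. ?f k / (real k * ln 2)) \<longlonglongrightarrow> 0" by simp
  thus "V = 0" using second_deriv_tendsto LIMSEQ_unique by blast
next
  let ?f = "\<lambda>k. deriv (deriv (spectrum \<nu> k)) 1"
  assume "V = 0"
  hence "(\<lambda>k. ?f k / (real k * ln 2) * ln 2) \<longlonglongrightarrow> 0 * ln 2" using second_deriv_tendsto by (intro tendsto_mult) auto
  hence "(\<lambda>k. ?f k / real k) \<longlonglongrightarrow> 0" by simp
  thus "?f \<in> o(\<lambda>k. real k)"
    by (rule smalloI_tendsto) (auto intro!: eventually_mono[OF eventually_gt_at_top[of 0]])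
qed

end

subsection \<open>Hausdorff and packing dimension in the maximum norm\<close>

text \<open>A real supremum is meaningful only when bounded; the mesh condition on admissible covers
  provides \<open>r\<close>.\<close>

lemma linf_diam_nonneg_bounds:
  fixes U :: "(real ^ 'n) set"
  assumes "\<And>x y. x \<in> U \<Longrightarrow> y \<in> U \<Longrightarrow> infnorm (x - y) \<le> r" "r \<ge> 0"
  shows "0 \<le> linf_diam U" "linf_diam U \<le> r" "x \<in> U \<Longrightarrow> y \<in> U \<Longrightarrow> infnorm (x - y) \<le> linf_diam U"
proof -
  let ?S = "(\<lambda>(x, y). infnorm (x - y)) ` (U \<times> U)"
  have bdd: "bdd_above ?S" using assms by (intro bdd_aboveI[of _ r]) auto
  show up: "infnorm (x - y) \<le> linf_diam U" if "x \<in> U" "y \<in> U" for x y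
  proof -
    have "infnorm (x - y) \<in> ?S" using that by force
    from cSup_upper[OF this bdd] show ?thesis using that by (auto simp: linf_diam_def)
  qed
  show "0 \<le> linf_diam U"
  proof (cases "U = {}")
    case False
    then obtain x where "x \<in> U" by blast
    from up[OF this this] show ?thesis using infnorm_pos_le order_trans by blast
  qed (simp add: linf_diam_def)
  show "linf_diam U \<le> r"
  proof (cases "U = {}")
    case False
    thus ?thesis unfolding linf_diam_def using assms(1) by (auto intro!: cSUP_least)
  qed (use assms in \<open>simp add: linf_diam_def\<close>)
qed

lemma hausdorff_measure_mono: "E \<subseteq> F \<Longrightarrow> hausdorff_measure s E \<le> hausdorff_measure s F"
  unfolding hausdorff_measure_def by (intro SUP_mono' INF_superset_mono) auto

definition fine_cover :: "real \<Rightarrow> (real ^ 'n) set \<Rightarrow> (nat \<Rightarrow> (real ^ 'n) set) \<Rightarrow> bool" where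
  "fine_cover \<delta> E U \<longleftrightarrow> E \<subseteq> (\<Union>i. U i) \<and> (\<forall>i. \<forall>x\<in>U i. \<forall>y\<in>U i. infnorm (x - y) \<le> \<delta>)"

text \<open>The dimension depends only on which measures vanish, so the nested supremum and infimum
  are reduced once to covers of small total.\<close>

lemma hausdorff_measure_eq_0_iff:
  "hausdorff_measure s E = 0 \<longleftrightarrow>
    (\<forall>\<delta>>0. \<forall>\<eta>>0. \<exists>U. fine_cover \<delta> E U \<and> (\<Sum>i. ennreal (linf_diam (U i) powr s)) \<le> ennreal \<eta>)"
proof -
  let ?I = "\<lambda>\<delta>. INF U\<in>Collect (fine_cover \<delta> E). \<Sum>i. ennreal (linf_diam (U i) powr s)"
  have "hausdorff_measure s E = (SUP \<delta>\<in>{0<..}. ?I \<delta>)"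
    unfolding hausdorff_measure_def fine_cover_def ..
  hence "hausdorff_measure s E = 0 \<longleftrightarrow> (\<forall>\<delta>>0. ?I \<delta> = 0)"
    by (simp only: SUP_bot_conv bot_ennreal[symmetric] greaterThan_iff Ball_def)
  also have "\<dots> \<longleftrightarrow> (\<forall>\<delta>>0. \<forall>\<eta>>0. \<exists>U. fine_cover \<delta> E U \<and> (\<Sum>i. ennreal (linf_diam (U i) powr s)) \<le> ennreal \<eta>)"
  proof (intro all_cong1 imp_cong refl)
    fix \<delta> :: real
    show "?I \<delta> = 0 \<longleftrightarrow> (\<forall>\<eta>>0. \<exists>U. fine_cover \<delta> E U \<and> (\<Sum>i. ennreal (linf_diam (U i) powr s)) \<le> ennreal \<eta>)"
    proof
      assume 0: "?I \<delta> = 0"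
      show "\<forall>\<eta>>0. \<exists>U. fine_cover \<delta> E U \<and> (\<Sum>i. ennreal (linf_diam (U i) powr s)) \<le> ennreal \<eta>"
      proof (intro allI impI)
        fix \<eta> :: real assume "\<eta> > 0"
        hence "?I \<delta> < ennreal \<eta>" unfolding 0 by simp
        then obtain U where "fine_cover \<delta> E U" "(\<Sum>i. ennreal (linf_diam (U i) powr s)) < ennreal \<eta>"
          unfolding INF_less_iff by auto
        thus "\<exists>U. fine_cover \<delta> E U \<and> (\<Sum>i. ennreal (linf_diam (U i) powr s)) \<le> ennreal \<eta>" using less_imp_le by blast
      qed
    next
      assume A: "\<forall>\<eta>>0. \<exists>U. fine_cover \<delta> E U \<and> (\<Sum>i. ennreal (linf_diam (U i) powr s)) \<le> ennreal \<eta>"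
      have "?I \<delta> \<le> 0 + ennreal e" if e: "e > 0" for e
      proof -
        obtain U where U: "fine_cover \<delta> E U" "(\<Sum>i. ennreal (linf_diam (U i) powr s)) \<le> ennreal e" using A e by blast
        have "?I \<delta> \<le> (\<Sum>i. ennreal (linf_diam (U i) powr s))" using U(1) by (intro INF_lower) simp
        thus ?thesis using U(2) by simp
      qed
      hence "?I \<delta> \<le> 0" by (rule ennreal_le_epsilon)
      thus "?I \<delta> = 0" by simp
    qed
  qed
  finally show ?thesis .
qed

text \<open>The \<open>j\<close>-th set gets a cover of total at most \<eta> / 2^(j+1), and the
  pairing of naturals merges all covers into one sequence.\<close>

lemma hausdorff_null_UN:
  fixes E :: "nat \<Rightarrow> (real ^ 'n) set"
  assumes "\<And>j. hausdorff_measure s (E j) = 0"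
  shows "hausdorff_measure s (\<Union>j. E j) = 0"
  unfolding hausdorff_measure_eq_0_iff
proof (intro allI impI)
  fix \<delta> \<eta> :: real assume \<delta>: "\<delta> > 0" and \<eta>: "\<eta> > 0"
  have "\<forall>j. \<exists>U. fine_cover \<delta> (E j) U \<and> (\<Sum>i. ennreal (linf_diam (U i) powr s)) \<le> ennreal (\<eta> * (1 / 2) ^ Suc j)"
    using assms[unfolded hausdorff_measure_eq_0_iff] \<delta> \<eta> by (metis mult_pos_pos zero_less_divide_1_iff zero_less_numeral zero_less_power)
  then obtain U where U: "\<And>j. fine_cover \<delta> (E j) (U j)"
    "\<And>j. (\<Sum>i. ennreal (linf_diam (U j i) powr s)) \<le> ennreal (\<eta> * (1 / 2) ^ Suc j)" by metis
  let ?W = "\<lambda>n. case prod_decode n of (j, i) \<Rightarrow> U j i"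
  have "fine_cover \<delta> (\<Union>j. E j) ?W"
    unfolding fine_cover_def
  proof (intro conjI)
    show "(\<Union>j. E j) \<subseteq> (\<Union>n. ?W n)"
    proof
      fix x assume "x \<in> (\<Union>j. E j)"
      then obtain j where "x \<in> E j" by blast
      moreover have "E j \<subseteq> (\<Union>i. U j i)" using U(1)[of j] unfolding fine_cover_def by simp
      ultimately obtain i where "x \<in> U j i" by blast
      hence "x \<in> ?W (prod_encode (j, i))" by simp
      thus "x \<in> (\<Union>n. ?W n)" by (rule UN_I[OF UNIV_I])
    qed
    show "\<forall>i. \<forall>x\<in>?W i. \<forall>y\<in>?W i. infnorm (x - y) \<le> \<delta>"
      using U(1) unfolding fine_cover_def by (auto split: prod.split)
  qed
  moreover have "(\<Sum>n. ennreal (linf_diam (?W n) powr s)) \<le> ennreal \<eta>"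
  proof -
    have "(\<Sum>n. ennreal (linf_diam (?W n) powr s)) = (\<Sum>n. (\<lambda>(j, i). ennreal (linf_diam (U j i) powr s)) (prod_decode n))"
      by (intro suminf_cong) (auto split: prod.split)
    also have "\<dots> = (\<Sum>j. \<Sum>i. ennreal (linf_diam (U j i) powr s))"
      by (rule suminf_ennreal_2dimen) simp
    also have "\<dots> \<le> (\<Sum>j. ennreal (\<eta> * (1 / 2) ^ Suc j))"
      using U(2) by (intro suminf_le) auto
    also have "\<dots> = ennreal \<eta>"
    proof (rule suminf_ennreal_eq)
      show "(\<lambda>j. \<eta> * (1 / 2) ^ Suc j) sums \<eta>" using sums_mult[OF power_half_series, of \<eta>] by simp
    qed (use \<eta> in auto)
    finally show ?thesis .
  qed
  ultimately show "\<exists>W. fine_cover \<delta> (\<Union>j. E j) W \<and> (\<Sum>i. ennreal (linf_diam (W i) powr s)) \<le> ennreal \<eta>" by blast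
qed

text \<open>For covers by finitely many sets of a common size. Padding the sequence with empty sets
  is free, as their diameter is 0 and \<open>0 powr s = 0\<close>.\<close>

lemma hausdorff_null_finite_covers:
  fixes E :: "(real ^ 'n) set"
  assumes "s > 0" and cov: "\<And>\<delta> \<eta>. \<delta> > 0 \<Longrightarrow> \<eta> > 0 \<Longrightarrow> \<exists>\<C> r. finite \<C> \<and> E \<subseteq> \<Union>\<C> \<and> 0 \<le> r \<and> r \<le> \<delta> \<and>
    (\<forall>U\<in>\<C>. \<forall>x\<in>U. \<forall>y\<in>U. infnorm (x - y) \<le> r) \<and> real (card \<C>) * r powr s \<le> \<eta>"
  shows "hausdorff_measure s E = 0"
  unfolding hausdorff_measure_eq_0_iff
proof (intro allI impI)
  fix \<delta> \<eta> :: real assume "\<delta> > 0" and "\<eta> > 0"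
  from cov[OF this] obtain \<C> r where C: "finite \<C>" "E \<subseteq> \<Union>\<C>" "0 \<le> r" "r \<le> \<delta>"
    and C5: "\<forall>U\<in>\<C>. \<forall>x\<in>U. \<forall>y\<in>U. infnorm (x - y) \<le> r" and C6: "real (card \<C>) * r powr s \<le> \<eta>"
    by (elim exE conjE)
  obtain f where f: "bij_betw f {0..<card \<C>} \<C>" using ex_bij_betw_nat_finite[OF C(1)] by blast
  define U where "U i = (if i < card \<C> then f i else {})" for i
  have fC: "f i \<in> \<C>" if "i < card \<C>" for i using f that by (auto simp: bij_betw_def)
  have "fine_cover \<delta> E U"
    unfolding fine_cover_def
  proof (intro conjI)
    have "\<C> = U ` {0..<card \<C>}" using f unfolding bij_betw_def U_def by simp
    hence "\<Union>\<C> \<subseteq> (\<Union>i. U i)" by (metis Union_mono subset_UNIV image_mono)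
    thus "E \<subseteq> (\<Union>i. U i)" using C(2) by (rule order_trans[rotated])
    have "infnorm (x - y) \<le> \<delta>" if "x \<in> U i" "y \<in> U i" for i x y
    proof -
      have "i < card \<C>" using that by (auto simp: U_def split: if_splits)
      hence "infnorm (x - y) \<le> r" using that C5[rule_format, OF fC, of i x y] by (simp add: U_def)
      thus ?thesis using C(4) by simp
    qed
    thus "\<forall>i. \<forall>x\<in>U i. \<forall>y\<in>U i. infnorm (x - y) \<le> \<delta>" by blast
  qed
  moreover have "(\<Sum>i. ennreal (linf_diam (U i) powr s)) \<le> ennreal \<eta>"
  proof -
    have "(\<Sum>i. ennreal (linf_diam (U i) powr s)) = (\<Sum>i<card \<C>. ennreal (linf_diam (U i) powr s))"
      using assms(1) by (intro suminf_finite) (auto simp: U_def linf_diam_def)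
    also have "\<dots> \<le> (\<Sum>i<card \<C>. ennreal (r powr s))"
    proof (intro sum_mono ennreal_leI powr_mono2)
      fix i assume "i \<in> {..<card \<C>}"
      hence "i < card \<C>" by simp
      hence *: "infnorm (x - y) \<le> r" if "x \<in> U i" "y \<in> U i" for x y
        using that fC C5 by (auto simp: U_def)
      show "0 \<le> linf_diam (U i)" "linf_diam (U i) \<le> r"
        using linf_diam_nonneg_bounds(1,2)[of "U i" r] * C(3) by blast+
    qed (use assms in simp)
    also have "\<dots> = ennreal (real (card \<C>) * r powr s)" by (simp add: ennreal_mult ennreal_of_nat_eq_real_of_nat)
    also have "\<dots> \<le> ennreal \<eta>" using C6 by (rule ennreal_leI)
    finally show ?thesis .
  qed
  ultimately show "\<exists>U. fine_cover \<delta> E U \<and> (\<Sum>i. ennreal (linf_diam (U i) powr s)) \<le> ennreal \<eta>" by blast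
qed

section \<open>Exponents above the dimension of the space\<close>

definition box_cube :: "nat \<Rightarrow> (real ^ 'n) set" where
  "box_cube N = {x. \<forall>i. \<bar>x $ i\<bar> \<le> real N}"

lemma UN_box_cube: "(\<Union>N. box_cube N) = (UNIV :: (real ^ 'n) set)"
proof (intro equalityI subsetI UNIV_I)
  fix x :: "real ^ 'n"
  obtain N where "infnorm x \<le> real N" using real_arch_simple by blast
  hence "x \<in> box_cube N" using infnorm_le_iff by (auto simp: box_cube_def)
  thus "x \<in> (\<Union>N. box_cube N)" by blast
qed

text \<open>Provides an admissible exponent, without which the real \<open>Inf\<close> would be
  arbitrary. A box needs O(K^d) cells of side 1/K, of total size O(1/K) for the exponent
  d+1.\<close>

lemma hausdorff_measure_above_dim:
  "hausdorff_measure (real CARD('n) + 1) (UNIV :: (real ^ 'n) set) = 0"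
  unfolding UN_box_cube[symmetric]
proof (rule hausdorff_null_UN, rule hausdorff_null_finite_covers)
  fix N and \<delta> \<eta> :: real assume "\<delta> > 0" "\<eta> > 0"
  \<comment> \<open>The number of cells is at most \<open>A * K ^ CARD('n)\<close>, because 2NK + 1
    \<le> (2N + 1) K.\<close>
  define A where "A = (2 * real N + 1) ^ CARD('n)"
  have A: "A \<ge> 0" by (simp add: A_def)
  obtain K :: nat where K: "max (1 / \<delta>) (A / \<eta>) < real K" "0 < K"
    using reals_Archimedean2[of "max (1 / \<delta>) (A / \<eta>)"]
    by (metis \<open>\<delta> > 0\<close> less_max_iff_disj max.strict_coboundedI1 neq0_conv not_less_iff_gr_or_eq of_nat_0 zero_less_divide_1_iff order_less_trans)
  define r where "r = 1 / real K"
  define cell where "cell j = {x :: real ^ 'n. \<forall>i. real (j i) \<le> (x $ i + real N) * real K \<and> (x $ i + real N) * real K \<le> real (j i) + 1}" for j :: "'n \<Rightarrow> nat"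
  \<comment> \<open>At the right end of the box the floor attains \<open>2 * N * K\<close>, hence
    the additional index.\<close>
  let ?J = "{j :: 'n \<Rightarrow> nat. \<forall>i. j i < 2 * N * K + 1}"
  let ?C = "cell ` ?J"
  have finJ: "finite ?J" "card ?J = (2 * N * K + 1) ^ CARD('n)" using finite_index_funs by blast+
  have "box_cube N \<subseteq> \<Union>?C"
  proof
    fix x :: "real ^ 'n" assume x: "x \<in> box_cube N"
    let ?j = "\<lambda>i. nat \<lfloor>(x $ i + real N) * real K\<rfloor>"
    have b: "0 \<le> (x $ i + real N) * real K" "(x $ i + real N) * real K \<le> real (2 * N * K)" for i
    proof -
      have "\<bar>x $ i\<bar> \<le> real N" using x by (simp add: box_cube_def)
      hence "0 \<le> x $ i + real N" "x $ i + real N \<le> 2 * real N" by auto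
      thus "0 \<le> (x $ i + real N) * real K" "(x $ i + real N) * real K \<le> real (2 * N * K)"
        using mult_right_mono[of "x $ i + real N" "2 * real N" "real K"] by auto
    qed
    have "x \<in> cell ?j" unfolding cell_def using b(1) by (auto simp: of_nat_floor)
    moreover have "?j \<in> ?J"
    proof -
      have "?j i < 2 * N * K + 1" for i using b[of i] by (simp add: nat_less_iff floor_less_iff less_Suc_eq_le nat_le_iff floor_le_iff)
      thus ?thesis by blast
    qed
    ultimately show "x \<in> \<Union>?C" by (intro UnionI[OF imageI])
  qed
  moreover have "\<forall>U\<in>?C. \<forall>x\<in>U. \<forall>y\<in>U. infnorm (x - y) \<le> r"
  proof (intro ballI)
    fix U x y assume "U \<in> ?C" "x \<in> U" "y \<in> U"
    then obtain j where j: "x \<in> cell j" "y \<in> cell j" by blast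
    show "infnorm (x - y) \<le> r" unfolding infnorm_le_iff
    proof
      fix i
      have "\<bar>(x $ i + real N) * real K - (y $ i + real N) * real K\<bar> \<le> 1"
        using j unfolding cell_def by (smt (verit) mem_Collect_eq)
      hence "\<bar>(x - y) $ i\<bar> * real K \<le> 1" by (simp add: left_diff_distrib[symmetric] abs_mult)
      thus "\<bar>(x - y) $ i\<bar> \<le> r" using K(2) by (simp add: r_def field_simps)
    qed
  qed
  moreover have "real (card ?C) * r powr (real CARD('n) + 1) \<le> \<eta>"
  proof -
    have "real (card ?C) \<le> real (card ?J)" using card_image_le[OF finJ(1)] by simp
    also have "\<dots> = (2 * real N * real K + 1) ^ CARD('n)" unfolding finJ(2) by (simp add: add.commute)
    also have "\<dots> \<le> ((2 * real N + 1) * real K) ^ CARD('n)"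
      using K(2) by (intro power_mono) (auto simp: algebra_simps)
    also have "\<dots> = A * real K ^ CARD('n)" by (simp add: A_def power_mult_distrib)
    finally have "real (card ?C) * r powr (real CARD('n) + 1) \<le> A * real K ^ CARD('n) * r powr (real CARD('n) + 1)"
      by (intro mult_right_mono) auto
    also have "A * real K ^ CARD('n) * r powr (real CARD('n) + 1) = A * real K ^ CARD('n) * (r ^ CARD('n) * r)"
      using K(2) by (simp add: powr_add powr_realpow r_def)
    also have "\<dots> = A * (real K * r) ^ CARD('n) * r" by (simp add: power_mult_distrib)
    also have "\<dots> = A / real K" using K(2) by (simp add: r_def)
    also have "\<dots> \<le> \<eta>" using K \<open>\<eta> > 0\<close> by (simp add: field_simps)
    finally show ?thesis .
  qed
  moreover have "0 \<le> r" "r \<le> \<delta>" using K \<open>\<delta> > 0\<close> by (auto simp: r_def field_simps)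
  ultimately show "\<exists>\<C> r. finite \<C> \<and> (box_cube N :: (real ^ 'n) set) \<subseteq> \<Union>\<C> \<and> 0 \<le> r \<and> r \<le> \<delta> \<and>
    (\<forall>U\<in>\<C>. \<forall>x\<in>U. \<forall>y\<in>U. infnorm (x - y) \<le> r) \<and> real (card \<C>) * r powr (real CARD('n) + 1) \<le> \<eta>"
    using finite_imageI[OF finJ(1), of cell] by - (rule exI[of _ ?C], rule exI[of _ r], simp)
qed simp

lemma hausdorff_exponents_nonempty: "real CARD('n) + 1 \<in> {s. s > 0 \<and> hausdorff_measure s (E :: (real ^ 'n) set) = 0}"
  using hausdorff_measure_mono[of E UNIV "real CARD('n) + 1"] hausdorff_measure_above_dim[where 'n='n] by simp

lemma hausdorff_dim_ge:
  assumes "\<And>s. s > 0 \<Longrightarrow> hausdorff_measure s E = 0 \<Longrightarrow> b \<le> s" shows "b \<le> hausdorff_dim E"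
  unfolding hausdorff_dim_def using hausdorff_exponents_nonempty[of E] assms by (intro cInf_greatest) blast+

lemma hausdorff_dim_le:
  assumes "s > 0" "hausdorff_measure s E = 0" shows "hausdorff_dim E \<le> s"
  unfolding hausdorff_dim_def using assms by (intro cInf_lower bdd_belowI[of _ 0]) auto

section \<open>Packing measure\<close>

lemma borel_linf_cball: "linf_cball x r \<in> sets borel"
proof -
  have "linf_cball x r = (\<lambda>y. infnorm (x - y)) -` {..r}" by (auto simp: linf_cball_def)
  moreover have "closed ((\<lambda>y. infnorm (x - y)) -` {..r})"
    by (intro continuous_closed_vimage) (auto intro!: continuous_intros)
  ultimately show ?thesis by simp
qed

text \<open>Disjoint balls inside \<open>W\<close>, each of mass at least c r^t, have a total of r^t
  at most \<mu>(W) / c. The excess exponent contributes the factor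
  \<open>\<delta> powr (s - t)\<close>, which tends to 0. The measure is left general: Lebesgue
  measure serves the whole space, \<nu> serves the points in heavy cubes.\<close>

lemma packing_premeasure_null:
  fixes E :: "(real ^ 'n) set" and \<mu> :: "(real ^ 'n) measure"
  assumes sets: "sets \<mu> = sets borel" and W: "W \<in> sets \<mu>" "emeasure \<mu> W < \<infinity>"
    and "0 < c" "0 < b" "0 < t" "t < s"
    and ball: "\<And>x r. x \<in> E \<Longrightarrow> 0 < r \<Longrightarrow> r \<le> b \<Longrightarrow> linf_cball x r \<subseteq> W \<and> ennreal (c * r powr t) \<le> emeasure \<mu> (linf_cball x r)"
  shows "packing_premeasure s E = 0"
proof -
  define w where "w = enn2real (emeasure \<mu> W)"
  have w: "emeasure \<mu> W = ennreal w" "w \<ge> 0" using W(2) by (auto simp: w_def)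
  \<comment> \<open>Packings are weighted by diameters \<open>2 * r\<close>, which gives the factor
    \<open>2 powr t\<close>.\<close>
  define K where "K = 2 powr t * w / c"
  have K0: "K \<ge> 0" using w assms by (simp add: K_def)
  have pack: "(\<Sum>(x, r)\<in>F. ennreal ((2 * r) powr s)) \<le> ennreal (\<delta> powr (s - t) * K)"
    if F: "F \<in> linf_packings \<delta> E" and \<delta>: "0 < \<delta>" "\<delta> \<le> 2 * b" for F \<delta>
  proof -
    have fin: "finite F" using F by (simp add: linf_packings_def)
    have pts: "x \<in> E" "0 < r" "2 * r \<le> \<delta>" if "(x, r) \<in> F" for x r
      using F that by (auto simp: linf_packings_def)
    let ?B = "\<lambda>(x, r). linf_cball x r"
    have disj: "disjoint_family_on ?B F"
      using F unfolding linf_packings_def disjoint_family_on_def pairwise_def disjnt_def by fast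
    have "(\<Sum>(x, r)\<in>F. ennreal (c * r powr t)) \<le> (\<Sum>p\<in>F. emeasure \<mu> (?B p))"
    proof (rule sum_mono)
      fix p assume "p \<in> F"
      thus "(case p of (x, r) \<Rightarrow> ennreal (c * r powr t)) \<le> emeasure \<mu> (?B p)"
        using ball[of "fst p" "snd p"] pts[of "fst p" "snd p"] \<delta> by (simp add: case_prod_beta)
    qed
    also have "\<dots> = emeasure \<mu> (\<Union>p\<in>F. ?B p)"
      using borel_linf_cball sets by (intro sum_emeasure disj fin) auto
    also have "\<dots> \<le> emeasure \<mu> W"
    proof (rule emeasure_mono[OF UN_least W(1)])
      fix p assume "p \<in> F"
      thus "?B p \<subseteq> W"
        using ball[of "fst p" "snd p"] pts[of "fst p" "snd p"] \<delta> by (simp add: case_prod_beta)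
    qed
    finally have "(\<Sum>p\<in>F. ennreal (c * snd p powr t)) \<le> ennreal w" by (simp add: w case_prod_beta)
    hence le: "(\<Sum>p\<in>F. c * snd p powr t) \<le> w" using assms(4) w(2) by (subst (asm) sum_ennreal) auto
    have "(\<Sum>(x, r)\<in>F. ennreal ((2 * r) powr s)) = (\<Sum>p\<in>F. ennreal ((2 * snd p) powr s))" by (simp add: case_prod_beta)
    also have "\<dots> = ennreal (\<Sum>p\<in>F. (2 * snd p) powr s)" by (intro sum_ennreal) simp
    finally have 1: "(\<Sum>(x, r)\<in>F. ennreal ((2 * r) powr s)) = ennreal (\<Sum>p\<in>F. (2 * snd p) powr s)" .
    have "(\<Sum>p\<in>F. (2 * snd p) powr s) \<le> (\<Sum>p\<in>F. \<delta> powr (s - t) * (2 powr t / c) * (c * snd p powr t))"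
    proof (rule sum_mono)
      fix p assume "p \<in> F"
      hence p: "0 < snd p" "2 * snd p \<le> \<delta>" using pts[of "fst p" "snd p"] by auto
      have "(2 * snd p) powr s = (2 * snd p) powr (s - t) * (2 * snd p) powr t" by (simp add: powr_add[symmetric])
      also have "\<dots> \<le> \<delta> powr (s - t) * (2 * snd p) powr t"
        using p assms by (intro mult_right_mono powr_mono2) auto
      also have "\<dots> = \<delta> powr (s - t) * (2 powr t / c) * (c * snd p powr t)"
        using p assms by (simp add: powr_mult)
      finally show "(2 * snd p) powr s \<le> \<delta> powr (s - t) * (2 powr t / c) * (c * snd p powr t)" .
    qed
    also have "\<dots> = \<delta> powr (s - t) * (2 powr t / c) * (\<Sum>p\<in>F. c * snd p powr t)" by (rule sum_distrib_left[symmetric])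
    also have "\<dots> \<le> \<delta> powr (s - t) * (2 powr t / c) * w" using le assms by (intro mult_left_mono) auto
    also have "\<dots> = \<delta> powr (s - t) * K" by (simp add: K_def)
    finally show ?thesis unfolding 1 by (rule ennreal_leI)
  qed
  have "packing_premeasure s E \<le> 0 + ennreal e" if e: "e > 0" for e
  proof -
    \<comment> \<open>Makes \<open>\<delta> powr (s - t)\<close> at most \<open>e / (K + 1)\<close>;
      the denominator stays positive even when \<open>K = 0\<close>.\<close>
    define \<delta> where "\<delta> = min (2 * b) ((e / (K + 1)) powr (1 / (s - t)))"
    have \<delta>: "0 < \<delta>" "\<delta> \<le> 2 * b" using assms e K0 by (auto simp: \<delta>_def)
    have "\<delta> powr (s - t) \<le> ((e / (K + 1)) powr (1 / (s - t))) powr (s - t)"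
      using assms \<delta> by (intro powr_mono2) (auto simp: \<delta>_def)
    also have "\<dots> = e / (K + 1)" using assms e K0 by (simp add: powr_powr)
    finally have "\<delta> powr (s - t) * K \<le> e / (K + 1) * K" using K0 by (intro mult_right_mono)
    also have "\<dots> \<le> e" using e K0 by (simp add: field_simps)
    finally have "ennreal (\<delta> powr (s - t) * K) \<le> ennreal e" by (rule ennreal_leI)
    moreover have "packing_premeasure s E \<le> (SUP F\<in>linf_packings \<delta> E. \<Sum>(x, r)\<in>F. ennreal ((2 * r) powr s))"
      unfolding packing_premeasure_def using \<delta> by (intro INF_lower) simp
    moreover have "\<dots> \<le> ennreal (\<delta> powr (s - t) * K)" using pack \<delta> by (intro SUP_least) blast
    ultimately show ?thesis by simp
  qed
  hence "packing_premeasure s E \<le> 0" by (rule ennreal_le_epsilon)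
  thus ?thesis by simp
qed

lemma packing_measure_null:
  fixes U :: "nat \<Rightarrow> (real ^ 'n) set"
  assumes "E \<subseteq> (\<Union>i. U i)" "\<And>i. packing_premeasure s (U i) = 0"
  shows "packing_measure s E = 0"
proof -
  have "packing_measure s E \<le> (\<Sum>i. packing_premeasure s (U i))"
    unfolding packing_measure_def using assms(1) by (intro INF_lower) simp
  thus ?thesis using assms(2) by simp
qed

text \<open>Again an admissible exponent. Lebesgue measure gives a ball of radius \<open>r\<close>
  at least r^d, and the next larger box contains all balls of radius at most 1.\<close>

lemma packing_measure_above_dim:
  "packing_measure (real CARD('n) + 1) (E :: (real ^ 'n) set) = 0"
proof (rule packing_measure_null)
  show "E \<subseteq> (\<Union>N. box_cube N)" unfolding UN_box_cube by simp
  fix N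
  have box: "box_cube N = cbox (\<chi> i. - real N) (\<chi> i. real N)" for N :: nat
    by (auto simp: box_cube_def mem_box_cart abs_le_iff) (smt (verit))+
  have cb: "linf_cball x r = cbox (\<chi> i. x $ i - r) (\<chi> i. x $ i + r)" for x :: "real ^ 'n" and r
    unfolding linf_cball_def infnorm_le_iff by (auto simp: mem_box_cart abs_le_iff algebra_simps)
  show "packing_premeasure (real CARD('n) + 1) (box_cube N :: (real ^ 'n) set) = 0"
  proof (rule packing_premeasure_null[where \<mu>=lborel and W="box_cube (N + 1)" and c=1 and b=1 and t="real CARD('n)"])
    show "(box_cube (N + 1) :: (real ^ 'n) set) \<in> sets lborel" unfolding box by simp
    show "emeasure lborel (box_cube (N + 1) :: (real ^ 'n) set) < \<infinity>" unfolding box by (rule emeasure_lborel_cbox_finite)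
    fix x :: "real ^ 'n" and r :: real assume x: "x \<in> box_cube N" "0 < r" "r \<le> 1"
    have "linf_cball x r \<subseteq> box_cube (N + 1)"
    proof
      fix y assume "y \<in> linf_cball x r"
      hence *: "\<bar>(x - y) $ i\<bar> \<le> r" for i unfolding linf_cball_def infnorm_le_iff by blast
      have "\<bar>y $ i\<bar> \<le> real N + 1" for i
      proof -
        have "\<bar>x $ i\<bar> \<le> real N" using x by (simp add: box_cube_def)
        moreover have "\<bar>x $ i - y $ i\<bar> \<le> r" using *[of i] by simp
        ultimately show ?thesis using x(3) by linarith
      qed
      thus "y \<in> box_cube (N + 1)" by (simp add: box_cube_def add.commute)
    qed
    moreover have "ennreal (1 * r powr real CARD('n)) \<le> emeasure lborel (linf_cball x r)"
    proof -
      have "cbox (\<chi> i. x $ i - r) (\<chi> i. x $ i + r) \<noteq> {}" using x by (auto simp: interval_ne_empty_cart)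
      hence "measure lborel (linf_cball x r) = (2 * r) ^ CARD('n)"
        unfolding cb by (subst content_cbox_cart) auto
      moreover have "r powr real CARD('n) \<le> (2 * r) ^ CARD('n)"
        using x by (simp add: powr_realpow)
      moreover have "emeasure lborel (linf_cball x r) = ennreal (measure lborel (linf_cball x r))"
        unfolding cb by (intro emeasure_eq_ennreal_measure) (use emeasure_lborel_cbox_finite in \<open>auto simp: less_top\<close>)
      ultimately show ?thesis by (simp add: ennreal_leI)
    qed
    ultimately show "linf_cball x r \<subseteq> box_cube (N + 1) \<and> ennreal (1 * r powr real CARD('n)) \<le> emeasure lborel (linf_cball x r)" ..
  qed auto
qed

lemma packing_dim_ge:
  fixes E :: "(real ^ 'n) set"
  assumes "\<And>s. s > 0 \<Longrightarrow> packing_measure s E = 0 \<Longrightarrow> b \<le> s" shows "b \<le> packing_dim E"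
proof -
  have "real CARD('n) + 1 \<in> {s. s > 0 \<and> packing_measure s E = 0}" using packing_measure_above_dim by simp
  thus ?thesis unfolding packing_dim_def using assms by (intro cInf_greatest) blast+
qed

lemma packing_dim_le:
  assumes "s > 0" "packing_measure s E = 0" shows "packing_dim E \<le> s"
  unfolding packing_dim_def using assms by (intro cInf_lower bdd_belowI[of _ 0]) auto

subsection \<open>Local dimensions\<close>

text \<open>Two Levy comparisons through a common law give an inequality up to a shift and error of
  \<open>2 * e\<close>. Right continuity removes them, and symmetry gives equality.\<close>

lemma weak_conv_unique:
  fixes \<mu> :: "nat \<Rightarrow> real measure"
  assumes \<mu>: "\<And>n. real_distribution (\<mu> n)" and M: "real_distribution M" "weak_conv_m \<mu> M"
    and N: "real_distribution N" "weak_conv_m \<mu> N"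
  shows "M = N"
proof -
  have le: "cdf M x \<le> cdf N x" if M: "real_distribution M" "weak_conv_m \<mu> M"
    and N: "real_distribution N" "weak_conv_m \<mu> N" for M N :: "real measure" and x
  proof -
    interpret N: real_distribution N by fact
    have le: "cdf M x \<le> cdf N (x + 2 * e) + 2 * e" if "e > 0" for e
    proof -
      from weak_conv_levy[OF \<mu> M that] weak_conv_levy[OF \<mu> N that]
      have "\<forall>\<^sub>F n in sequentially. cdf M x \<le> cdf N (x + 2 * e) + 2 * e"
      proof eventually_elim
        case (elim n)
        have "cdf M ((x + e) - e) - e \<le> cdf (\<mu> n) (x + e)" using elim(1) by blast
        moreover have "cdf (\<mu> n) (x + e) \<le> cdf N ((x + e) + e) + e" using elim(2) by blast
        moreover have "(x + e) + e = x + 2 * e" "(x + e) - e = x" by simp_all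
        ultimately show ?case by simp
      qed
      thus ?thesis by (simp add: eventually_const)
    qed
    have "((\<lambda>e. cdf N (x + 2 * e) + 2 * e) \<longlongrightarrow> cdf N x + 2 * 0) (at_right 0)"
    proof (intro tendsto_add tendsto_mult tendsto_const tendsto_ident_at)
      have "(cdf N \<longlongrightarrow> cdf N x) (at_right x)" using N.cdf_is_right_cont by (simp add: continuous_within)
      moreover have "filterlim (\<lambda>e. x + 2 * e) (at_right x) (at_right 0)"
        unfolding filterlim_at
      proof
        show "\<forall>\<^sub>F e in at_right 0. x + 2 * e \<in> {x<..} \<and> x + 2 * e \<noteq> x"
          using eventually_at_right_less[of 0] by eventually_elim auto
        have "((\<lambda>e. x + 2 * e) \<longlongrightarrow> x + 2 * 0) (at_right 0)" by (intro tendsto_intros)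
        thus "((\<lambda>e. x + 2 * e) \<longlongrightarrow> x) (at_right 0)" by simp
      qed
      ultimately show "((\<lambda>e. cdf N (x + 2 * e)) \<longlongrightarrow> cdf N x) (at_right 0)" by (rule filterlim_compose)
    qed
    hence "((\<lambda>e. cdf N (x + 2 * e) + 2 * e) \<longlongrightarrow> cdf N x) (at_right 0)" by simp
    moreover have "\<forall>\<^sub>F e in at_right 0. cdf M x \<le> cdf N (x + 2 * e) + 2 * e"
      using eventually_at_right_less[of 0] by eventually_elim (rule le)
    ultimately show ?thesis by (rule tendsto_lowerbound) simp
  qed
  have "cdf M = cdf N" using le[OF M N] le[OF N M] by (intro ext antisym) auto
  thus ?thesis using cdf_unique M N by blast
qed

text \<open>The function \<open>s\<close> may fail to be measurable on a null set only, which the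
  completion repairs: there, every subset of a null set is measurable.\<close>

lemma distr_completion_AE_eq:
  fixes s f :: "'a \<Rightarrow> real"
  assumes "AE x in M. s x = f x" "f \<in> borel_measurable M"
  shows "distr (completion M) borel s = distr M borel f"
proof -
  have f: "f \<in> borel_measurable (completion M)" by (rule measurable_completion[OF assms(2)])
  have s: "s \<in> borel_measurable (completion M)"
  proof (rule measurableI)
    fix A :: "real set" assume A: "A \<in> sets borel"
    have [measurable]: "Measurable.pred (completion M) (\<lambda>x. f x \<in> A)" using f A by measurable
    have [measurable]: "Measurable.pred (completion M) (\<lambda>x. s x \<noteq> f x \<and> s x \<in> A)"
      "Measurable.pred (completion M) (\<lambda>x. s x \<noteq> f x)"
      using assms(1) by (auto intro!: sets_completion_AE elim!: eventually_mono)
    have "Measurable.pred (completion M) (\<lambda>x. (f x \<in> A \<and> \<not> s x \<noteq> f x) \<or> (s x \<noteq> f x \<and> s x \<in> A))" by measurable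
    moreover have "(\<lambda>x. (f x \<in> A \<and> \<not> s x \<noteq> f x) \<or> (s x \<noteq> f x \<and> s x \<in> A)) = (\<lambda>x. s x \<in> A)" by (intro ext) auto
    ultimately have "Measurable.pred (completion M) (\<lambda>x. s x \<in> A)" by simp
    hence "{x \<in> space (completion M). s x \<in> A} \<in> sets (completion M)" by (rule predE)
    moreover have "s -` A \<inter> space (completion M) = {x \<in> space (completion M). s x \<in> A}" by auto
    ultimately show "s -` A \<inter> space (completion M) \<in> sets (completion M)" by simp
  qed simp
  have "distr (completion M) borel s = distr (completion M) borel f"
    using AE_completion[OF assms(1)] s f by (intro distr_cong_AE) auto
  also have "\<dots> = distr M borel f" by (rule distr_completion[OF assms(2)])
  finally show ?thesis .
qed

lemma (in finite_measure) measure_UN_pos_imp_ex: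
  assumes "F \<subseteq> (\<Union>j::nat. B j)" "\<And>j. B j \<in> sets M" "F \<in> sets M" "measure M F > 0"
  shows "\<exists>j. measure M (B j) > 0"
proof (rule ccontr)
  assume "\<not> ?thesis"
  hence "measure M (B j) = 0" for j by (simp add: zero_less_measure_iff)
  hence "(\<Union>j. B j) \<in> null_sets M"
    using assms(2) by (intro null_sets_UN) (auto simp: null_sets_def emeasure_eq_measure)
  hence "measure M F \<le> 0"
    using assms by (metis finite_measure_mono measure_eq_0_null_sets null_setsD2)
  thus False using assms(4) by simp
qed

section \<open>Hausdorff and packing measures controlled by cube masses\<close>

context info_rate_limit
begin

text \<open>Mass distribution principle. A small set of diameter r > 0 is compared with the level
  \<open>k\<close> for which 2^(-k) lies in [r, 2r). It meets at most 5^d cubes of that level, and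
  those that contain a point of \<open>B\<close> have mass at most (2r)^t. A cover of
  \<open>E\<close> thus has total at least \<open>measure \<nu> B / c\<close>.\<close>

lemma hausdorff_measure_pos:
  assumes B: "B \<in> sets \<nu>" "B \<subseteq> E \<inter> good" "measure \<nu> B > 0" and "t > 0"
    and mass: "\<And>x k. x \<in> B \<Longrightarrow> k \<ge> k0 \<Longrightarrow> mass k x \<le> 2 powr (- real k * t)"
  shows "hausdorff_measure t E \<noteq> 0"
proof
  assume "hausdorff_measure t E = 0"
  define c where "c = 5 ^ CARD('n) * 2 powr t"
  have c: "c > 0" by (simp add: c_def)
  define \<eta> where "\<eta> = measure \<nu> B / (2 * c)"
  have "\<eta> > 0" using B(3) c by (simp add: \<eta>_def)
  moreover have "(1 :: real) / 2 ^ k0 > 0" by simp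
  ultimately obtain U where U: "fine_cover (1 / 2 ^ k0) E U" "(\<Sum>i. ennreal (linf_diam (U i) powr t)) \<le> ennreal \<eta>"
    using \<open>hausdorff_measure t E = 0\<close>[unfolded hausdorff_measure_eq_0_iff] by blast
  have small: "infnorm (x - y) \<le> 1 / 2 ^ k0" if "x \<in> U i" "y \<in> U i" for x y i
    using U(1) that unfolding fine_cover_def by blast
  \<comment> \<open>The covering sets may be non-measurable, so each trace on \<open>B\<close> is
    enlarged to a measurable set of comparable mass.\<close>
  have "\<exists>G. G \<in> sets \<nu> \<and> U i \<inter> B \<subseteq> G \<and> measure \<nu> G \<le> c * linf_diam (U i) powr t" for i
  proof -
    let ?r = "linf_diam (U i)"
    have r: "0 \<le> ?r" "?r \<le> 1 / 2 ^ k0" and r_ge: "\<And>x y. x \<in> U i \<Longrightarrow> y \<in> U i \<Longrightarrow> infnorm (x - y) \<le> ?r"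
      using linf_diam_nonneg_bounds[of "U i" "1 / 2 ^ k0"] small by auto
    show ?thesis
    proof (cases "?r = 0")
      case True
      \<comment> \<open>A set of diameter 0 determines no level; it is at most a point, and \<nu>
        has no atoms.\<close>
      have "U i \<inter> B \<subseteq> {x}" if "x \<in> U i" for x
      proof
        fix y assume "y \<in> U i \<inter> B"
        hence "infnorm (x - y) \<le> 0" using r_ge[OF that, of y] True by simp
        hence "x - y = 0" using infnorm_pos_lt[of "x - y"] by linarith
        thus "y \<in> {x}" by simp
      qed
      hence "\<exists>x. U i \<inter> B \<subseteq> {x}" by blast
      then obtain x where "U i \<inter> B \<subseteq> {x}" by blast
      thus ?thesis using True atomless[of x] by (intro exI[of _ "{x}"]) (auto simp: sets_eq)
    next
      case False
      hence r0: "?r > 0" using r by simp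
      define k where "k = nat \<lfloor>- log 2 ?r\<rfloor>"
      have lk0: "real k0 \<le> - log 2 ?r"
      proof -
        have "log 2 ?r \<le> log 2 (1 / 2 ^ k0)" using r(2) r0 by (subst log_le_cancel_iff) auto
        also have "\<dots> = - real k0" by (simp add: log_divide log_nat_power)
        finally show ?thesis by simp
      qed
      have k: "k \<ge> k0" "real k \<le> - log 2 ?r" "- log 2 ?r < real k + 1"
        using lk0 unfolding k_def by linarith+
      have rk: "?r \<le> 1 / 2 ^ k"
      proof -
        have "log 2 ?r \<le> - real k" using k by simp
        hence "?r \<le> 2 powr (- real k)" using r0 by (simp add: log_le_iff)
        thus ?thesis by (simp add: two_powr_minus_nat)
      qed
      have rk2: "2 powr (- real k) \<le> 2 * ?r"
      proof -
        have "- real k \<le> 1 + log 2 ?r" using k by simp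
        hence "2 powr (- real k) \<le> 2 powr (1 + log 2 ?r)" by (intro powr_mono) auto
        thus ?thesis using r0 by (simp add: powr_add)
      qed
      let ?Q = "{Q \<in> dyadic_cubes k. Q \<inter> (U i \<inter> B) \<noteq> {}}"
      have fin: "finite ?Q" by (rule finite_subset[OF _ finite_dyadic_cubes[of k]]) auto
      have "card ?Q \<le> 5 ^ CARD('n)"
      proof (rule card_cubes_meeting)
        fix x y assume "x \<in> U i \<inter> B" "y \<in> U i \<inter> B"
        hence "infnorm (x - y) \<le> 1 / 2 ^ k" using r_ge[of x y] rk by simp
        also have "(1 :: real) / 2 ^ k \<le> 2 / 2 ^ k" by (simp add: divide_right_mono)
        finally show "infnorm (x - y) \<le> 2 / 2 ^ k" .
      qed
      hence cardQ: "real (card ?Q) \<le> 5 ^ CARD('n)" using of_nat_mono[where 'a=real] by fastforce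
      have m: "\<Union>?Q \<in> sets \<nu>" using fin cubes_measurable by (intro sets.finite_Union) auto
      have "measure \<nu> (\<Union>?Q) \<le> (\<Sum>Q\<in>?Q. measure \<nu> Q)"
        using finite_measure_subadditive_finite[OF fin, of "\<lambda>Q. Q"] cubes_measurable by auto
      also have "\<dots> \<le> real (card ?Q) * (2 * ?r) powr t"
      proof (rule sum_bounded_above)
        fix Q assume "Q \<in> ?Q"
        then obtain x where x: "Q \<in> dyadic_cubes k" "x \<in> Q" "x \<in> B" by blast
        have "measure \<nu> Q \<le> 2 powr (- real k * t)" using mass[OF x(3) k(1)] dyadic_cube_at_unique[OF x(1,2)] by simp
        also have "\<dots> = (2 powr (- real k)) powr t" by (simp add: powr_powr)
        also have "\<dots> \<le> (2 * ?r) powr t" using rk2 assms(4) by (intro powr_mono2) auto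
        finally show "measure \<nu> Q \<le> (2 * ?r) powr t" .
      qed
      also have "\<dots> \<le> 5 ^ CARD('n) * (2 * ?r) powr t" using cardQ by (intro mult_right_mono) auto
      also have "\<dots> = c * ?r powr t" using r0 by (simp add: c_def powr_mult)
      finally have "measure \<nu> (\<Union>?Q) \<le> c * ?r powr t" .
      moreover have "U i \<inter> B \<subseteq> \<Union>?Q"
      proof
        fix x assume x: "x \<in> U i \<inter> B"
        hence "x \<in> unit_cube" using B(2) good_unit by blast
        thus "x \<in> \<Union>?Q" using x dyadic_cube_at_eq(2) mem_dyadic_cube_at by blast
      qed
      ultimately show ?thesis using m by blast
    qed
  qed
  then obtain G where G: "\<And>i. G i \<in> sets \<nu>" "\<And>i. U i \<inter> B \<subseteq> G i" "\<And>i. measure \<nu> (G i) \<le> c * linf_diam (U i) powr t"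
    by metis
  have "B \<subseteq> (\<Union>i. U i)" using B(2) U(1) unfolding fine_cover_def by blast
  hence "B \<subseteq> (\<Union>i. G i)" using G(2) by blast
  hence "ennreal (measure \<nu> B) \<le> emeasure \<nu> (\<Union>i. G i)"
    unfolding emeasure_eq_measure[symmetric] using G(1) by (intro emeasure_mono sets.countable_UN) auto
  also have "\<dots> \<le> (\<Sum>i. emeasure \<nu> (G i))" using G(1) by (intro emeasure_subadditive_countably) auto
  also have "\<dots> \<le> (\<Sum>i. ennreal c * ennreal (linf_diam (U i) powr t))"
    using G(3) c by (intro suminf_le) (auto simp: emeasure_eq_measure ennreal_mult[symmetric] intro: ennreal_leI)
  also have "\<dots> = ennreal c * (\<Sum>i. ennreal (linf_diam (U i) powr t))" by simp
  also have "\<dots> \<le> ennreal c * ennreal \<eta>" using U(2) by (rule mult_left_mono) simp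
  also have "\<dots> = ennreal (c * \<eta>)" using c \<open>\<eta> > 0\<close> by (simp add: ennreal_mult)
  finally have "measure \<nu> B \<le> c * \<eta>" using c \<open>\<eta> > 0\<close> by simp
  thus False using B(3) c by (simp add: \<eta>_def)
qed

text \<open>
  Take one point in each level-\<open>k\<close> cube that meets \<open>U \<inter> B\<close>. Two points in different cubes whose indices
  agree modulo 2 are more than \<open>2\<^sup>-\<^sup>k\<close> apart, so one of the \<open>2\<^sup>d\<close> parity classes carries a good packing.
\<close>

lemma packing_premeasure_ge:
  assumes B: "B \<subseteq> good"
    and mass: "\<And>x k. x \<in> B \<Longrightarrow> k \<ge> k0 \<Longrightarrow> mass k x \<le> 2 powr (- real k * t)"
    and G: "G = (\<Inter>k\<in>{k0..}. \<Union>{Q \<in> dyadic_cubes k. Q \<inter> (U \<inter> B) \<noteq> {}})"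
  shows "ennreal (measure \<nu> G / 2 ^ CARD('n)) \<le> packing_premeasure t U"
  unfolding packing_premeasure_def
proof (rule INF_greatest)
  fix \<delta> :: real assume "\<delta> \<in> {0<..}"
  hence \<delta>: "\<delta> > 0" by simp
  obtain k where k: "k \<ge> k0" "1 / 2 ^ k \<le> \<delta>"
  proof -
    obtain j where j: "(1 / 2) ^ j < \<delta>" using real_arch_pow_inv[OF \<delta>, of "1 / 2"] by auto
    have "(1 / 2 :: real) ^ max j k0 \<le> (1 / 2) ^ j" by (intro power_decreasing) auto
    hence "1 / 2 ^ max j k0 \<le> \<delta>" using j by (simp add: power_one_over)
    thus ?thesis using that[of "max j k0"] by simp
  qed
  let ?Q = "{Q \<in> dyadic_cubes k. Q \<inter> (U \<inter> B) \<noteq> {}}"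
  have fin: "finite ?Q" by (rule finite_subset[OF _ finite_dyadic_cubes[of k]]) auto
  define pt where "pt Q = (SOME x. x \<in> Q \<inter> (U \<inter> B))" for Q
  have pt: "pt Q \<in> Q" "pt Q \<in> U" "pt Q \<in> B" "pt Q \<in> unit_cube" "dyadic_cube_at k (pt Q) = Q" if "Q \<in> ?Q" for Q
  proof -
    have "\<exists>x. x \<in> Q \<inter> (U \<inter> B)" using that by auto
    hence "pt Q \<in> Q \<inter> (U \<inter> B)" unfolding pt_def by (rule someI_ex)
    thus "pt Q \<in> Q" "pt Q \<in> U" "pt Q \<in> B" by auto
    thus "pt Q \<in> unit_cube" "dyadic_cube_at k (pt Q) = Q"
      using B good_unit that dyadic_cube_at_unique by blast+
  qed
  have GQ: "measure \<nu> G \<le> (\<Sum>Q\<in>?Q. measure \<nu> Q)"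
  proof -
    have "G \<subseteq> \<Union>?Q" unfolding G using k(1) by (intro INF_lower) simp
    moreover have "\<Union>?Q \<in> sets \<nu>" using fin cubes_measurable by (intro sets.finite_Union) auto
    ultimately have "measure \<nu> G \<le> measure \<nu> (\<Union>?Q)" by (rule finite_measure_mono)
    also have "\<dots> \<le> (\<Sum>Q\<in>?Q. measure \<nu> Q)"
      using finite_measure_subadditive_finite[OF fin, of "\<lambda>Q. Q"] cubes_measurable by auto
    finally show ?thesis .
  qed
  define par where "par Q = (\<lambda>i. even (dyadic_index k (pt Q $ i)))" for Q
  define cls where "cls p = {Q \<in> ?Q. par Q = p}" for p
  \<comment> \<open>Pigeonhole: if each of the \<open>2 ^ CARD('n)\<close> parity classes carried
    less than its share, the cubes together would carry less than
    \<open>measure \<nu> G\<close>.\<close>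
  have "\<exists>p. measure \<nu> G / 2 ^ CARD('n) \<le> (\<Sum>Q\<in>cls p. measure \<nu> Q)"
  proof (rule ccontr)
    assume "\<not> ?thesis"
    hence less: "(\<Sum>Q\<in>cls p. measure \<nu> Q) < measure \<nu> G / 2 ^ CARD('n)" for p by (simp add: not_le)
    have "(\<Sum>Q\<in>?Q. measure \<nu> Q) = (\<Sum>p\<in>UNIV. \<Sum>Q\<in>cls p. measure \<nu> Q)"
      unfolding cls_def by (rule sum.group[symmetric]) (use fin in auto)
    also have "\<dots> < (\<Sum>p\<in>(UNIV :: ('n \<Rightarrow> bool) set). measure \<nu> G / 2 ^ CARD('n))"
      using less by (intro sum_strict_mono) auto
    also have "\<dots> = measure \<nu> G" by (simp add: card_fun)
    finally show False using GQ by simp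
  qed
  then obtain p where p: "measure \<nu> G / 2 ^ CARD('n) \<le> (\<Sum>Q\<in>cls p. measure \<nu> Q)" by blast
  have "cls p \<subseteq> ?Q" unfolding cls_def by auto
  hence cls: "cls p \<subseteq> ?Q" "finite (cls p)" using finite_subset[OF _ fin] by auto
  \<comment> \<open>The diameter \<open>2 * ?r\<close> is then the side length, against which the
    masses are bounded.\<close>
  let ?r = "1 / 2 ^ k / 2 :: real"
  define F where "F = (\<lambda>Q. (pt Q, ?r)) ` cls p"
  have inj: "inj_on (\<lambda>Q. (pt Q, ?r)) (cls p)"
    by (rule inj_onI) (use pt(5) cls(1) in \<open>metis (no_types, lifting) prod.inject subsetD\<close>)
  have far: "infnorm (pt P - pt Q) > 1 / 2 ^ k" if "P \<in> cls p" "Q \<in> cls p" "P \<noteq> Q" for P Q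
  proof (rule infnorm_parity_class)
    have PQ: "P \<in> ?Q" "Q \<in> ?Q" using that cls by auto
    show "pt P \<in> unit_cube" "pt Q \<in> unit_cube" using pt(4) PQ by auto
    show "dyadic_cube_at k (pt P) \<noteq> dyadic_cube_at k (pt Q)" using pt(5)[OF PQ(1)] pt(5)[OF PQ(2)] that by simp
    have "par P = par Q" using that by (simp add: cls_def)
    thus "even (dyadic_index k (pt P $ i)) = even (dyadic_index k (pt Q $ i))" for i
      unfolding par_def by meson
  qed
  have "F \<in> linf_packings \<delta> U"
    unfolding linf_packings_def
  proof (intro CollectI conjI)
    show "finite F" unfolding F_def using cls by simp
    show "\<forall>(x, r)\<in>F. x \<in> U \<and> 0 < r \<and> 2 * r \<le> \<delta>"
      unfolding F_def using pt(2)[OF subsetD[OF cls(1)]] k(2) by auto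
    show "pairwise (\<lambda>(x, r) (y, t). disjnt (linf_cball x r) (linf_cball y t)) F"
    proof (rule pairwiseI)
      fix u v assume "u \<in> F" "v \<in> F" "u \<noteq> v"
      then obtain P Q where PQ: "P \<in> cls p" "Q \<in> cls p" "P \<noteq> Q" "u = (pt P, ?r)" "v = (pt Q, ?r)"
        unfolding F_def by blast
      have "disjnt (linf_cball (pt P) ?r) (linf_cball (pt Q) ?r)"
        unfolding disjnt_def
      proof (rule equals0I)
        fix z assume "z \<in> linf_cball (pt P) ?r \<inter> linf_cball (pt Q) ?r"
        hence "infnorm (pt P - z) \<le> ?r" "infnorm (pt Q - z) \<le> ?r" by (auto simp: linf_cball_def)
        moreover have "infnorm (pt P - pt Q) \<le> infnorm (pt P - z) + infnorm (pt Q - z)"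
          using infnorm_triangle[of "pt P - z" "z - pt Q"] infnorm_sub[of z "pt Q"] by simp
        ultimately have "infnorm (pt P - pt Q) \<le> ?r + ?r" by linarith
        also have "?r + ?r = 1 / 2 ^ k" by simp
        finally show False using far[OF PQ(1-3)] by simp
      qed
      thus "(case u of (x, r) \<Rightarrow> \<lambda>(y, t). disjnt (linf_cball x r) (linf_cball y t)) v"
        unfolding PQ(4,5) by simp
    qed
  qed
  moreover have "ennreal (measure \<nu> G / 2 ^ CARD('n)) \<le> (\<Sum>(x, r)\<in>F. ennreal ((2 * r) powr t))"
  proof -
    have "(\<Sum>(x, r)\<in>F. ennreal ((2 * r) powr t)) = (\<Sum>Q\<in>cls p. ennreal ((2 * ?r) powr t))"
      unfolding F_def by (subst sum.reindex[OF inj]) (simp add: comp_def)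
    also have "\<dots> = ennreal (\<Sum>Q\<in>cls p. (2 * ?r) powr t)" by (rule sum_ennreal) simp
    finally have eq: "(\<Sum>(x, r)\<in>F. ennreal ((2 * r) powr t)) = ennreal (\<Sum>Q\<in>cls p. (2 * ?r) powr t)" .
    have "measure \<nu> Q \<le> (2 * ?r) powr t" if "Q \<in> cls p" for Q
    proof -
      have Q: "Q \<in> ?Q" using that cls by auto
      have "measure \<nu> Q \<le> 2 powr (- real k * t)" using mass[OF pt(3)[OF Q] k(1)] pt(5)[OF Q] by simp
      also have "\<dots> = (2 powr (- real k)) powr t" by (simp add: powr_powr)
      also have "2 powr (- real k) = 2 * ?r" by (simp add: two_powr_minus_nat)
      finally show ?thesis .
    qed
    hence "(\<Sum>Q\<in>cls p. measure \<nu> Q) \<le> (\<Sum>Q\<in>cls p. (2 * ?r) powr t)" by (rule sum_mono)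
    thus ?thesis unfolding eq using p by (intro ennreal_leI) linarith
  qed
  ultimately show "ennreal (measure \<nu> G / 2 ^ CARD('n)) \<le> (SUP F\<in>linf_packings \<delta> U. \<Sum>(x, r)\<in>F. ennreal ((2 * r) powr t))"
    by (rule SUP_upper2)
qed

text \<open>The packing measure is an infimum over countable decompositions, so the pre-measure
  estimate is needed for every piece, and the pieces together must still account for
  \<open>B\<close>.\<close>

lemma packing_measure_pos:
  assumes B: "B \<in> sets \<nu>" "B \<subseteq> E \<inter> good" "measure \<nu> B > 0"
    and mass: "\<And>x k. x \<in> B \<Longrightarrow> k \<ge> k0 \<Longrightarrow> mass k x \<le> 2 powr (- real k * t)"
  shows "packing_measure t E \<noteq> 0"
proof -
  have "ennreal (measure \<nu> B / 2 ^ CARD('n)) \<le> packing_measure t E"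
    unfolding packing_measure_def
  proof (rule INF_greatest)
    fix U :: "nat \<Rightarrow> (real ^ 'n) set" assume "U \<in> {U. E \<subseteq> (\<Union>i. U i)}"
    hence U: "E \<subseteq> (\<Union>i. U i)" by simp
    \<comment> \<open>Pieces may be non-measurable. \<open>G i\<close> is a measurable hull of
      \<open>U i \<inter> B\<close>, tested on all levels at once, so that it does not depend on the
      scale of the packing.\<close>
    define G where "G i = (\<Inter>k\<in>{k0..}. \<Union>{Q \<in> dyadic_cubes k. Q \<inter> (U i \<inter> B) \<noteq> {}})" for i
    have G: "G i \<in> sets \<nu>" for i
    proof -
      have "\<Union>{Q \<in> dyadic_cubes k. Q \<inter> (U i \<inter> B) \<noteq> {}} \<in> sets \<nu>" for k
      proof (rule sets.finite_Union)
        show "finite {Q \<in> dyadic_cubes k. Q \<inter> (U i \<inter> B) \<noteq> {}}"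
          by (rule finite_subset[OF _ finite_dyadic_cubes[of k]]) auto
      qed (use cubes_measurable in auto)
      thus ?thesis unfolding G_def by (intro sets.countable_INT') auto
    qed
    have "B \<subseteq> (\<Union>i. G i)"
    proof
      fix x assume x: "x \<in> B"
      then obtain i where "x \<in> U i" using B(2) U by blast
      moreover have "x \<in> unit_cube" using x B(2) good_unit by blast
      ultimately have "x \<in> G i" unfolding G_def using x dyadic_cube_at_eq(2) mem_dyadic_cube_at by blast
      thus "x \<in> (\<Union>i. G i)" by blast
    qed
    hence "emeasure \<nu> B \<le> emeasure \<nu> (\<Union>i. G i)" using G by (intro emeasure_mono sets.countable_UN) auto
    also have "\<dots> \<le> (\<Sum>i. emeasure \<nu> (G i))" using G by (intro emeasure_subadditive_countably) auto
    finally have "emeasure \<nu> B * ennreal (1 / 2 ^ CARD('n)) \<le> (\<Sum>i. emeasure \<nu> (G i)) * ennreal (1 / 2 ^ CARD('n))"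
      by (rule mult_right_mono) simp
    also have "\<dots> = (\<Sum>i. emeasure \<nu> (G i) * ennreal (1 / 2 ^ CARD('n)))" by simp
    also have "\<dots> \<le> (\<Sum>i. packing_premeasure t (U i))"
    proof (rule suminf_le)
      fix i
      have "emeasure \<nu> (G i) * ennreal (1 / 2 ^ CARD('n)) = ennreal (measure \<nu> (G i) / 2 ^ CARD('n))"
        by (simp add: emeasure_eq_measure ennreal_mult[symmetric])
      also have "\<dots> \<le> packing_premeasure t (U i)"
        using B(2) by (intro packing_premeasure_ge[OF _ mass G_def]) auto
      finally show "emeasure \<nu> (G i) * ennreal (1 / 2 ^ CARD('n)) \<le> packing_premeasure t (U i)" .
    qed auto
    also have "emeasure \<nu> B * ennreal (1 / 2 ^ CARD('n)) = ennreal (measure \<nu> B / 2 ^ CARD('n))"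
      by (simp add: emeasure_eq_measure ennreal_mult[symmetric])
    finally show "ennreal (measure \<nu> B / 2 ^ CARD('n)) \<le> (\<Sum>i. packing_premeasure t (U i))" .
  qed
  moreover have "ennreal (measure \<nu> B / 2 ^ CARD('n)) > 0" using B(3) by simp
  ultimately show ?thesis by (metis not_le)
qed

text \<open>At most 2^(kt) cubes have mass at least 2^(-kt). They cover \<open>E\<close> with
  diameters at most 2^(-k), for a total of 2^(-k(s-t)).\<close>

lemma hausdorff_null_heavy:
  assumes "t > 0" "s > t" and "\<And>x k. x \<in> E \<Longrightarrow> k \<ge> k0 \<Longrightarrow> mass k x \<ge> 2 powr (- real k * t)" and "E \<subseteq> good"
  shows "hausdorff_measure s E = 0"
proof (rule hausdorff_null_finite_covers)
  fix \<delta> \<eta> :: real assume \<delta>: "\<delta> > 0" "\<eta> > 0"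
  have "(\<lambda>k. 2 powr (- real k)) \<longlonglongrightarrow> 0" by real_asymp
  hence "\<forall>\<^sub>F k in sequentially. 2 powr (- real k) < \<delta>" using \<delta> by (auto dest: order_tendstoD)
  moreover have "(\<lambda>k. 2 powr (- (s - t) * real k)) \<longlonglongrightarrow> 0"
  proof -
    have "(\<lambda>k. 2 powr (- c * real k)) \<longlonglongrightarrow> 0" if "c > 0" for c :: real using that by real_asymp
    from this[of "s - t"] show ?thesis using assms by simp
  qed
  hence "\<forall>\<^sub>F k in sequentially. 2 powr (- (s - t) * real k) < \<eta>" using \<delta> by (auto dest: order_tendstoD)
  ultimately have "\<forall>\<^sub>F k in sequentially. 2 powr (- real k) < \<delta> \<and> 2 powr (- (s - t) * real k) < \<eta> \<and> k \<ge> k0"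
    using eventually_ge_at_top[of k0] by eventually_elim auto
  then obtain k where k: "2 powr (- real k) < \<delta>" "2 powr (- (s - t) * real k) < \<eta>" "k \<ge> k0"
    using eventually_happens'[OF sequentially_bot] by blast
  let ?Q = "{Q \<in> dyadic_cubes k. measure \<nu> Q \<ge> 2 powr (- real k * t)}"
  have r: "2 powr (- real k) = 1 / 2 ^ k" by (rule two_powr_minus_nat)
  have "real (card ?Q) * (2 powr (- real k)) powr s \<le> (1 / 2 powr (- real k * t)) * (2 powr (- real k)) powr s"
    by (intro mult_right_mono card_heavy_cubes) auto
  also have "\<dots> = 2 powr (- (s - t) * real k)" by (simp add: powr_powr powr_diff[symmetric] algebra_simps)
  finally have "real (card ?Q) * (2 powr (- real k)) powr s \<le> \<eta>" using k(2) by simp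
  moreover have "finite ?Q" by (rule finite_subset[OF _ finite_dyadic_cubes[of k]]) auto
  moreover have "E \<subseteq> \<Union>?Q"
  proof
    fix x assume "x \<in> E"
    hence "x \<in> unit_cube" "mass k x \<ge> 2 powr (- real k * t)" using assms(3,4) k(3) good_unit by auto
    thus "x \<in> \<Union>?Q" using dyadic_cube_at_eq(2) mem_dyadic_cube_at by blast
  qed
  moreover have "\<forall>Q\<in>?Q. \<forall>x\<in>Q. \<forall>y\<in>Q. infnorm (x - y) \<le> 2 powr (- real k)"
    unfolding r using infnorm_dyadic_cube by blast
  ultimately show "\<exists>\<C> r. finite \<C> \<and> E \<subseteq> \<Union>\<C> \<and> 0 \<le> r \<and> r \<le> \<delta> \<and>
    (\<forall>U\<in>\<C>. \<forall>x\<in>U. \<forall>y\<in>U. infnorm (x - y) \<le> r) \<and> real (card \<C>) * r powr s \<le> \<eta>"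
    using k(1) by - (rule exI[of _ ?Q], rule exI[of _ "2 powr (- real k)"], simp)
qed (use assms in simp)

text \<open>A ball of radius \<open>r\<close> contains the cube around its centre whose side lies in
  (r/2, r]. Its mass is at least (r/2)^t, which is where the constant \<open>2 powr (- t)\<close>
  comes from.\<close>

lemma packing_premeasure_null_heavy:
  assumes "t > 0" "s > t" and "\<And>x k. x \<in> E \<Longrightarrow> k \<ge> k0 \<Longrightarrow> mass k x \<ge> 2 powr (- real k * t)" and "E \<subseteq> good"
  shows "packing_premeasure s E = 0"
proof (rule packing_premeasure_null[where \<mu>=\<nu> and W=UNIV and c="2 powr (- t)" and b="1 / 2 ^ k0" and t=t])
  fix x and r :: real assume x: "x \<in> E" "0 < r" "r \<le> 1 / 2 ^ k0"
  have xu: "x \<in> unit_cube" using x assms(4) good_unit by blast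
  define k where "k = nat \<lceil>- log 2 r\<rceil>"
  have "log 2 r \<le> log 2 (1 / 2 ^ k0)" using x by (subst log_le_cancel_iff) auto
  also have "\<dots> = - real k0" by (simp add: log_divide log_nat_power)
  finally have "real k0 \<le> - log 2 r" by simp
  hence k: "k \<ge> k0" "- log 2 r \<le> real k" "real k < - log 2 r + 1" unfolding k_def by linarith+
  have rk: "1 / 2 ^ k \<le> r"
  proof -
    have "- real k \<le> log 2 r" using k by simp
    hence "2 powr (- real k) \<le> r" using x by (simp add: le_log_iff)
    thus ?thesis by (simp add: two_powr_minus_nat)
  qed
  have "log 2 r - 1 \<le> - real k" using k by simp
  hence "2 powr (log 2 r - 1) \<le> 2 powr (- real k)" by (intro powr_mono) auto
  hence rk2: "r / 2 \<le> 2 powr (- real k)" using x by (simp add: powr_diff)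
  have sub: "dyadic_cube_at k x \<subseteq> linf_cball x r"
    using infnorm_dyadic_cube_at[OF xu] rk by (auto simp: linf_cball_def intro: order_trans)
  have ball: "linf_cball x r \<in> sets \<nu>" using borel_linf_cball sets_eq by blast
  have "2 powr (- t) * r powr t = (r / 2) powr t" using x by (simp add: powr_divide powr_minus_divide)
  also have "\<dots> \<le> (2 powr (- real k)) powr t" using rk2 x assms(1) by (intro powr_mono2) auto
  also have "\<dots> = 2 powr (- real k * t)" by (simp add: powr_powr)
  also have "\<dots> \<le> mass k x" using assms(3)[OF x(1) k(1)] .
  also have "\<dots> \<le> measure \<nu> (linf_cball x r)" using sub ball by (rule finite_measure_mono)
  finally have "ennreal (2 powr (- t) * r powr t) \<le> emeasure \<nu> (linf_cball x r)"
    unfolding emeasure_eq_measure by (rule ennreal_leI)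
  thus "linf_cball x r \<subseteq> UNIV \<and> ennreal (2 powr (- t) * r powr t) \<le> emeasure \<nu> (linf_cball x r)" by simp
qed (use assms sets_eq emeasure_eq_measure in auto)

end

section \<open>Almost everywhere limits of the rates\<close>

locale info_rate_AE_limit = info_rate_limit \<nu> a C \<rho>
  for \<nu> :: "(real ^ 'n) measure" and a C :: real and \<rho> :: "real measure" +
  fixes s :: "real ^ 'n \<Rightarrow> real"
  assumes AE_limit: "AE x in \<nu>. (\<lambda>k. info_rate \<nu> k x) \<longlonglongrightarrow> s x"
begin

text \<open>A measurable version of \<open>s\<close>; where the rates diverge, \<open>lim\<close>
  yields some value without significance.\<close>

definition loc :: "real ^ 'n \<Rightarrow> real" where "loc x = lim (\<lambda>k. X k x)"

definition nice :: "(real ^ 'n) set" where "nice = {x \<in> good. convergent (\<lambda>k. X k x)}"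

lemma loc_measurable [measurable]: "loc \<in> borel_measurable \<nu>"
  unfolding loc_def by measurable

lemma AE_nice: "AE x in \<nu>. x \<in> nice" and AE_s_eq: "AE x in \<nu>. s x = loc x"
proof -
  show "AE x in \<nu>. x \<in> nice"
    using AE_limit AE_good by eventually_elim (auto simp: nice_def convergent_def)
  show "AE x in \<nu>. s x = loc x"
    using AE_limit by eventually_elim (simp add: loc_def limI)
qed

lemma nice_measurable [measurable]: "nice \<in> sets \<nu>"
proof -
  have "{x \<in> space \<nu>. convergent (\<lambda>k. X k x)} \<in> sets \<nu>"
    unfolding Cauchy_convergent_iff[symmetric] by measurable
  hence "good \<inter> {x \<in> space \<nu>. convergent (\<lambda>k. X k x)} \<in> sets \<nu>" by auto
  moreover have "good \<inter> {x \<in> space \<nu>. convergent (\<lambda>k. X k x)} = nice" by (auto simp: nice_def space_eq)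
  ultimately show ?thesis by simp
qed

lemma nice_limit: "x \<in> nice \<Longrightarrow> (\<lambda>k. X k x) \<longlonglongrightarrow> loc x"
  by (simp add: nice_def loc_def convergent_LIMSEQ_iff)

lemma nice_good: "nice \<subseteq> good" by (auto simp: nice_def)

text \<open>Dominated convergence makes the laws of the rates converge weakly to the law of
  \<open>loc\<close>, and weak limits are unique.\<close>

lemma rho_eq_distr: "\<rho> = distr \<nu> borel loc"
proof (rule weak_conv_unique[OF real_distribution_X R.real_distribution_axioms weak])
  show "real_distribution (distr \<nu> borel loc)" by simp
  show "weak_conv_m (\<lambda>k. distr \<nu> borel (X k)) (distr \<nu> borel loc)"
  proof (rule integral_bdd_continuous_conv_imp_weak_conv[OF real_distribution_X])
    show "real_distribution (distr \<nu> borel loc)" by simp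
    fix f :: "real \<Rightarrow> real" assume f: "\<And>x. isCont f x" "\<And>x. \<bar>f x\<bar> \<le> 1"
    have [measurable]: "f \<in> borel_measurable borel"
      using f(1) by (intro borel_measurable_continuous_onI continuous_at_imp_continuous_on) auto
    have "(\<lambda>k. LINT x|\<nu>. f (X k x)) \<longlonglongrightarrow> (LINT x|\<nu>. f (loc x))"
    proof (rule integral_dominated_convergence[where w="\<lambda>_. 1"])
      show "AE x in \<nu>. (\<lambda>k. f (X k x)) \<longlonglongrightarrow> f (loc x)"
        using AE_nice by eventually_elim (use nice_limit f(1) in \<open>auto intro: isCont_tendsto_compose\<close>)
    qed (use f(2) in auto)
    thus "(\<lambda>k. integral\<^sup>L (distr \<nu> borel (X k)) f) \<longlonglongrightarrow> integral\<^sup>L (distr \<nu> borel loc) f"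
      by (simp add: integral_distr)
  qed
qed

lemma rho_eq_completion: "\<rho> = distr (completion \<nu>) borel s"
  using rho_eq_distr distr_completion_AE_eq[OF AE_s_eq loc_measurable] by simp

lemma loc_law: "A \<in> sets borel \<Longrightarrow> measure \<nu> {x. loc x \<in> A} = measure \<rho> A"
  using arg_cong[OF rho_eq_distr, of "\<lambda>\<mu>. measure \<mu> A"] by (simp add: measure_distr vimage_def space_eq)

lemma loc_sets: "A \<in> sets borel \<Longrightarrow> {x. loc x \<in> A} \<in> sets \<nu>"
  using measurable_sets[OF loc_measurable, of A] by (simp add: vimage_def space_eq)

lemma AE_loc_between: "AE x in \<nu>. m \<le> loc x \<and> loc x \<le> M"
proof -
  have "AE y in distr \<nu> borel loc. m \<le> y \<and> y \<le> M" using AE_between by (subst (asm) rho_eq_distr)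
  thus ?thesis by (subst (asm) AE_distr_iff) auto
qed

text \<open>The mass distribution principle needs one starting level for all points. Exhausting
  \<open>F\<close> by sets with a common starting level leaves at least one of positive
  measure.\<close>

lemma ex_light_part:
  assumes F: "F \<in> sets \<nu>" "F \<subseteq> nice" "\<forall>x\<in>F. loc x > t" "measure \<nu> F > 0"
  shows "\<exists>k0 B. B \<in> sets \<nu> \<and> B \<subseteq> F \<and> measure \<nu> B > 0 \<and> (\<forall>x\<in>B. \<forall>k\<ge>k0. mass k x \<le> 2 powr (- real k * t))"
proof -
  \<comment> \<open>Starting at \<open>max j 1\<close> excludes level 0, where the rate is a default
    value and does not encode the mass.\<close>
  define B where "B j = F \<inter> {x \<in> space \<nu>. \<forall>k\<in>{max j 1..}. X k x \<ge> t}" for j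
  have B: "B j \<in> sets \<nu>" for j
  proof -
    have "{x \<in> space \<nu>. \<forall>k\<in>{max j 1..}. X k x \<ge> t} \<in> sets \<nu>" by measurable
    thus ?thesis unfolding B_def using F(1) by blast
  qed
  have "F \<subseteq> (\<Union>j. B j)"
  proof
    fix x assume x: "x \<in> F"
    hence "\<forall>\<^sub>F k in sequentially. t < X k x"
      using nice_limit[of x] F(2,3) by (auto dest: order_tendstoD)
    then obtain j where "\<And>k. k \<ge> j \<Longrightarrow> t < X k x" unfolding eventually_sequentially by blast
    hence "x \<in> B j" using x unfolding B_def by (auto simp: space_eq less_imp_le)
    thus "x \<in> (\<Union>j. B j)" by blast
  qed
  from measure_UN_pos_imp_ex[OF this B F(1,4)] obtain j where j: "measure \<nu> (B j) > 0" by blast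
  have "mass k x \<le> 2 powr (- real k * t)" if "x \<in> B j" "k \<ge> max j 1" for x k
  proof -
    have "x \<in> good" "k > 0" "X k x \<ge> t" using that F(2) nice_good unfolding B_def by auto
    thus ?thesis using mass_eq_powr[of x k] by (simp add: mult_left_mono)
  qed
  thus ?thesis using B[of j] j by (intro exI[of _ "max j 1"] exI[of _ "B j"]) (auto simp: B_def)
qed

text \<open>The same exhaustion from the other side. Here all parts are kept, since being null
  passes from the parts to \<open>F\<close> through a countable union or cover.\<close>

lemma heavy_parts:
  assumes "F \<subseteq> nice" "\<forall>x\<in>F. loc x < t"
  shows "\<exists>E. F \<subseteq> (\<Union>j. E j) \<and> (\<forall>j. E j \<subseteq> good \<and> (\<forall>x\<in>E j. \<forall>k\<ge>max j 1. mass k x \<ge> 2 powr (- real k * t)))"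
proof -
  define E where "E j = {x \<in> F. \<forall>k\<ge>max j 1. X k x \<le> t}" for j
  have "F \<subseteq> (\<Union>j. E j)"
  proof
    fix x assume x: "x \<in> F"
    hence "\<forall>\<^sub>F k in sequentially. X k x < t"
      using nice_limit[of x] assms by (auto dest: order_tendstoD)
    then obtain j where "\<And>k. k \<ge> j \<Longrightarrow> X k x < t" unfolding eventually_sequentially by blast
    hence "x \<in> E j" using x unfolding E_def by (auto simp: less_imp_le)
    thus "x \<in> (\<Union>j. E j)" by blast
  qed
  moreover have "mass k x \<ge> 2 powr (- real k * t)" if "x \<in> E j" "k \<ge> max j 1" for x k j
  proof -
    have "x \<in> good" "k > 0" "X k x \<le> t" using that assms(1) nice_good unfolding E_def by auto
    thus ?thesis using mass_eq_powr[of x k] by (simp add: mult_left_mono)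
  qed
  moreover have "E j \<subseteq> good" for j using assms(1) nice_good unfolding E_def by blast
  ultimately show ?thesis by (intro exI[of _ E]) blast
qed

text \<open>Almost every point has limit rate at least \<open>m\<close>, so for \<open>t < m\<close>
  any charged set contains a charged part of rates above \<open>t\<close>. Conversely, since
  \<open>m\<close> is in the support, points of rate below \<open>m + e / 2\<close> form a charged
  set, and it is null for the exponent \<open>m + e\<close>.\<close>

lemma lower_hausdorff_dim_eq: "lower_hausdorff_dim \<nu> = m"
proof (rule antisym)
  let ?E = "{E \<in> sets borel. measure \<nu> E > 0}"
  have bdd: "bdd_below (hausdorff_dim ` ?E)"
    by (intro bdd_belowI[of _ 0]) (auto intro: hausdorff_dim_ge)
  show "m \<le> lower_hausdorff_dim \<nu>"
    unfolding lower_hausdorff_dim_def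
  proof (rule cINF_greatest)
    have "UNIV \<in> ?E" using prob_space by (simp add: space_eq)
    thus "?E \<noteq> {}" by blast
    fix E assume "E \<in> ?E"
    hence E: "E \<in> sets \<nu>" "measure \<nu> E > 0" using sets_eq by auto
    show "m \<le> hausdorff_dim E"
    proof (rule hausdorff_dim_ge, rule ccontr)
      fix t assume t: "t > 0" "hausdorff_measure t E = 0" "\<not> m \<le> t"
      define F where "F = E \<inter> nice \<inter> {x. loc x \<in> {t<..}}"
      have F: "F \<in> sets \<nu>" unfolding F_def using E(1) loc_sets[of "{t<..}"] nice_measurable by auto
      have "measure \<nu> F = measure \<nu> E"
      proof (rule measure_eq_AE)
        show "AE x in \<nu>. x \<in> F \<longleftrightarrow> x \<in> E"
          using AE_nice AE_loc_between by eventually_elim (use t in \<open>auto simp: F_def\<close>)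
      qed (use F E in auto)
      hence F_pos: "measure \<nu> F > 0" using E by simp
      have Fn: "F \<subseteq> nice" and Ft: "\<forall>x\<in>F. loc x > t" unfolding F_def by auto
      from ex_light_part[OF F Fn Ft F_pos] obtain k0 B
        where "B \<in> sets \<nu>" "B \<subseteq> F" "measure \<nu> B > 0" "\<forall>x\<in>B. \<forall>k\<ge>k0. mass k x \<le> 2 powr (- real k * t)"
        by (elim exE conjE)
      hence "hausdorff_measure t E \<noteq> 0"
        using nice_good t(1) by (intro hausdorff_measure_pos[of B E t k0]) (auto simp: F_def)
      thus False using t(2) by simp
    qed
  qed
  show "lower_hausdorff_dim \<nu> \<le> m"
  proof (rule field_le_epsilon)
    fix e :: real assume e: "e > 0"
    \<comment> \<open>Halfway, so that the exponent \<open>m + e\<close> strictly exceeds the rate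
      bound \<open>t\<close>.\<close>
    define t where "t = m + e / 2"
    have t: "t > m" "m + e > t" "t > 0" using e m_bounds by (auto simp: t_def)
    define F where "F = nice \<inter> {x. loc x \<in> {..<t}}"
    have F: "F \<in> sets \<nu>" unfolding F_def using loc_sets[of "{..<t}"] nice_measurable by auto
    have "measure \<nu> F = measure \<nu> {x. loc x \<in> {..<t}}"
      using AE_nice F loc_sets[of "{..<t}"] by (intro measure_eq_AE) (auto simp: F_def elim!: eventually_mono)
    also have "\<dots> > 0" using loc_law[of "{..<t}"] mass_left_of[OF t(1)] by simp
    finally have F_pos: "measure \<nu> F > 0" .
    have Fn: "F \<subseteq> nice" and Ft: "\<forall>x\<in>F. loc x < t" unfolding F_def by auto
    from heavy_parts[OF Fn Ft] obtain E where E1: "F \<subseteq> (\<Union>j. E j)"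
      and E2: "\<forall>j. E j \<subseteq> good \<and> (\<forall>x\<in>E j. \<forall>k\<ge>max j 1. mass k x \<ge> 2 powr (- real k * t))"
      by (elim exE conjE)
    have E: "F \<subseteq> (\<Union>j. E j)" "\<And>j. E j \<subseteq> good" "\<And>j x k. x \<in> E j \<Longrightarrow> k \<ge> max j 1 \<Longrightarrow> mass k x \<ge> 2 powr (- real k * t)"
      using E1 E2 by auto
    have "hausdorff_measure (m + e) (E j) = 0" for j
      by (rule hausdorff_null_heavy[OF t(3,2) E(3) E(2)])
    hence "hausdorff_measure (m + e) (\<Union>j. E j) = 0" by (rule hausdorff_null_UN)
    hence "hausdorff_measure (m + e) F = 0" using hausdorff_measure_mono[OF E(1), of "m + e"] by simp
    hence "hausdorff_dim F \<le> m + e" using t by (intro hausdorff_dim_le) auto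
    moreover have "lower_hausdorff_dim \<nu> \<le> hausdorff_dim F"
      unfolding lower_hausdorff_dim_def using F F_pos sets_eq by (intro cINF_lower bdd) auto
    ultimately show "lower_hausdorff_dim \<nu> \<le> m + e" by simp
  qed
qed

text \<open>A set of full measure meets the charged set of rates above \<open>t\<close> for every
  \<open>t < M\<close>, as \<open>M\<close> is in the support. Conversely, the rates below
  \<open>M + e / 2\<close> already have full measure.\<close>

lemma upper_packing_dim_eq: "upper_packing_dim \<nu> = M"
proof (rule antisym)
  let ?E = "{E \<in> sets borel. measure \<nu> E = 1}"
  have bdd: "bdd_below (packing_dim ` ?E)"
    by (intro bdd_belowI[of _ 0]) (auto intro: packing_dim_ge)
  show "M \<le> upper_packing_dim \<nu>"
    unfolding upper_packing_dim_def
  proof (rule cINF_greatest)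
    have "UNIV \<in> ?E" using prob_space by (simp add: space_eq)
    thus "?E \<noteq> {}" by blast
    fix E assume "E \<in> ?E"
    hence E: "E \<in> sets \<nu>" "measure \<nu> E = 1" using sets_eq by auto
    have AE_E: "AE x in \<nu>. x \<in> E" using prob_eq_1[OF E(1)] E(2) by simp
    show "M \<le> packing_dim E"
    proof (rule packing_dim_ge, rule ccontr)
      fix t assume t: "t > 0" "packing_measure t E = 0" "\<not> M \<le> t"
      define F where "F = E \<inter> nice \<inter> {x. loc x \<in> {t<..}}"
      have F: "F \<in> sets \<nu>" unfolding F_def using E(1) loc_sets[of "{t<..}"] nice_measurable by auto
      have "measure \<nu> F = measure \<nu> {x. loc x \<in> {t<..}}"
      proof (rule measure_eq_AE)
        show "AE x in \<nu>. x \<in> F \<longleftrightarrow> x \<in> {x. loc x \<in> {t<..}}"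
          using AE_nice AE_E by eventually_elim (auto simp: F_def)
      qed (use F loc_sets[of "{t<..}"] in auto)
      also have "\<dots> > 0" using loc_law[of "{t<..}"] mass_right_of[of t] t(3) by simp
      finally have F_pos: "measure \<nu> F > 0" .
      have Fn: "F \<subseteq> nice" and Ft: "\<forall>x\<in>F. loc x > t" unfolding F_def by auto
      from ex_light_part[OF F Fn Ft F_pos] obtain k0 B
        where "B \<in> sets \<nu>" "B \<subseteq> F" "measure \<nu> B > 0" "\<forall>x\<in>B. \<forall>k\<ge>k0. mass k x \<le> 2 powr (- real k * t)"
        by (elim exE conjE)
      hence "packing_measure t E \<noteq> 0"
        using nice_good by (intro packing_measure_pos[of B E k0 t]) (auto simp: F_def)
      thus False using t(2) by simp
    qed
  qed
  show "upper_packing_dim \<nu> \<le> M"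
  proof (rule field_le_epsilon)
    fix e :: real assume e: "e > 0"
    define t where "t = M + e / 2"
    have t: "t > M" "M + e > t" "t > 0" using e m_bounds by (auto simp: t_def)
    define F where "F = nice \<inter> {x. loc x \<in> {..<t}}"
    have F: "F \<in> sets \<nu>" unfolding F_def using loc_sets[of "{..<t}"] nice_measurable by auto
    have "AE x in \<nu>. x \<in> F" using AE_nice AE_loc_between by eventually_elim (use t in \<open>auto simp: F_def\<close>)
    hence F1: "measure \<nu> F = 1" using prob_eq_1[OF F] by simp
    have Fn: "F \<subseteq> nice" and Ft: "\<forall>x\<in>F. loc x < t" unfolding F_def by auto
    from heavy_parts[OF Fn Ft] obtain E where E1: "F \<subseteq> (\<Union>j. E j)"
      and E2: "\<forall>j. E j \<subseteq> good \<and> (\<forall>x\<in>E j. \<forall>k\<ge>max j 1. mass k x \<ge> 2 powr (- real k * t))"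
      by (elim exE conjE)
    have E: "F \<subseteq> (\<Union>j. E j)" "\<And>j. E j \<subseteq> good" "\<And>j x k. x \<in> E j \<Longrightarrow> k \<ge> max j 1 \<Longrightarrow> mass k x \<ge> 2 powr (- real k * t)"
      using E1 E2 by auto
    have "packing_premeasure (M + e) (E j) = 0" for j
      by (rule packing_premeasure_null_heavy[OF t(3,2) E(3) E(2)])
    hence "packing_measure (M + e) F = 0" by (rule packing_measure_null[OF E(1)])
    hence "packing_dim F \<le> M + e" using t by (intro packing_dim_le) auto
    moreover have "upper_packing_dim \<nu> \<le> packing_dim F"
      unfolding upper_packing_dim_def using F F1 sets_eq by (intro cINF_lower bdd) auto
    ultimately show "upper_packing_dim \<nu> \<le> M + e" by simp
  qed
qed

end

subsection \<open>Bounds for the gap\<close>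

context info_rate_limit
begin

lemma integrable_inv: "integrable \<rho> (\<lambda>y. 1 / y)"
  using integrable_inverse[of 0] m_bounds by simp

lemma between_mono:
  assumes "integrable \<rho> f" "integrable \<rho> g" "\<And>y. m \<le> y \<Longrightarrow> y \<le> M \<Longrightarrow> f y \<le> g y"
  shows "(LINT y|\<rho>. f y) \<le> (LINT y|\<rho>. (g y :: real))"
proof (rule integral_mono_AE[OF assms(1,2)])
  show "AE y in \<rho>. f y \<le> g y" using AE_between by eventually_elim (use assms(3) in auto)
qed

lemma h_bounds: "m \<le> h" "h \<le> M" "h > 0"
proof -
  have "(LINT y|\<rho>. m) \<le> h" unfolding h_def by (rule between_mono[OF _ integrable_powers(1)]) auto
  thus "m \<le> h" by simp
  have "h \<le> (LINT y|\<rho>. M)" unfolding h_def by (rule between_mono[OF integrable_powers(1)]) auto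
  thus "h \<le> M" by simp
  show "h > 0" using \<open>m \<le> h\<close> m_bounds by simp
qed

lemma affine_integral: "integrable \<rho> (\<lambda>y. (c - y) / b)" "(LINT y|\<rho>. (c - y) / b) = (c - h) / b"
proof -
  show "integrable \<rho> (\<lambda>y. (c - y) / b)"
    by (intro integrable_divide Bochner_Integration.integrable_diff integrable_powers) auto
  have "(LINT y|\<rho>. c - y) = (LINT y|\<rho>. c) - h"
    unfolding h_def by (rule Bochner_Integration.integral_diff[OF _ integrable_powers(1)]) auto
  thus "(LINT y|\<rho>. (c - y) / b) = (c - h) / b" by simp
qed

lemma D_pos: "D > 0" "H = 1 / D"
  using H_bounds by (auto simp: D_def)

text \<open>Expanding (y - c)^2 / y gives y - 2c + c^2 / y. The two exact representations of the gap
  are the choices \<open>c = D\<close> and \<open>c = h\<close>, with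
  \<open>H = 1 / D\<close>.\<close>

lemma centered_integral:
  "integrable \<rho> (\<lambda>y. (y - c)\<^sup>2 / y)" "(LINT y|\<rho>. (y - c)\<^sup>2 / y) = h - 2 * c + c\<^sup>2 * H"
proof -
  have AE: "AE y in \<rho>. (y - c)\<^sup>2 / y = y - 2 * c + c\<^sup>2 * (1 / y)"
    using AE_between by eventually_elim (use m_bounds in \<open>auto simp: field_simps power2_eq_square\<close>)
  have int1: "integrable \<rho> (\<lambda>y. y - 2 * c)"
    by (intro Bochner_Integration.integrable_diff integrable_powers) auto
  have int2: "integrable \<rho> (\<lambda>y. c\<^sup>2 * (1 / y))" by (rule integrable_mult_right[OF integrable_inv])
  have int: "integrable \<rho> (\<lambda>y. y - 2 * c + c\<^sup>2 * (1 / y))"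
    by (rule Bochner_Integration.integrable_add[OF int1 int2])
  show "integrable \<rho> (\<lambda>y. (y - c)\<^sup>2 / y)"
    by (subst integrable_cong_AE[OF _ _ AE]) (use int in auto)
  have "(LINT y|\<rho>. (y - c)\<^sup>2 / y) = (LINT y|\<rho>. y - 2 * c + c\<^sup>2 * (1 / y))"
    by (rule integral_cong_AE[OF _ _ AE]) auto
  also have "\<dots> = h - 2 * c + c\<^sup>2 * H"
  proof -
    have "(LINT y|\<rho>. y - 2 * c + c\<^sup>2 * (1 / y)) = (LINT y|\<rho>. y - 2 * c) + (LINT y|\<rho>. c\<^sup>2 * (1 / y))"
      by (rule Bochner_Integration.integral_add[OF int1 int2])
    also have "(LINT y|\<rho>. c\<^sup>2 * (1 / y)) = c\<^sup>2 * H" unfolding H_def by (rule integral_mult_right_zero)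
    also have "(LINT y|\<rho>. y - 2 * c) = h - (LINT y|\<rho>. 2 * c)"
      unfolding h_def by (rule Bochner_Integration.integral_diff[OF integrable_powers(1)]) auto
    finally show ?thesis by simp
  qed
  finally show "(LINT y|\<rho>. (y - c)\<^sup>2 / y) = h - 2 * c + c\<^sup>2 * H" .
qed

lemma gap_representation: "h - D = (LINT y|\<rho>. (y - D)\<^sup>2 / y)"
  unfolding centered_integral(2) D_pos(2) using D_pos(1) by (simp add: power2_eq_square)

lemma gap_representation': "h - D = D / h * (LINT y|\<rho>. (y - h)\<^sup>2 / y)"
  unfolding centered_integral(2) D_pos(2) using D_pos(1) h_bounds by (simp add: field_simps power2_eq_square)

lemma D_le_h: "D \<le> h"
proof -
  have "0 \<le> (LINT y|\<rho>. (y - D)\<^sup>2 / y)"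
    using AE_between m_bounds by (intro integral_nonneg_AE) (auto elim!: eventually_mono)
  thus ?thesis using gap_representation by simp
qed

lemma V_integral: "V = (LINT y|\<rho>. (y - h)\<^sup>2)" unfolding V_def h_def ..

lemma integrable_V: "integrable \<rho> (\<lambda>y. (y - h)\<^sup>2)"
proof -
  have "(\<lambda>y. (y - h)\<^sup>2) = (\<lambda>y. y\<^sup>2 - 2 * h * y + h\<^sup>2)" by (auto simp: power2_eq_square algebra_simps)
  thus ?thesis using integrable_powers by simp
qed

lemma V_nonneg: "V \<ge> 0" unfolding V_integral by simp

text \<open>The function 1/y lies below its chord over [\<alpha>, \<beta>], and integrating the
  chord bounds 1/D. With \<open>u = \<alpha> + \<beta> - h\<close>, the square root bound is the
  arithmetic-geometric mean inequality for \<open>u\<close> and \<alpha>\<beta>/u. The variance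
  bounds replace 1/y by 1/\<beta> or 1/\<alpha> in the second representation.\<close>

lemma interval_bounds:
  assumes "0 < \<alpha>" "\<alpha> \<le> m" "M \<le> \<beta>"
  shows "\<alpha> * \<beta> / (\<alpha> + \<beta> - h) \<le> D" and "h - D \<le> (sqrt \<beta> - sqrt \<alpha>)\<^sup>2"
    and "D / (h * \<beta>) * V \<le> h - D" and "h - D \<le> D / (h * \<alpha>) * V"
proof -
  have \<beta>: "0 < \<beta>" using assms m_bounds by linarith
  define u where "u = \<alpha> + \<beta> - h"
  have u: "u > 0" using assms h_bounds by (simp add: u_def)
  have "H \<le> (LINT y|\<rho>. (\<alpha> + \<beta> - y) / (\<alpha> * \<beta>))"
    unfolding H_def
  proof (rule between_mono[OF integrable_inv affine_integral(1)])
    fix y assume y: "m \<le> y" "y \<le> M"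
    hence y0: "y > 0" "\<alpha> \<le> y" "y \<le> \<beta>" using assms m_bounds by auto
    \<comment> \<open>The chord inequality in factored form.\<close>
    have "0 \<le> (y - \<alpha>) * (\<beta> - y)" using y0 by simp
    hence "\<alpha> * \<beta> \<le> (\<alpha> + \<beta> - y) * y" by (simp add: algebra_simps)
    thus "1 / y \<le> (\<alpha> + \<beta> - y) / (\<alpha> * \<beta>)" using y0 assms \<beta> by (simp add: field_simps)
  qed
  also have "\<dots> = u / (\<alpha> * \<beta>)" unfolding u_def by (rule affine_integral(2))
  finally have "1 / D \<le> u / (\<alpha> * \<beta>)" unfolding D_pos(2) .
  hence le: "\<alpha> * \<beta> / u \<le> D" using u D_pos assms \<beta> by (simp add: field_simps)
  thus "\<alpha> * \<beta> / (\<alpha> + \<beta> - h) \<le> D" by (simp add: u_def)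
  have "0 \<le> (u - sqrt (\<alpha> * \<beta>))\<^sup>2 / u" using u by simp
  also have "\<dots> = u - 2 * sqrt (\<alpha> * \<beta>) + (sqrt (\<alpha> * \<beta>))\<^sup>2 / u"
    using u by (simp add: field_simps power2_eq_square)
  also have "(sqrt (\<alpha> * \<beta>))\<^sup>2 = \<alpha> * \<beta>" using assms \<beta> by simp
  finally have "2 * sqrt (\<alpha> * \<beta>) \<le> u + D" using le by linarith
  hence "h - D \<le> \<alpha> + \<beta> - 2 * sqrt (\<alpha> * \<beta>)" by (simp add: u_def)
  also have "\<dots> = (sqrt \<beta> - sqrt \<alpha>)\<^sup>2" using assms \<beta> by (simp add: power2_diff real_sqrt_mult)
  finally show "h - D \<le> (sqrt \<beta> - sqrt \<alpha>)\<^sup>2" .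
  have "V / \<beta> \<le> (LINT y|\<rho>. (y - h)\<^sup>2 / y)"
  proof -
    have "(LINT y|\<rho>. (y - h)\<^sup>2 / \<beta>) \<le> (LINT y|\<rho>. (y - h)\<^sup>2 / y)"
      by (rule between_mono[OF integrable_divide[OF integrable_V] centered_integral(1)])
        (use assms m_bounds \<beta> in \<open>auto intro!: divide_left_mono\<close>)
    thus ?thesis by (simp add: V_integral)
  qed
  hence "D / h * (V / \<beta>) \<le> h - D"
    unfolding gap_representation' using D_pos h_bounds by (intro mult_left_mono) auto
  thus "D / (h * \<beta>) * V \<le> h - D" by simp
  have "(LINT y|\<rho>. (y - h)\<^sup>2 / y) \<le> V / \<alpha>"
  proof -
    have "(LINT y|\<rho>. (y - h)\<^sup>2 / y) \<le> (LINT y|\<rho>. (y - h)\<^sup>2 / \<alpha>)"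
      by (rule between_mono[OF centered_integral(1) integrable_divide[OF integrable_V]])
        (use assms m_bounds in \<open>auto intro!: divide_left_mono\<close>)
    thus ?thesis by (simp add: V_integral)
  qed
  hence "h - D \<le> D / h * (V / \<alpha>)"
    unfolding gap_representation' using D_pos h_bounds by (intro mult_left_mono) auto
  thus "h - D \<le> D / (h * \<alpha>) * V" by simp
qed

section \<open>Equality cases\<close>

lemma rho_eq_return_if_AE:
  assumes "AE y in \<rho>. y = c" shows "\<rho> = return borel c"
proof (rule measure_eqI)
  fix A assume "A \<in> sets \<rho>"
  hence A: "A \<in> sets borel" by simp
  have "emeasure \<rho> A = emeasure \<rho> (if c \<in> A then UNIV else {})"
    using assms A by (intro emeasure_eq_AE) (auto elim!: eventually_mono)
  thus "emeasure \<rho> A = emeasure (return borel c) A"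
    using A R.emeasure_space_1 by (simp add: indicator_def)
qed simp

lemma V_eq_0_iff: "V = 0 \<longleftrightarrow> \<rho> = return borel h"
proof
  assume "V = 0"
  hence "AE y in \<rho>. (y - h)\<^sup>2 = 0"
    unfolding V_integral by (subst (asm) integral_nonneg_eq_0_iff_AE[OF integrable_V]) auto
  hence "AE y in \<rho>. y = h" by eventually_elim simp
  thus "\<rho> = return borel h" by (rule rho_eq_return_if_AE)
next
  assume eq: "\<rho> = return borel h"
  have "V = (LINT y|return borel h. (y - h)\<^sup>2)" unfolding V_integral by (rule arg_cong2[OF eq refl])
  also have "\<dots> = 0" by (subst integral_return) auto
  finally show "V = 0" .
qed

text \<open>The gap is enclosed between two multiples of the variance, the lower one with a positive
  factor, so both vanish together.\<close>

lemma h_eq_D_iff: "h = D \<longleftrightarrow> \<rho> = return borel h"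
proof -
  have b: "D / (h * M) * V \<le> h - D" "h - D \<le> D / (h * m) * V"
    using interval_bounds(3,4)[of m M] m_bounds by auto
  have "D / (h * M) > 0" using D_pos h_bounds m_bounds by simp
  hence "h = D \<longleftrightarrow> V = 0" using b V_nonneg D_le_h
    by (metis diff_self eq_iff_diff_eq_0 mult_le_0_iff mult_zero_right not_le order_antisym)
  thus ?thesis using V_eq_0_iff by simp
qed

lemma integral_two_points:
  assumes "measure \<rho> {u, v} = 1" "f \<in> borel_measurable borel" "u \<noteq> v"
  shows "(LINT y|\<rho>. f y) = f u * measure \<rho> {u} + (f v * measure \<rho> {v} :: real)"
    and "measure \<rho> {u} + measure \<rho> {v} = 1"
proof -
  have AE: "AE y in \<rho>. y \<in> {u, v}" using R.prob_eq_1[of "{u, v}"] assms by simp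
  have "(LINT y|\<rho>. f y) = (LINT y|\<rho>. f u * indicator {u} y + f v * indicator {v} y)"
    using assms(2) AE assms(3) by (intro integral_cong_AE) (auto simp: indicator_def elim!: eventually_mono)
  also have "\<dots> = f u * measure \<rho> {u} + f v * measure \<rho> {v}"
    by (subst Bochner_Integration.integral_add) (auto simp: R.emeasure_eq_measure)
  finally show "(LINT y|\<rho>. f y) = f u * measure \<rho> {u} + f v * measure \<rho> {v}" .
  have "measure \<rho> {u} + measure \<rho> {v} = measure \<rho> ({u} \<union> {v})"
    using assms(3) by (intro R.finite_measure_Union[symmetric]) auto
  thus "measure \<rho> {u} + measure \<rho> {v} = 1" using assms(1) by (simp add: insert_commute)
qed

text \<open>The deficit in the chord inequality is (y - m)(M - y) / (m M y). It is nonnegative on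
  the support, so its integral vanishes only if it vanishes almost everywhere.\<close>

lemma lower_bound_eq_iff:
  "m * M / (m + M - h) = D \<longleftrightarrow> measure \<rho> {m, M} = 1"
proof -
  let ?g = "\<lambda>y. (m + M - y) / (m * M) - 1 / y"
  have u: "m + M - h > 0" using h_bounds m_bounds by simp
  have g: "?g y = (y - m) * (M - y) / (m * M * y)" if "m \<le> y" for y
    using that m_bounds by (simp add: field_simps)
  have int: "integrable \<rho> ?g" by (rule Bochner_Integration.integrable_diff[OF affine_integral(1) integrable_inv])
  have "(LINT y|\<rho>. ?g y) = (m + M - h) / (m * M) - H"
    unfolding H_def affine_integral(2)[symmetric] by (rule Bochner_Integration.integral_diff[OF affine_integral(1) integrable_inv])
  moreover have "m * M / (m + M - h) = D \<longleftrightarrow> (m + M - h) / (m * M) - H = 0"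
    unfolding D_pos(2) using u m_bounds D_pos(1) by (auto simp: field_simps)
  moreover have "(LINT y|\<rho>. ?g y) = 0 \<longleftrightarrow> (AE y in \<rho>. ?g y = 0)"
  proof (rule integral_nonneg_eq_0_iff_AE[OF int])
    show "AE y in \<rho>. 0 \<le> ?g y" using AE_between by eventually_elim (use g m_bounds in simp)
  qed
  moreover have "(AE y in \<rho>. ?g y = 0) \<longleftrightarrow> (AE y in \<rho>. y \<in> {m, M})"
  proof
    assume "AE y in \<rho>. ?g y = 0"
    thus "AE y in \<rho>. y \<in> {m, M}" using AE_between by eventually_elim (use g m_bounds in auto)
  next
    assume "AE y in \<rho>. y \<in> {m, M}"
    thus "AE y in \<rho>. ?g y = 0" using AE_between by eventually_elim (use g m_bounds in auto)
  qed
  moreover have "(AE y in \<rho>. y \<in> {m, M}) \<longleftrightarrow> measure \<rho> {m, M} = 1" using R.prob_eq_1[of "{m, M}"] by simp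
  ultimately show ?thesis by simp
qed

text \<open>A maximal gap forces equality twice: in the chord bound, which puts \<rho> on the two
  end points, and in the mean inequality, which fixes the mean as m + M - sqrt(m M). The mean then
  determines the weights.\<close>

lemma max_gap_iff:
  assumes "m < M"
  shows "h - D = (sqrt M - sqrt m)\<^sup>2 \<longleftrightarrow>
    measure \<rho> {m} = sqrt m / (sqrt m + sqrt M) \<and> measure \<rho> {M} = sqrt M / (sqrt m + sqrt M)"
proof -
  define p q where "p = sqrt m" and "q = sqrt M"
  have pq: "p > 0" "q > 0" "p < q" "m = p\<^sup>2" "M = q\<^sup>2" using assms m_bounds by (auto simp: p_def q_def)
  have ne: "m \<noteq> M" using assms by simp
  define u where "u = m + M - h"
  have u: "u > 0" using h_bounds m_bounds by (simp add: u_def)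
  have h_two: "h = m * measure \<rho> {m} + M * measure \<rho> {M}" if "measure \<rho> {m, M} = 1"
    unfolding h_def using integral_two_points(1)[OF that _ ne, of "\<lambda>y. y"] by simp
  show ?thesis unfolding p_def[symmetric] q_def[symmetric]
  proof
    assume eq: "h - D = (q - p)\<^sup>2"
    have "m * M / u \<le> D" using interval_bounds(1)[of m M] m_bounds by (simp add: u_def)
    moreover have uD: "u + D = 2 * (p * q)" using eq unfolding u_def pq(4,5) by (simp add: power2_eq_square algebra_simps)
    ultimately have "u + m * M / u \<le> 2 * (p * q)" by simp
    hence "(u + m * M / u) * u \<le> 2 * (p * q) * u" using u by (intro mult_right_mono) auto
    moreover have "(u + m * M / u) * u = u\<^sup>2 + (p * q)\<^sup>2" using u unfolding pq(4,5) by (simp add: field_simps power2_eq_square)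
    \<comment> \<open>Equality in the arithmetic-geometric mean inequality, obtained by completing
      the square.\<close>
    ultimately have "(u - p * q)\<^sup>2 \<le> 0" by (simp add: power2_diff algebra_simps)
    hence u_eq: "u = p * q" by simp
    hence "D = p * q" using uD by simp
    moreover have "m * M / u = p * q" unfolding u_eq pq(4,5) using pq(1,2) by (simp add: power2_eq_square)
    ultimately have "m * M / (m + M - h) = D" by (simp add: u_def)
    hence one: "measure \<rho> {m, M} = 1" using lower_bound_eq_iff by simp
    have sum: "measure \<rho> {m} + measure \<rho> {M} = 1" by (rule integral_two_points(2)[OF one _ ne, of "\<lambda>y. y"]) simp
    define w where "w = measure \<rho> {m}"
    have wM: "measure \<rho> {M} = 1 - w" using sum by (simp add: w_def)
    have "m + M - (m * w + M * (1 - w)) = p * q" using h_two[OF one] u_eq unfolding u_def w_def[symmetric] wM by simp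
    hence "w * (q - p) * (q + p) = p * (q - p)" unfolding pq(4,5) by (simp add: power2_eq_square algebra_simps)
    hence "w * (q + p) = p" using pq(3) by (simp add: mult.assoc mult.left_commute) 
    hence "w = p / (p + q)" using pq by (simp add: field_simps)
    thus "measure \<rho> {m} = p / (p + q) \<and> measure \<rho> {M} = q / (p + q)"
      unfolding wM w_def[symmetric] using pq by (simp add: field_simps)
  next
    assume w: "measure \<rho> {m} = p / (p + q) \<and> measure \<rho> {M} = q / (p + q)"
    have "measure \<rho> ({m} \<union> {M}) = measure \<rho> {m} + measure \<rho> {M}" using ne by (intro R.finite_measure_Union) auto
    also have "\<dots> = 1" using w pq by (simp add: add_divide_distrib[symmetric])
    finally have one: "measure \<rho> {m, M} = 1" by (simp add: insert_commute)
    have h_eq: "h = p\<^sup>2 - p * q + q\<^sup>2"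
    proof -
      have "h = m * (p / (p + q)) + M * (q / (p + q))" using h_two[OF one] w by simp
      also have "\<dots> = p\<^sup>2 - p * q + q\<^sup>2"
      proof -
        have "m * (p / (p + q)) + M * (q / (p + q)) = (p ^ 3 + q ^ 3) / (p + q)"
          unfolding pq(4,5) by (simp add: add_divide_distrib power2_eq_square power3_eq_cube)
        also have "p ^ 3 + q ^ 3 = (p\<^sup>2 - p * q + q\<^sup>2) * (p + q)" by algebra
        finally show ?thesis using pq(1,2) by simp
      qed
      finally show ?thesis .
    qed
    have "D = m * M / (m + M - h)" using lower_bound_eq_iff one by simp
    also have "\<dots> = p * q" unfolding h_eq pq(4,5) using pq(1,2) by (simp add: power2_eq_square)
    finally show "h - D = (q - p)\<^sup>2" unfolding h_eq by (simp add: power2_eq_square algebra_simps)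
  qed
qed

lemma two_point_gap:
  assumes p: "0 \<le> p" "p \<le> 1"
    and law: "\<forall>A\<in>sets borel. measure \<rho> A = p * measure (return borel s1) A + (1 - p) * measure (return borel s2) A"
  shows "h - D = p * (1 - p) * (s1 - s2)\<^sup>2 / (p * s2 + (1 - p) * s1)"
proof (cases "s1 = s2 \<or> p = 0 \<or> p = 1")
  case True
  \<comment> \<open>An uncharged point may be any real number, even one at which the denominator
    vanishes. The numerator is 0 in all these cases, so the right side is 0 regardless.\<close>
  define c where "c = (if p = 0 then s2 else s1)"
  have "measure \<rho> {c} = 1"
    using law[rule_format, of "{c}"] True by (auto simp: c_def measure_return indicator_def)
  hence "AE y in \<rho>. y = c" using R.prob_eq_1[of "{c}"] by simp
  hence "\<rho> = return borel c" by (rule rho_eq_return_if_AE)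
  moreover from this have "h = c" unfolding h_def by (simp add: integral_return)
  ultimately have "h = D" using h_eq_D_iff by simp
  thus ?thesis using True by auto
next
  case False
  hence ne: "s1 \<noteq> s2" and p': "0 < p" "p < 1" using p by auto
  have w: "measure \<rho> {s1} = p" "measure \<rho> {s2} = 1 - p" "measure \<rho> {s1, s2} = 1"
    using law[rule_format, of "{s1}"] law[rule_format, of "{s2}"] law[rule_format, of "{s1, s2}"] ne
    by (auto simp: measure_return indicator_def)
  \<comment> \<open>Positivity of the two points is derived: an atom of \<rho> cannot lie outside
    \<open>{m..M}\<close>.\<close>
  have pos: "y > 0" if "measure \<rho> {y} > 0" for y
  proof (rule ccontr)
    assume "\<not> y > 0"
    hence "AE x in \<rho>. x \<notin> {y}" using AE_between by (rule_tac eventually_mono) (use m_bounds in auto)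
    hence "measure \<rho> {y} = 0" using R.prob_eq_0[of "{y}"] by simp
    thus False using that by simp
  qed
  have s: "s1 > 0" "s2 > 0" using pos w p' by auto
  have h_eq: "h = s1 * p + s2 * (1 - p)"
    unfolding h_def using integral_two_points(1)[OF w(3) _ ne, of "\<lambda>y. y"] w by simp
  have H_eq: "H = p / s1 + (1 - p) / s2"
    unfolding H_def using integral_two_points(1)[OF w(3) _ ne, of "\<lambda>y. 1 / y"] w by simp
  define t where "t = p * s2 + (1 - p) * s1"
  have t: "t > 0" unfolding t_def using s p' by (simp add: add_pos_pos)
  have "H = t / (s1 * s2)" unfolding H_eq t_def using s by (simp add: field_simps)
  hence D_eq: "D = s1 * s2 / t" by (simp add: D_def)
  have "(h - D) * t = h * t - s1 * s2" unfolding D_eq using t by (simp add: field_simps)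
  also have "\<dots> = p * (1 - p) * (s1 - s2)\<^sup>2" unfolding h_eq t_def by (simp add: power2_eq_square algebra_simps)
  finally show ?thesis using t unfolding t_def[symmetric] by (simp add: field_simps)
qed

lemma sqrt_spread_mono:
  assumes "0 \<le> \<alpha>" "\<alpha> \<le> m" "M \<le> \<beta>"
  shows "(sqrt M - sqrt m)\<^sup>2 \<le> (sqrt \<beta> - sqrt \<alpha>)\<^sup>2"
  using assms m_bounds real_sqrt_le_mono[of m M] real_sqrt_le_mono[of \<alpha> m] real_sqrt_le_mono[of M \<beta>]
  by (intro power_mono) linarith+

end

section \<open>Transfer to the dimensions and derivatives of the statement\<close>

theorem theorem5p4:
  fixes \<nu> :: "(real ^ 'n) measure" and \<rho> :: "real measure"
    and a C m M h D V :: real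
  assumes "prob_space \<nu>" and "sets \<nu> = sets borel"
    and "msupport \<nu> \<subseteq> interior {x. \<forall>i. 0 \<le> x $ i \<and> x $ i \<le> 1}"
    and "a > 0" and "C \<ge> 1"
    and "\<And>k Q. Q \<in> dyadic_cubes k \<Longrightarrow> measure \<nu> Q \<le> C * 2 powr (- a * real k)"
    and "real_distribution \<rho>"
    and "weak_conv_m (\<lambda>k. distr \<nu> borel (info_rate \<nu> k)) \<rho>"
    and "m = (LEAST y. y \<in> msupport \<rho>)" and "M = (GREATEST y. y \<in> msupport \<rho>)"
    and "h = entropy_dim \<nu>" and "D = geom_quant_dim \<nu>"
    and "V = prob_space.variance \<rho> (\<lambda>y. y)"
  shows
    "m \<in> msupport \<rho> \<and> M \<in> msupport \<rho> \<and> msupport \<rho> \<subseteq> {m..M} \<and>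
     convergent (entropy_rate \<nu>) \<and> convergent (geom_quant_ratio \<nu>) \<and>
     0 < sigma_minus \<nu> \<and> sigma_minus \<nu> \<le> m \<and> m \<le> M \<and> M \<le> sigma_plus \<nu> \<and>
     m * M / (m + M - h) \<le> D \<and> D \<le> h \<and>
     0 \<le> h - D \<and> h - D \<le> (sqrt M - sqrt m)\<^sup>2 \<and>
     h - D = (LINT y|\<rho>. (y - D)\<^sup>2 / y) \<and>
     h - D = D / h * (LINT y|\<rho>. (y - h)\<^sup>2 / y) \<and>
     D / (h * M) * V \<le> h - D \<and> h - D \<le> D / (h * m) * V \<and>
     (\<lambda>k. deriv (deriv (spectrum \<nu> k)) 1 / (real k * ln 2)) \<longlonglongrightarrow> V \<and>
     (h = D \<longleftrightarrow> \<rho> = return borel h) \<and>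
     (\<rho> = return borel h \<longleftrightarrow> (\<lambda>k. deriv (deriv (spectrum \<nu> k)) 1) \<in> o(\<lambda>k. real k)) \<and>
     (m < M \<longrightarrow>
        (m * M / (m + M - h) = D \<longleftrightarrow> measure \<rho> {m, M} = 1) \<and>
        (h - D = (sqrt M - sqrt m)\<^sup>2 \<longleftrightarrow>
           measure \<rho> {m} = sqrt m / (sqrt m + sqrt M) \<and>
           measure \<rho> {M} = sqrt M / (sqrt m + sqrt M))) \<and>
     (\<forall>p s1 s2 :: real. 0 \<le> p \<longrightarrow> p \<le> 1 \<longrightarrow>
        (\<forall>A\<in>sets borel. measure \<rho> A =
           p * measure (return borel s1) A + (1 - p) * measure (return borel s2) A) \<longrightarrow>
        h - D = p * (1 - p) * (s1 - s2)\<^sup>2 / (p * s2 + (1 - p) * s1)) \<and>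
     (\<forall>\<alpha> \<alpha>' :: real. {m..M} \<subseteq> {\<alpha>..\<alpha>'} \<longrightarrow> {\<alpha>..\<alpha>'} \<subseteq> {0<..} \<longrightarrow>
        \<alpha> * \<alpha>' / (\<alpha> + \<alpha>' - h) \<le> D \<and> D \<le> h \<and>
        0 \<le> h - D \<and> h - D \<le> (sqrt \<alpha>' - sqrt \<alpha>)\<^sup>2 \<and>
        D / (h * \<alpha>') * V \<le> h - D \<and> h - D \<le> D / (h * \<alpha>) * V) \<and>
     h - D \<le> (sqrt M - sqrt m)\<^sup>2 \<and>
     (sqrt M - sqrt m)\<^sup>2 \<le> (sqrt (sigma_plus \<nu>) - sqrt (sigma_minus \<nu>))\<^sup>2 \<and>
     (\<forall>s :: real ^ 'n \<Rightarrow> real. (AE x in \<nu>. (\<lambda>k. info_rate \<nu> k x) \<longlonglongrightarrow> s x) \<longrightarrow>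
        \<rho> = distr (completion \<nu>) borel s \<and>
        {m..M} = {lower_hausdorff_dim \<nu>..upper_packing_dim \<nu>} \<and>
        h - D \<le> (sqrt (upper_packing_dim \<nu>) - sqrt (lower_hausdorff_dim \<nu>))\<^sup>2 \<and>
        (sqrt (upper_packing_dim \<nu>) - sqrt (lower_hausdorff_dim \<nu>))\<^sup>2
          \<le> (sqrt (sigma_plus \<nu>) - sqrt (sigma_minus \<nu>))\<^sup>2)"
proof -
  have supp: "msupport \<nu> \<subseteq> unit_cube"
    using assms(3) interior_subset unfolding unit_cube_def by blast
  interpret I: info_rate_limit \<nu> a C \<rho>
    unfolding info_rate_limit_def dyadic_measure_def dyadic_measure_axioms_def info_rate_limit_axioms_def
    using assms(1,2,4-8) supp by blast
  have eqs: "m = I.m" "M = I.M" "h = I.h" "D = I.D" "V = I.V"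
    using assms(9-13) I.Least_support I.Greatest_support I.entropy_dim_eq I.geom_quant_dim_eq I.V_def by auto
  note mb = I.m_bounds
  have sigma: "0 < sigma_minus \<nu>" "sigma_minus \<nu> \<le> I.m" "I.M \<le> sigma_plus \<nu>"
    using I.sigma_minus_bounds I.sigma_plus_ge assms(4) by auto
  note B = I.interval_bounds[OF mb(4) order_refl order_refl]
  have spread: "(sqrt I.M - sqrt I.m)\<^sup>2 \<le> (sqrt (sigma_plus \<nu>) - sqrt (sigma_minus \<nu>))\<^sup>2"
    using sigma by (intro I.sqrt_spread_mono) auto
  have gap: "0 \<le> I.h - I.D" using I.D_le_h by simp
  have conv: "convergent (entropy_rate \<nu>)" "convergent (geom_quant_ratio \<nu>)"
    using I.entropy_rate_tendsto I.geom_quant_ratio_tendsto unfolding convergent_def by auto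
  have small: "\<rho> = return borel I.h \<longleftrightarrow> (\<lambda>k. deriv (deriv (spectrum \<nu> k)) 1) \<in> o(\<lambda>k. real k)"
    using I.second_deriv_smallo_iff I.V_eq_0_iff by simp
  have interval: "\<alpha> * \<alpha>' / (\<alpha> + \<alpha>' - I.h) \<le> I.D \<and> I.D \<le> I.h \<and> 0 \<le> I.h - I.D \<and>
      I.h - I.D \<le> (sqrt \<alpha>' - sqrt \<alpha>)\<^sup>2 \<and> I.D / (I.h * \<alpha>') * I.V \<le> I.h - I.D \<and> I.h - I.D \<le> I.D / (I.h * \<alpha>) * I.V"
    if "{I.m..I.M} \<subseteq> {\<alpha>..\<alpha>'}" "{\<alpha>..\<alpha>'} \<subseteq> {0<..}" for \<alpha> \<alpha>'
  proof -
    have "\<alpha> \<le> I.m" "I.M \<le> \<alpha>'" using that(1) mb(2) by auto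
    \<comment> \<open>The interval is nonempty and so contains its left end point \<alpha>, which is
      therefore positive.\<close>
    moreover from this have "0 < \<alpha>" using that(2) mb(2) by (force dest: subsetD[of _ _ \<alpha>])
    ultimately show ?thesis using I.interval_bounds[of \<alpha> \<alpha>'] I.D_le_h gap by blast
  qed
  have pointwise: "\<rho> = distr (completion \<nu>) borel s \<and> lower_hausdorff_dim \<nu> = I.m \<and> upper_packing_dim \<nu> = I.M"
    if "AE x in \<nu>. (\<lambda>k. info_rate \<nu> k x) \<longlonglongrightarrow> s x" for s
  proof -
    interpret J: info_rate_AE_limit \<nu> a C \<rho> s by unfold_locales (rule that)
    show ?thesis using J.rho_eq_completion J.lower_hausdorff_dim_eq J.upper_packing_dim_eq by blast
  qed
  have extremal: "I.m < I.M \<longrightarrow>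
      (I.m * I.M / (I.m + I.M - I.h) = I.D \<longleftrightarrow> measure \<rho> {I.m, I.M} = 1) \<and>
      (I.h - I.D = (sqrt I.M - sqrt I.m)\<^sup>2 \<longleftrightarrow>
         measure \<rho> {I.m} = sqrt I.m / (sqrt I.m + sqrt I.M) \<and>
         measure \<rho> {I.M} = sqrt I.M / (sqrt I.m + sqrt I.M))"
    using I.lower_bound_eq_iff I.max_gap_iff by blast
  have two_point: "\<forall>p s1 s2 :: real. 0 \<le> p \<longrightarrow> p \<le> 1 \<longrightarrow>
      (\<forall>A\<in>sets borel. measure \<rho> A =
         p * measure (return borel s1) A + (1 - p) * measure (return borel s2) A) \<longrightarrow>
      I.h - I.D = p * (1 - p) * (s1 - s2)\<^sup>2 / (p * s2 + (1 - p) * s1)"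
    by (intro allI impI) (rule I.two_point_gap)
  show ?thesis
    unfolding eqs
  proof (intro conjI I.m_in I.M_in I.support_between conv sigma mb(2) B I.D_le_h gap I.gap_representation
      I.gap_representation' I.second_deriv_tendsto I.h_eq_D_iff small extremal spread two_point)
    show "\<forall>s. (AE x in \<nu>. (\<lambda>k. info_rate \<nu> k x) \<longlonglongrightarrow> s x) \<longrightarrow>
        \<rho> = distr (completion \<nu>) borel s \<and>
        {I.m..I.M} = {lower_hausdorff_dim \<nu>..upper_packing_dim \<nu>} \<and>
        I.h - I.D \<le> (sqrt (upper_packing_dim \<nu>) - sqrt (lower_hausdorff_dim \<nu>))\<^sup>2 \<and>
        (sqrt (upper_packing_dim \<nu>) - sqrt (lower_hausdorff_dim \<nu>))\<^sup>2
          \<le> (sqrt (sigma_plus \<nu>) - sqrt (sigma_minus \<nu>))\<^sup>2"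
    proof (intro allI impI)
      fix s assume "AE x in \<nu>. (\<lambda>k. info_rate \<nu> k x) \<longlonglongrightarrow> s x"
      note s = pointwise[OF this]
      have dims: "lower_hausdorff_dim \<nu> = I.m" "upper_packing_dim \<nu> = I.M" using s by blast+
      show "\<rho> = distr (completion \<nu>) borel s \<and>
          {I.m..I.M} = {lower_hausdorff_dim \<nu>..upper_packing_dim \<nu>} \<and>
          I.h - I.D \<le> (sqrt (upper_packing_dim \<nu>) - sqrt (lower_hausdorff_dim \<nu>))\<^sup>2 \<and>
          (sqrt (upper_packing_dim \<nu>) - sqrt (lower_hausdorff_dim \<nu>))\<^sup>2
            \<le> (sqrt (sigma_plus \<nu>) - sqrt (sigma_minus \<nu>))\<^sup>2"
        unfolding dims by (intro conjI refl B(2) spread conjunct1[OF s])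
    qed
  qed (intro allI impI interval)
qed

end
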